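(* Let $G$ be a negatively curved group acting geometrically on two proper CAT(0) spaces $X_1$ and $X_2$, and let $\Lambda$ be the schmear of the pair $\partial X_1,\partial X_2$, with schmear maps $\phi_i:\Lambda\to\partial X_i$. Then there are a closed, possibly degenerate, bounded interval $I$ and a homeomorphism $h:\partial G\times I\to\Lambda$ such that the maps $\phi_i$ simply collapse the $I$-coordinate; that is, for $i=1,2$ and all $(\xi,s)\in\partial G\times I$, $\phi_i(h(\xi,s))=f_i(\xi)$, where $f_i:\partial G\to\partial X_i$ is the canonical homeomorphism induced by the orbit map.
   Context: A group acts geometrically if it acts properly discontinuously and cocompactly by isometries. A CAT(0) group is a group acting geometrically on some proper CAT(0) space; a negatively curved group is a $\delta$-hyperbolic CAT(0) group, and $\partial G$ is its Gromov boundary. For $G$ negatively curved acting geometrically on a proper CAT(0) space $X$, the orbit map induces a canonical homeomorphism from $\partial G$ to the visual boundary $\partial X$ (cone topology). $\overline X=X\cup\partial X$ denotes the corresponding compactification. Schmear. Let $G$ act geometrically on proper CAT(0) spaces $X_1,X_2$ with base points $x_i\in X_i$. Let $X=X_1\times X_2$ with the $\ell_2$-metric and base point $x=(x_1,x_2)$, and let $G$ act on $X$ diagonally: $g^\Delta(p,q)=(gp,gq)$. The schmear is $\Lambda=\overline{\{g^\Delta x: g\in G\}}\cap\partial X$ (closure in $\overline X$). A point $\zeta\in\partial X$ is represented by a unique unit speed ray $\alpha=(\alpha_1,\alpha_2)$ from $x$, where each $\alpha_i$ is a constant-speed geodesic in $X_i$ (possibly constant). For $\zeta\in\Lambda$ neither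 $\alpha_1$ nor $\alpha_2$ is constant, and the schmear maps are $\phi_i(\zeta)=\alpha_i(\infty)\in\partial X_i$. *)

theory Defs
  imports "HOL-Analysis.Analysis" "HOL-Algebra.Group_Action" "HOL-Algebra.Generated_Groups"
begin

section \<open>Proper CAT(0) spaces\<close>

definition proper_metric :: "'a metric \<Rightarrow> bool" where
  "proper_metric X \<longleftrightarrow> (\<forall>x\<in>mspace X. \<forall>r. compactin (mtopology_of X) (mcball_of X x r))"

definition geodesic_segment :: "'a metric \<Rightarrow> 'a \<Rightarrow> 'a \<Rightarrow> (real \<Rightarrow> 'a) \<Rightarrow> bool" where
  "geodesic_segment X x y c \<longleftrightarrow>
     c \<in> {0..mdist X x y} \<rightarrow> mspace X \<and> c 0 = x \<and> c (mdist X x y) = y \<and>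
     (\<forall>s\<in>{0..mdist X x y}. \<forall>t\<in>{0..mdist X x y}. mdist X (c s) (c t) = \<bar>s - t\<bar>)"

definition geodesic_metric :: "'a metric \<Rightarrow> bool" where
  "geodesic_metric X \<longleftrightarrow> (\<forall>x\<in>mspace X. \<forall>y\<in>mspace X. \<exists>c. geodesic_segment X x y c)"

text \<open>
  Any two sides of a geodesic triangle share a vertex, here called \<open>x\<close>, and the roles of the
  vertices are arbitrary. So it is enough to compare points on the sides \<open>[x,y]\<close> and \<open>[x,z]\<close>; their
  comparison points in the Euclidean plane are \<open>p\<close> and \<open>q\<close>.
\<close>

definition CAT0 :: "'a metric \<Rightarrow> bool" where
  "CAT0 X \<longleftrightarrow> geodesic_metric X \<and>
     (\<forall>x\<in>mspace X. \<forall>y\<in>mspace X. \<forall>z\<in>mspace X. \<forall>c c'.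
        geodesic_segment X x y c \<and> geodesic_segment X x z c' \<longrightarrow>
        (\<forall>x' y' z' :: real^2.
           dist x' y' = mdist X x y \<and> dist x' z' = mdist X x z \<and> dist y' z' = mdist X y z \<longrightarrow>
           (\<forall>p\<in>closed_segment x' y'. \<forall>q\<in>closed_segment x' z'.
              mdist X (c (dist x' p)) (c' (dist x' q)) \<le> dist p q)))"


section \<open>The visual boundary and the cone topology\<close>

text \<open>
  Rays are extensional functions on \<open>[0,\<infinity>)\<close>, so that a ray is determined by its values there.
\<close>

definition geodesic_ray :: "'a metric \<Rightarrow> (real \<Rightarrow> 'a) \<Rightarrow> bool" where
  "geodesic_ray X c \<longleftrightarrow>
     c \<in> {0..} \<rightarrow>\<^sub>E mspace X \<and> (\<forall>s\<ge>0. \<forall>t\<ge>0. mdist X (c s) (c t) = \<bar>s - t\<bar>)"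

definition asymptotic :: "'a metric \<Rightarrow> ((real \<Rightarrow> 'a) \<times> (real \<Rightarrow> 'a)) set" where
  "asymptotic X = {(c, c'). geodesic_ray X c \<and> geodesic_ray X c' \<and>
     (\<exists>K. \<forall>t\<ge>0. mdist X (c t) (c' t) \<le> K)}"

definition visual_boundary :: "'a metric \<Rightarrow> (real \<Rightarrow> 'a) set set" where
  "visual_boundary X = Collect (geodesic_ray X) // asymptotic X"

definition ray_from :: "'a metric \<Rightarrow> 'a \<Rightarrow> (real \<Rightarrow> 'a) set \<Rightarrow> real \<Rightarrow> 'a" where
  "ray_from X x0 \<zeta> = (THE c. c \<in> \<zeta> \<and> c 0 = x0)"

text \<open>
  The compactification is the disjoint union of the space and its visual boundary. The set
  \<open>cone_nbhd X x0 c r e\<close> consists of the points at distance more than \<open>r\<close> from \<open>x0\<close> (boundary points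
  being infinitely far away) whose projection to the closed ball of radius \<open>r\<close> about \<open>x0\<close> is
  \<open>e\<close>-close to \<open>c r\<close>. The projection of a point \<open>y\<close> outside the ball is the point at distance \<open>r\<close>
  from \<open>x0\<close> on the geodesic from \<open>x0\<close> to \<open>y\<close>.
\<close>

definition cone_nbhd ::
  "'a metric \<Rightarrow> 'a \<Rightarrow> (real \<Rightarrow> 'a) \<Rightarrow> real \<Rightarrow> real \<Rightarrow> ('a + (real \<Rightarrow> 'a) set) set" where
  "cone_nbhd X x0 c r e =
     Inl ` {y \<in> mspace X. mdist X x0 y > r \<and>
             (\<exists>\<sigma>. geodesic_segment X x0 y \<sigma> \<and> mdist X (\<sigma> r) (c r) < e)} \<union>
     Inr ` {\<zeta> \<in> visual_boundary X. mdist X (ray_from X x0 \<zeta> r) (c r) < e}"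

definition cone_topology :: "'a metric \<Rightarrow> 'a \<Rightarrow> ('a + (real \<Rightarrow> 'a) set) topology" where
  "cone_topology X x0 = topology_generated_by
     ({Inl ` mball_of X y r | y r. y \<in> mspace X \<and> r > 0} \<union>
      {cone_nbhd X x0 c r e | c r e. geodesic_ray X c \<and> c 0 = x0 \<and> r > 0 \<and> e > 0})"

definition visual_topology :: "'a metric \<Rightarrow> 'a \<Rightarrow> (real \<Rightarrow> 'a) set topology" where
  "visual_topology X x0 = pullback_topology (visual_boundary X) Inr (cone_topology X x0)"

text \<open>
  The point at infinity of a non-constant constant-speed geodesic \<open>\<beta>\<close> on \<open>[0,\<infinity>)\<close>, whose speed is the
  distance from \<open>\<beta> 0\<close> to \<open>\<beta> 1\<close>: the class of its unit speed reparametrization.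
\<close>

definition endpoint :: "'a metric \<Rightarrow> (real \<Rightarrow> 'a) \<Rightarrow> (real \<Rightarrow> 'a) set" where
  "endpoint X \<beta> = asymptotic X `` {\<lambda>t\<in>{0..}. \<beta> (t / mdist X (\<beta> 0) (\<beta> 1))}"


section \<open>Gromov hyperbolicity and the Gromov boundary\<close>

definition gromov_product :: "'a metric \<Rightarrow> 'a \<Rightarrow> 'a \<Rightarrow> 'a \<Rightarrow> real" where
  "gromov_product X w x y = (mdist X w x + mdist X w y - mdist X x y) / 2"

definition gromov_hyperbolic :: "'a metric \<Rightarrow> bool" where
  "gromov_hyperbolic X \<longleftrightarrow>
     (\<exists>\<delta>\<ge>0. \<forall>w\<in>mspace X. \<forall>x\<in>mspace X. \<forall>y\<in>mspace X. \<forall>z\<in>mspace X.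
        gromov_product X w x z \<ge> min (gromov_product X w x y) (gromov_product X w y z) - \<delta>)"

definition converges_to_infinity :: "'a metric \<Rightarrow> 'a \<Rightarrow> (nat \<Rightarrow> 'a) \<Rightarrow> bool" where
  "converges_to_infinity X w u \<longleftrightarrow> range u \<subseteq> mspace X \<and>
     filterlim (\<lambda>(i, j). gromov_product X w (u i) (u j)) at_top (sequentially \<times>\<^sub>F sequentially)"

definition gromov_equiv :: "'a metric \<Rightarrow> 'a \<Rightarrow> ((nat \<Rightarrow> 'a) \<times> (nat \<Rightarrow> 'a)) set" where
  "gromov_equiv X w = {(u, v). converges_to_infinity X w u \<and> converges_to_infinity X w v \<and>
     filterlim (\<lambda>(i, j). gromov_product X w (u i) (v j)) at_top (sequentially \<times>\<^sub>F sequentially)}"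

definition gromov_boundary :: "'a metric \<Rightarrow> 'a \<Rightarrow> (nat \<Rightarrow> 'a) set set" where
  "gromov_boundary X w = Collect (converges_to_infinity X w) // gromov_equiv X w"

definition gromov_nbhd :: "'a metric \<Rightarrow> 'a \<Rightarrow> (nat \<Rightarrow> 'a) set \<Rightarrow> real \<Rightarrow> (nat \<Rightarrow> 'a) set set" where
  "gromov_nbhd X w \<xi> r = {\<eta> \<in> gromov_boundary X w. \<exists>u\<in>\<xi>. \<exists>v\<in>\<eta>.
     \<forall>\<^sub>F (i, j) in sequentially \<times>\<^sub>F sequentially. gromov_product X w (u i) (v j) \<ge> r}"

text \<open>
  The sets \<open>gromov_nbhd X w \<xi> r\<close> need not be open; they form a neighbourhood basis at \<open>\<xi>\<close>.
\<close>

definition gromov_topology :: "'a metric \<Rightarrow> 'a \<Rightarrow> (nat \<Rightarrow> 'a) set topology" where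
  "gromov_topology X w = topology (\<lambda>U. U \<subseteq> gromov_boundary X w \<and>
     (\<forall>\<xi>\<in>U. \<exists>r. gromov_nbhd X w \<xi> r \<subseteq> U))"

lemma gromov_nbhd_antimono: "r \<le> s \<Longrightarrow> gromov_nbhd X w \<xi> s \<subseteq> gromov_nbhd X w \<xi> r"
proof -
  assume "r \<le> s"
  then have "(\<forall>\<^sub>F (i, j) in sequentially \<times>\<^sub>F sequentially. gromov_product X w (u i) (v j) \<ge> r)"
    if "(\<forall>\<^sub>F (i, j) in sequentially \<times>\<^sub>F sequentially. gromov_product X w (u i) (v j) \<ge> s)" for u v
    using that by (auto elim: eventually_mono)
  then show ?thesis
    unfolding gromov_nbhd_def by fast
qed

lemma openin_gromov_topology:
  "openin (gromov_topology X w) U \<longleftrightarrow>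
     U \<subseteq> gromov_boundary X w \<and> (\<forall>\<xi>\<in>U. \<exists>r. gromov_nbhd X w \<xi> r \<subseteq> U)"
proof -
  have "istopology (\<lambda>U. U \<subseteq> gromov_boundary X w \<and> (\<forall>\<xi>\<in>U. \<exists>r. gromov_nbhd X w \<xi> r \<subseteq> U))"
    unfolding istopology_def
  proof (intro conjI allI impI, goal_cases)
    case (2 S T)
    show ?case
    proof
      fix \<xi> assume "\<xi> \<in> S \<inter> T"
      then obtain r s where "gromov_nbhd X w \<xi> r \<subseteq> S" "gromov_nbhd X w \<xi> s \<subseteq> T"
        using 2 by blast
      then have "gromov_nbhd X w \<xi> (max r s) \<subseteq> S \<inter> T"
        using gromov_nbhd_antimono[of r "max r s" X w \<xi>] gromov_nbhd_antimono[of s "max r s" X w \<xi>]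
        by auto
      then show "\<exists>r. gromov_nbhd X w \<xi> r \<subseteq> S \<inter> T" by blast
    qed
  next
    case (4 K)
    show ?case
    proof
      fix \<xi> assume "\<xi> \<in> \<Union>K"
      then obtain V where "V \<in> K" "\<xi> \<in> V" by blast
      moreover obtain r where "gromov_nbhd X w \<xi> r \<subseteq> V"
        using 4 calculation by blast
      ultimately show "\<exists>r. gromov_nbhd X w \<xi> r \<subseteq> \<Union>K" by blast
    qed
  qed blast+
  then show ?thesis
    unfolding gromov_topology_def by (simp add: topology_inverse')
qed

lemma topspace_gromov_topology: "topspace (gromov_topology X w) = gromov_boundary X w"
proof -
  have "openin (gromov_topology X w) (gromov_boundary X w)"
    by (auto simp: openin_gromov_topology gromov_nbhd_def)
  then show ?thesis
    by (metis openin_gromov_topology openin_subset openin_topspace subset_antisym)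
qed

definition word_norm :: "('g, 'm) monoid_scheme \<Rightarrow> 'g set \<Rightarrow> 'g \<Rightarrow> nat" where
  "word_norm G S g = (LEAST n. \<exists>ws. length ws = n \<and> set ws \<subseteq> S \<union> m_inv G ` S \<and>
     foldr (mult G) ws (one G) = g)"

text \<open>
  The values outside the carrier are irrelevant, but \<^locale>\<open>Metric_space\<close> demands symmetry there too.
\<close>

definition word_dist :: "('g, 'm) monoid_scheme \<Rightarrow> 'g set \<Rightarrow> 'g \<Rightarrow> 'g \<Rightarrow> real" where
  "word_dist G S g h = (if g \<in> carrier G \<and> h \<in> carrier G
     then real (word_norm G S (m_inv G g \<otimes>\<^bsub>G\<^esub> h)) else 0)"

definition word_metric :: "('g, 'm) monoid_scheme \<Rightarrow> 'g set \<Rightarrow> 'g metric" where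
  "word_metric G S = metric (carrier G, word_dist G S)"

text \<open>
  A group with a finite generating set whose word metric is hyperbolic. The choice of the finite
  generating set affects neither hyperbolicity nor the boundary.
\<close>

definition hyperbolic_group :: "('g, 'm) monoid_scheme \<Rightarrow> 'g set \<Rightarrow> bool" where
  "hyperbolic_group G S \<longleftrightarrow> group G \<and> finite S \<and> S \<subseteq> carrier G \<and> generate G S = carrier G \<and>
     gromov_hyperbolic (word_metric G S)"

abbreviation group_boundary :: "('g, 'm) monoid_scheme \<Rightarrow> 'g set \<Rightarrow> (nat \<Rightarrow> 'g) set set" where
  "group_boundary G S \<equiv> gromov_boundary (word_metric G S) (one G)"

abbreviation group_boundary_topology ::
  "('g, 'm) monoid_scheme \<Rightarrow> 'g set \<Rightarrow> (nat \<Rightarrow> 'g) set topology" where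
  "group_boundary_topology G S \<equiv> gromov_topology (word_metric G S) (one G)"

context group
begin

abbreviation (input) is_word :: "'a set \<Rightarrow> 'a list \<Rightarrow> bool" where
  "is_word S ws \<equiv> set ws \<subseteq> S \<union> m_inv G ` S"

abbreviation (input) val :: "'a list \<Rightarrow> 'a" where
  "val ws \<equiv> foldr (mult G) ws \<one>"

lemma val_closed: "S \<subseteq> carrier G \<Longrightarrow> is_word S ws \<Longrightarrow> val ws \<in> carrier G"
  by (induction ws) auto

lemma val_append:
  "S \<subseteq> carrier G \<Longrightarrow> is_word S us \<Longrightarrow> is_word S vs \<Longrightarrow> val (us @ vs) = val us \<otimes> val vs"
proof (induction us)
  case Nil
  then show ?case using val_closed by simp
next
  case (Cons u us)
  have "u \<in> carrier G" "val us \<in> carrier G" "val vs \<in> carrier G"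
    using Cons.prems val_closed[of S us] val_closed[of S vs] by (auto simp del: foldr_append)
  then show ?case using Cons by (simp add: m_assoc)
qed

lemma val_inv:
  "S \<subseteq> carrier G \<Longrightarrow> is_word S ws \<Longrightarrow>
     \<exists>vs. length vs = length ws \<and> is_word S vs \<and> val vs = inv (val ws)"
proof (induction ws)
  case Nil
  then show ?case by simp
next
  case (Cons w ws)
  then obtain vs where vs: "length vs = length ws" "is_word S vs" "val vs = inv (val ws)"
    by auto
  have w: "w \<in> carrier G" "val ws \<in> carrier G"
    using Cons.prems val_closed[of S ws] by auto
  have iw: "is_word S [inv w]" using Cons.prems w by auto
  have "val (vs @ [inv w]) = inv (val ws) \<otimes> inv w"
    using val_append[OF Cons.prems(1) vs(2) iw] vs(3) w by simp
  then show ?case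
    using vs iw w by (intro exI[of _ "vs @ [inv w]"]) (auto simp: inv_mult_group)
qed

lemma val_surj:
  assumes "S \<subseteq> carrier G" "g \<in> generate G S"
  shows "\<exists>ws. is_word S ws \<and> val ws = g"
  using assms(2)
proof (induction rule: generate.induct)
  case one
  then show ?case by (intro exI[of _ "[]"]) simp
next
  case (incl h)
  then show ?case using assms(1) by (intro exI[of _ "[h]"]) auto
next
  case (inv h)
  then show ?case using assms(1) by (intro exI[of _ "[inv h]"]) auto
next
  case (eng g h)
  then obtain us vs where "is_word S us" "val us = g" "is_word S vs" "val vs = h" by blast
  then show ?case
    using val_append[OF assms(1), of us vs] by (intro exI[of _ "us @ vs"]) (simp del: foldr_append)
qed

lemma word_norm_le:
  "is_word S ws \<Longrightarrow> word_norm G S (val ws) \<le> length ws"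
  unfolding word_norm_def by (rule Least_le) blast

lemma word_norm_attained:
  assumes "S \<subseteq> carrier G" "generate G S = carrier G" "g \<in> carrier G"
  obtains ws where "length ws = word_norm G S g" "is_word S ws" "val ws = g"
proof -
  have "\<exists>n ws. length ws = n \<and> is_word S ws \<and> val ws = g"
    using val_surj[OF assms(1)] assms(2,3) by blast
  from LeastI_ex[OF this] show thesis
    using that unfolding word_norm_def by blast
qed

lemma word_norm_inv_le:
  assumes "S \<subseteq> carrier G" "generate G S = carrier G" "g \<in> carrier G"
  shows "word_norm G S (inv g) \<le> word_norm G S g"
proof -
  obtain ws where ws: "length ws = word_norm G S g" "is_word S ws" "val ws = g"
    using word_norm_attained[OF assms] .
  obtain vs where "length vs = length ws" "is_word S vs" "val vs = inv g"
    using val_inv[OF assms(1) ws(2)] ws(3) by auto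
  then show ?thesis using word_norm_le[of vs S] ws(1) by simp
qed

lemma word_norm_mult_le:
  assumes "S \<subseteq> carrier G" "generate G S = carrier G" "g \<in> carrier G" "h \<in> carrier G"
  shows "word_norm G S (g \<otimes> h) \<le> word_norm G S g + word_norm G S h"
proof -
  obtain us where us: "length us = word_norm G S g" "is_word S us" "val us = g"
    using word_norm_attained[OF assms(1-3)] .
  obtain vs where vs: "length vs = word_norm G S h" "is_word S vs" "val vs = h"
    using word_norm_attained[OF assms(1,2,4)] .
  have "is_word S (us @ vs)" using us(2) vs(2) by simp
  moreover have "val (us @ vs) = g \<otimes> h"
    using val_append[OF assms(1) us(2) vs(2)] us(3) vs(3) by (simp only:)
  ultimately show ?thesis using word_norm_le[of "us @ vs" S] us(1) vs(1) by (simp del: foldr_append)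
qed

lemma word_norm_eq_0_iff:
  assumes "S \<subseteq> carrier G" "generate G S = carrier G" "g \<in> carrier G"
  shows "word_norm G S g = 0 \<longleftrightarrow> g = \<one>"
proof
  assume "word_norm G S g = 0"
  moreover obtain ws where "length ws = word_norm G S g" "is_word S ws" "val ws = g"
    using word_norm_attained[OF assms] .
  ultimately show "g = \<one>" by auto
next
  assume "g = \<one>"
  then show "word_norm G S g = 0" using word_norm_le[of "[]" S] by simp
qed

lemma Metric_space_word_dist:
  assumes S: "S \<subseteq> carrier G" "generate G S = carrier G"
  shows "Metric_space (carrier G) (word_dist G S)"
proof
  fix x y
  have "word_norm G S (inv x \<otimes> y) \<le> word_norm G S (inv y \<otimes> x)"
    if "x \<in> carrier G" "y \<in> carrier G" for x y
    using word_norm_inv_le[OF S, of "inv y \<otimes> x"] that by (simp add: inv_mult_group)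
  then show "word_dist G S x y = word_dist G S y x"
    by (auto simp: word_dist_def intro: antisym)
next
  fix x y assume xy: "x \<in> carrier G" "y \<in> carrier G"
  have "inv x \<otimes> y = \<one> \<longleftrightarrow> x = y"
  proof
    assume "inv x \<otimes> y = \<one>"
    moreover have "x \<otimes> (inv x \<otimes> y) = y" using xy by (simp flip: m_assoc)
    ultimately show "x = y" using xy by simp
  qed (use xy in simp)
  then show "word_dist G S x y = 0 \<longleftrightarrow> x = y"
    using word_norm_eq_0_iff[OF S, of "inv x \<otimes> y"] xy by (simp add: word_dist_def)
next
  fix x y z assume xyz: "x \<in> carrier G" "y \<in> carrier G" "z \<in> carrier G"
  have "y \<otimes> (inv y \<otimes> z) = z" using xyz by (simp flip: m_assoc)
  then have "(inv x \<otimes> y) \<otimes> (inv y \<otimes> z) = inv x \<otimes> z" using xyz by (simp add: m_assoc)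
  then have "word_norm G S (inv x \<otimes> z) \<le> word_norm G S (inv x \<otimes> y) + word_norm G S (inv y \<otimes> z)"
    using word_norm_mult_le[OF S, of "inv x \<otimes> y" "inv y \<otimes> z"] xyz by simp
  then show "word_dist G S x z \<le> word_dist G S x y + word_dist G S y z"
    using xyz by (simp add: word_dist_def flip: of_nat_add)
qed (simp add: word_dist_def)

lemma
  assumes S: "S \<subseteq> carrier G" "generate G S = carrier G"
  shows mspace_word_metric: "mspace (word_metric G S) = carrier G"
    and mdist_word_metric: "mdist (word_metric G S) = word_dist G S"
  using Metric_space_word_dist[OF S]
  by (simp_all add: word_metric_def Metric_space.mspace_metric Metric_space.mdist_metric)

end


section \<open>Geometric actions\<close>

definition acts_geometrically ::
  "('g, 'm) monoid_scheme \<Rightarrow> 'a metric \<Rightarrow> ('g \<Rightarrow> 'a \<Rightarrow> 'a) \<Rightarrow> bool" where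
  "acts_geometrically G X \<phi> \<longleftrightarrow> group_action G (mspace X) \<phi> \<and>
     (\<forall>g\<in>carrier G. \<forall>x\<in>mspace X. \<forall>y\<in>mspace X. mdist X (\<phi> g x) (\<phi> g y) = mdist X x y) \<and>
     (\<forall>K. compactin (mtopology_of X) K \<longrightarrow> finite {g \<in> carrier G. \<phi> g ` K \<inter> K \<noteq> {}}) \<and>
     (\<exists>K. compactin (mtopology_of X) K \<and> (\<Union>g\<in>carrier G. \<phi> g ` K) = mspace X)"

text \<open>
  The map from the Gromov boundary to the visual boundary induced by the orbit map \<open>g \<mapsto> \<phi> g x0\<close>.
\<close>

definition orbit_boundary_map ::
  "'a metric \<Rightarrow> ('g \<Rightarrow> 'a \<Rightarrow> 'a) \<Rightarrow> 'a \<Rightarrow> (nat \<Rightarrow> 'g) set \<Rightarrow> (real \<Rightarrow> 'a) set" where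
  "orbit_boundary_map X \<phi> x0 \<xi> = (THE \<eta>. \<eta> \<in> visual_boundary X \<and>
     (\<forall>u\<in>\<xi>. limitin (cone_topology X x0) (\<lambda>n. Inl (\<phi> (u n) x0)) (Inr \<eta>) sequentially))"


section \<open>The schmear\<close>

definition diagonal_action ::
  "('g \<Rightarrow> 'a \<Rightarrow> 'a) \<Rightarrow> ('g \<Rightarrow> 'b \<Rightarrow> 'b) \<Rightarrow> 'g \<Rightarrow> 'a \<times> 'b \<Rightarrow> 'a \<times> 'b" where
  "diagonal_action \<phi>1 \<phi>2 g = map_prod (\<phi>1 g) (\<phi>2 g)"

definition schmear ::
  "('g, 'm) monoid_scheme \<Rightarrow> 'a metric \<Rightarrow> ('g \<Rightarrow> 'a \<Rightarrow> 'a) \<Rightarrow> 'a \<Rightarrow>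
     'b metric \<Rightarrow> ('g \<Rightarrow> 'b \<Rightarrow> 'b) \<Rightarrow> 'b \<Rightarrow> (real \<Rightarrow> 'a \<times> 'b) set set" where
  "schmear G X1 \<phi>1 x1 X2 \<phi>2 x2 = {\<zeta> \<in> visual_boundary (prod_metric X1 X2).
     Inr \<zeta> \<in> cone_topology (prod_metric X1 X2) (x1, x2) closure_of
       (Inl ` orbit G (diagonal_action \<phi>1 \<phi>2) (x1, x2))}"

definition schmear_topology ::
  "('g, 'm) monoid_scheme \<Rightarrow> 'a metric \<Rightarrow> ('g \<Rightarrow> 'a \<Rightarrow> 'a) \<Rightarrow> 'a \<Rightarrow>
     'b metric \<Rightarrow> ('g \<Rightarrow> 'b \<Rightarrow> 'b) \<Rightarrow> 'b \<Rightarrow> (real \<Rightarrow> 'a \<times> 'b) set topology" where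
  "schmear_topology G X1 \<phi>1 x1 X2 \<phi>2 x2 =
     subtopology (visual_topology (prod_metric X1 X2) (x1, x2)) (schmear G X1 \<phi>1 x1 X2 \<phi>2 x2)"

definition schmear_map1 ::
  "'a metric \<Rightarrow> 'a \<Rightarrow> 'b metric \<Rightarrow> 'b \<Rightarrow> (real \<Rightarrow> 'a \<times> 'b) set \<Rightarrow> (real \<Rightarrow> 'a) set" where
  "schmear_map1 X1 x1 X2 x2 \<zeta> = endpoint X1 (fst \<circ> ray_from (prod_metric X1 X2) (x1, x2) \<zeta>)"

definition schmear_map2 ::
  "'a metric \<Rightarrow> 'a \<Rightarrow> 'b metric \<Rightarrow> 'b \<Rightarrow> (real \<Rightarrow> 'a \<times> 'b) set \<Rightarrow> (real \<Rightarrow> 'b) set" where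
  "schmear_map2 X1 x1 X2 x2 \<zeta> = endpoint X2 (snd \<circ> ray_from (prod_metric X1 X2) (x1, x2) \<zeta>)"

end

theory Submission
  imports Defs
begin

text \<open>
  Only convexity of the metric is used of the CAT(0) condition, and it passes to the product. The
  Morse lemma compares word geodesics with geodesics of \<open>X1\<close> and \<open>X2\<close>, so a sequence in \<open>G\<close>
  converges to \<open>\<xi>\<close> in the Gromov boundary if and only if its orbit converges to the corresponding
  point of \<open>\<partial>X1\<close>, and likewise for \<open>X2\<close>. A point of the schmear is therefore given by \<open>\<xi>\<close> and the
  limit of the slopes \<open>|g|\<^sub>1 / |g|\<close>, where \<open>|g|\<^sub>1\<close> and \<open>|g|\<close> are the displacements of the base
  points of \<open>X1\<close> and of the product. The set of limiting slopes is closed. It does not depend on \<open>\<xi>\<close>: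
  there is a constant \<open>C\<close> such that for all \<open>w\<close> and \<open>v\<close> some \<open>a\<close> of length at most \<open>C\<close> makes the
  Gromov product of \<open>inv w\<close> with \<open>a v\<close> or with \<open>a (inv v)\<close> at most \<open>C\<close>, so \<open>w a v\<close> or \<open>w a (inv v)\<close>
  points in the direction of \<open>w\<close> while its slope is close to that of a much longer \<open>v\<close>. (Otherwise \<open>G\<close>
  fixes a boundary point, which by discreteness makes every element a power-like translation along a
  ray up to a finite set, and then \<open>v\<close> and \<open>inv v\<close> point in different directions.) It is an interval
  because slopes change little along word geodesics far from the identity.
\<close>

section \<open>Hyperbolic graphs and stability of quasi-geodesics\<close>

text \<open>Hyperbolicity is available only in \<open>G\<close>: geodesics of \<open>X1\<close> and
  \<open>X2\<close> are therefore sampled by orbit points and pulled back to quasi-geodesics of the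
  word metric, and statements about directions become estimates of Gromov products in
  \<open>G\<close>. Thus one class \<xi> governs both factors, which are never compared with each
  other directly. The obstacle to independence of the slopes from \<xi> is cancellation: an element
  \<open>w\<close> chosen near \<xi> turns \<open>w v\<close> towards \<xi> only if \<open>v\<close>
  does not run back along \<open>inv w\<close>, and any correction must change displacements by an
  amount fixed before \<open>v\<close> is chosen, so that a longer \<open>v\<close> absorbs it.
  Trying \<open>inv v\<close> costs nothing because inversion preserves both displacements. Limiting
  slopes lie strictly between 0 and 1, since both orbit maps are quasi-isometric embeddings; hence
  time can be rescaled in either factor, and rays of \<open>X1\<close> and \<open>X2\<close> are
  recovered from a ray of the product.\<close>

definition discrete_geodesic :: "'p metric \<Rightarrow> 'p \<Rightarrow> 'p \<Rightarrow> (nat \<Rightarrow> 'p) \<Rightarrow> nat \<Rightarrow> bool" where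
  "discrete_geodesic X x y \<gamma> n \<longleftrightarrow> \<gamma> 0 = x \<and> \<gamma> n = y \<and> (\<forall>i\<le>n. \<gamma> i \<in> mspace X) \<and>
     (\<forall>i\<le>n. \<forall>j\<le>n. mdist X (\<gamma> i) (\<gamma> j) = \<bar>real i - real j\<bar>)"

lemma mdist_self [simp]: "x \<in> mspace X \<Longrightarrow> mdist X x x = 0"
  by simp

text \<open>Closes the self-referential estimate in the stability theorem: a distance that is
  logarithmic in a length which is linear in that same distance cannot be large.\<close>

lemma exp_le_linear_bounded:
  fixes a b :: real
  shows "\<exists>K. \<forall>k. 2 ^ k \<le> a + b * real k \<longrightarrow> k \<le> K"
proof -
  have "eventually (\<lambda>k::nat. a + b * real k < 2 ^ k) sequentially"
    by real_asymp
  then obtain K where "\<And>k. k \<ge> K \<Longrightarrow> a + b * real k < 2 ^ k"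
    by (auto simp: eventually_sequentially)
  then show ?thesis by (meson le_cases not_le)
qed

lemma triangle4:
  assumes "x \<in> mspace X" "y \<in> mspace X" "z \<in> mspace X" "w \<in> mspace X"
  shows "mdist X x w \<le> mdist X x y + mdist X y z + mdist X z w"
  using mdist_triangle[of x X y w] mdist_triangle[of y X z w] assms by simp

text \<open>The halving argument wants a power of two; rounding up costs a factor 2.\<close>

lemma ex_pow2_between:
  fixes r :: real assumes "1 \<le> r"
  shows "\<exists>k::nat. r \<le> 2 ^ k \<and> 2 ^ k \<le> 2 * r"
proof -
  obtain n where n: "r < 2 ^ n" using real_arch_pow[of 2 r] by auto
  define k where "k = (LEAST k. r \<le> 2 ^ k)"
  have 1: "r \<le> 2 ^ k" unfolding k_def by (rule LeastI[where k = n]) (use n in simp)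
  show ?thesis
  proof (cases k)
    case 0
    then show ?thesis using 1 assms by (intro exI[of _ 0]) auto
  next
    case (Suc l)
    then have "\<not> r \<le> 2 ^ l" using not_less_Least[of l "\<lambda>k. r \<le> 2 ^ k"] k_def by auto
    then show ?thesis using 1 Suc by (intro exI[of _ k]) auto
  qed
qed

text \<open>Discrete intermediate value property without monotonicity: \<open>j s\<close> will be
  the index of a point near the \<open>s\<close>-th vertex of a geodesic, and such indices may go
  back and forth.\<close>

lemma discrete_crossing:
  fixes j :: "nat \<Rightarrow> nat"
  assumes "j 0 \<le> i" "i \<le> j L"
  shows "\<exists>s\<le>L. j s \<le> i \<and> (i \<le> j (Suc s) \<and> Suc s \<le> L \<or> j s = i)"
  using assms
proof (induction L)
  case (Suc L)
  then show ?case by (cases "i \<le> j L") (use le_Suc_eq in \<open>auto intro: exI[of _ L]\<close>)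
qed auto

lemma mdist_chain:
  assumes "\<And>i. i \<le> n \<Longrightarrow> f i \<in> mspace X" "\<And>i. i < n \<Longrightarrow> mdist X (f i) (f (Suc i)) \<le> B"
  shows "mdist X (f 0) (f n) \<le> real n * B"
  using assms
proof (induction n)
  case (Suc n)
  have "mdist X (f 0) (f (Suc n)) \<le> mdist X (f 0) (f n) + mdist X (f n) (f (Suc n))"
    using Suc.prems by (intro mdist_triangle) auto
  moreover have "mdist X (f 0) (f n) \<le> real n * B" using Suc by simp
  moreover have "mdist X (f n) (f (Suc n)) \<le> B" using Suc.prems by simp
  ultimately show ?case by (simp add: algebra_simps)
qed simp

text \<open>The vertices alone form the space, with paths at integer times, as a word metric
  provides them. The four point condition is required at every base point because the stability
  argument looks from a point of a geodesic.\<close>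

locale hyperbolic_graph =
  fixes X :: "'p metric" and \<delta> :: real
  assumes delta_pos: "\<delta> > 0"
    and four_point: "\<And>w x y z. \<lbrakk>w \<in> mspace X; x \<in> mspace X; y \<in> mspace X; z \<in> mspace X\<rbrakk> \<Longrightarrow>
      min (gromov_product X w x y) (gromov_product X w y z) - \<delta> \<le> gromov_product X w x z"
    and discrete_geodesic_ex: "\<And>x y. \<lbrakk>x \<in> mspace X; y \<in> mspace X\<rbrakk> \<Longrightarrow>
      \<exists>\<gamma> n. discrete_geodesic X x y \<gamma> n"
begin

abbreviation "M \<equiv> mspace X"
abbreviation "d \<equiv> mdist X"
abbreviation "gp \<equiv> gromov_product X"

section \<open>Elementary estimates and chains of Gromov products\<close>

lemma gp_commute: "gp w x y = gp w y x"
  by (simp add: gromov_product_def mdist_commute)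

lemma gp_nonneg: "\<lbrakk>w \<in> M; x \<in> M; y \<in> M\<rbrakk> \<Longrightarrow> 0 \<le> gp w x y"
  unfolding gromov_product_def using mdist_triangle[of x X w y] mdist_commute[of X x w] by simp

lemma gp_le: "\<lbrakk>w \<in> M; x \<in> M; y \<in> M\<rbrakk> \<Longrightarrow> gp w x y \<le> d w x"
  unfolding gromov_product_def using mdist_triangle[of w X x y] by simp

lemma gp_le': "\<lbrakk>w \<in> M; x \<in> M; y \<in> M\<rbrakk> \<Longrightarrow> gp w x y \<le> d w y"
  using gp_le gp_commute by metis

lemma gp_ge: "\<lbrakk>w \<in> M; x \<in> M; y \<in> M\<rbrakk> \<Longrightarrow> d w x - d x y \<le> gp w x y"
  unfolding gromov_product_def
  using mdist_triangle[of w X y x] mdist_commute[of X x y] by simp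

lemma gp_self: "\<lbrakk>w \<in> M; x \<in> M\<rbrakk> \<Longrightarrow> gp w x x = d w x"
  unfolding gromov_product_def by simp

lemma five_point:
  assumes "w \<in> M" "x \<in> M" "y \<in> M" "z \<in> M" "u \<in> M"
  shows "min (gp w x y) (min (gp w y z) (gp w z u)) - 2 * \<delta> \<le> gp w x u"
  using four_point[of w x y u] four_point[of w y z u] assms delta_pos by linarith

text \<open>Bisection: joining two half chains costs one \<delta>, so a chain of
  \<open>2 ^ k\<close> links loses only k \<delta>. This logarithmic loss drives the stability
  theorem.\<close>

lemma gp_chain:
  assumes "w \<in> M" "\<And>i. i \<le> n \<Longrightarrow> q i \<in> M" "\<And>i. i < n \<Longrightarrow> B \<le> gp w (q i) (q (Suc i))"
    "1 \<le> n" "n \<le> 2 ^ k"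
  shows "B - real k * \<delta> \<le> gp w (q 0) (q n)"
  using assms
proof (induction k arbitrary: n q)
  case 0
  then have "n = 1" by simp
  then show ?case using "0.prems"(3)[of 0] by simp
next
  case (Suc k)
  show ?case
  proof (cases "n \<le> 2 ^ k")
    case True
    then have "B - real k * \<delta> \<le> gp w (q 0) (q n)"
      using Suc by blast
    then show ?thesis using delta_pos by (simp add: algebra_simps)
  next
    case False
    define m where "m = (2::nat) ^ k"
    have m: "1 \<le> m" "m < n" "n - m \<le> 2 ^ k" "m \<le> 2 ^ k" using False Suc.prems by (auto simp: m_def)
    have 1: "B - real k * \<delta> \<le> gp w (q 0) (q m)"
      using Suc.prems m by (intro Suc.IH) auto
    have 2: "B - real k * \<delta> \<le> gp w (q (0 + m)) (q ((n - m) + m))"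
      using Suc.prems m by (intro Suc.IH[where q = "\<lambda>i. q (i + m)"]) auto
    have "min (gp w (q 0) (q m)) (gp w (q m) (q n)) - \<delta> \<le> gp w (q 0) (q n)"
      using Suc.prems m by (intro four_point) auto
    then show ?thesis using 1 2 m by (simp add: algebra_simps)
  qed
qed

lemma discrete_geodesic_dist:
  "discrete_geodesic X x y \<gamma> n \<Longrightarrow> d x y = real n"
  unfolding discrete_geodesic_def by (metis abs_minus_commute abs_of_nat diff_zero le_refl of_nat_0 zero_le)

text \<open>One constant serves all bounds. The upper bound has no additive term, so consecutive
  points are at most \<open>A\<close> apart.\<close>

definition quasi_geodesic :: "real \<Rightarrow> (nat \<Rightarrow> 'p) \<Rightarrow> nat \<Rightarrow> bool" where
  "quasi_geodesic A q n \<longleftrightarrow> (\<forall>i\<le>n. q i \<in> M) \<and>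
     (\<forall>i\<le>n. \<forall>j\<le>n. d (q i) (q j) \<le> A * \<bar>real i - real j\<bar> \<and>
        \<bar>real i - real j\<bar> \<le> A * d (q i) (q j) + A)"

text \<open>Consecutive points are at most \<open>A\<close> apart, so seen from \<open>p\<close>
  each link has Gromov product at least \<open>D - A\<close>; the rest is \<open>gp_chain\<close>,
  in either direction.\<close>

lemma quasi_geodesic_chain:
  assumes A: "1 \<le> A" and q: "quasi_geodesic A q n" and ij: "i \<le> n" "j \<le> n" and p: "p \<in> M"
    and D: "\<And>l. l \<le> n \<Longrightarrow> D \<le> d p (q l)" and k: "\<bar>real i - real j\<bar> \<le> 2 ^ k"
  shows "D - A - real k * \<delta> \<le> gp p (q i) (q j)"
proof -
  have *: "D - A - real k * \<delta> \<le> gp p (q i) (q j)"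
    if ij: "i \<le> j" "j \<le> n" and k: "\<bar>real i - real j\<bar> \<le> 2 ^ k" for i j
  proof (cases "i = j")
    case True
    have "D \<le> gp p (q i) (q j)"
      using True q that D[of i] p gp_self[of p "q i"] by (auto simp: quasi_geodesic_def)
    then show ?thesis using A delta_pos by (smt (verit) mult_nonneg_nonneg of_nat_0_le_iff)
  next
    case False
    have "D - A - real k * \<delta> \<le> gp p (q (i + 0)) (q (i + (j - i)))"
    proof (rule gp_chain[where q = "\<lambda>l. q (i + l)"])
      show "j - i \<le> 2 ^ k"
        using k that by (metis abs_minus_commute abs_of_nat of_nat_diff of_nat_le_iff of_nat_numeral of_nat_power)
      show "D - A \<le> gp p (q (i + l)) (q (i + Suc l))" if "l < j - i" for l
      proof -
        have l: "i + l \<le> n" "i + Suc l \<le> n" using that ij by auto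
        then have "d (q (i + l)) (q (i + Suc l)) \<le> A * \<bar>real (i + l) - real (i + Suc l)\<bar>"
          using q unfolding quasi_geodesic_def by blast
        moreover have "d p (q (i+l)) - d (q (i + l)) (q (i + Suc l)) \<le> gp p (q (i + l)) (q (i + Suc l))"
          using q l p by (intro gp_ge) (auto simp: quasi_geodesic_def)
        ultimately show ?thesis using D[of "i + l"] l by simp
      qed
    qed (use q p False ij in \<open>auto simp: quasi_geodesic_def\<close>)
    then show ?thesis using ij by simp
  qed
  show ?thesis
  proof (cases "i \<le> j")
    case True
    then show ?thesis using * ij k by blast
  next
    case False
    then have "D - A - real k * \<delta> \<le> gp p (q j) (q i)"
      using *[of j i] ij k by (simp add: abs_minus_commute)
    then show ?thesis by (simp add: gp_commute)
  qed
qed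

text \<open>
  Seen from the point of the geodesic farthest from the quasi-geodesic, at distance \<open>D\<close>, the
  geodesic makes an angle of \<open>\<pi>\<close>, while a detour through the quasi-geodesic of length linear in \<open>D\<close>
  keeps the Gromov product above \<open>D - O(log D)\<close>.
\<close>

lemma geodesic_near_quasi_geodesic:
  assumes A: "1 \<le> A"
  obtains C where "0 \<le> C" "\<And>\<gamma> L q n s. \<lbrakk>quasi_geodesic A q n; discrete_geodesic X (q 0) (q n) \<gamma> L; s \<le> L\<rbrakk>
    \<Longrightarrow> \<exists>j\<le>n. d (\<gamma> s) (q j) \<le> C"
proof -
  \<comment> \<open>Substituting A + 2\<delta> + k\<delta> for \<open>D\<close> into
    \<open>2 * r\<close>, where \<open>r\<close> bounds the number of links of the detour, gives a +
    b k.\<close>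
  define a b where "a = 2 * (A * (6 * (A + 2 * \<delta>) + 2) + A + 1)" and "b = 12 * A * \<delta>"
  obtain K where K: "\<And>k. 2 ^ k \<le> a + b * real k \<Longrightarrow> k \<le> K"
    using exp_le_linear_bounded[of a b] by blast
  define C where "C = A + 2 * \<delta> + real K * \<delta>"
  have C0: "0 \<le> C" using A delta_pos by (simp add: C_def)
  have "\<exists>j\<le>n. d (\<gamma> s) (q j) \<le> C"
    if q: "quasi_geodesic A q n" and \<gamma>: "discrete_geodesic X (q 0) (q n) \<gamma> L" and s: "s \<le> L" for \<gamma> L q n s
  proof -
    have qM: "q i \<in> M" if "i \<le> n" for i using q that by (simp add: quasi_geodesic_def)
    have gM: "\<gamma> i \<in> M" if "i \<le> L" for i using \<gamma> that by (simp add: discrete_geodesic_def)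
    have gd: "d (\<gamma> i) (\<gamma> j) = \<bar>real i - real j\<bar>" if "i \<le> L" "j \<le> L" for i j
      using \<gamma> that by (simp add: discrete_geodesic_def)
    define dq where "dq t = Min ((\<lambda>j. d (\<gamma> t) (q j)) ` {..n})" for t
    have dq_le: "dq t \<le> d (\<gamma> t) (q j)" if "j \<le> n" for t j
      unfolding dq_def using that by (intro Min_le) auto
    have dq_ex: "\<exists>j\<le>n. d (\<gamma> t) (q j) = dq t" for t
    proof -
      have "dq t \<in> (\<lambda>j. d (\<gamma> t) (q j)) ` {..n}" unfolding dq_def by (intro Min_in) auto
      then show ?thesis by auto
    qed
    define D where "D = Max (dq ` {..L})"
    have D_ge: "dq t \<le> D" if "t \<le> L" for t
      unfolding D_def using that by (intro Max_ge) auto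
    have "D \<in> dq ` {..L}" unfolding D_def by (intro Max_in) auto
    then obtain s0 where s0: "s0 \<le> L" "dq s0 = D" by auto
    define p where "p = \<gamma> s0"
    have pM: "p \<in> M" using gM s0 p_def by simp
    have Dp: "D \<le> d p (q l)" if "l \<le> n" for l using dq_le[OF that, of s0] s0 p_def by simp
    have D0: "0 \<le> D" using dq_ex[of s0] s0 by (metis mdist_nonneg)
    \<comment> \<open>At distance \<open>m\<close>, at least 2D, from \<open>p\<close>, a point of
      \<gamma> and its nearest point of \<open>q\<close> have Gromov product at least (2D + D - D) /
      2 = D as seen from \<open>p\<close>.\<close>
    define m where "m = nat \<lceil>2 * D\<rceil>"
    have m: "2 * D \<le> real m" "real m \<le> 2 * D + 1" using D0 unfolding m_def by linarith+
    have near: "\<exists>i\<le>n. D \<le> gp p (\<gamma> t) (q i) \<and> d (\<gamma> t) (q i) \<le> D"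
      if t: "t \<le> L" "(\<gamma> t = q 0 \<or> \<gamma> t = q n) \<or> d p (\<gamma> t) = real m" for t
    proof -
      have *: ?thesis if "\<gamma> t = q i" "i \<le> n" for i
        using Dp[of i] that gp_self[OF pM, of "q i"] qM D0 by (intro exI[of _ i]) auto
      have **: ?thesis if dm: "d p (\<gamma> t) = real m"
      proof -
        obtain i where i: "i \<le> n" "d (\<gamma> t) (q i) = dq t" using dq_ex by blast
        have "D \<le> gp p (\<gamma> t) (q i)"
          using dm Dp[OF i(1)] i(2) D_ge[OF t(1)] m unfolding gromov_product_def by simp
        then show ?thesis using i D_ge[OF t(1)] by auto
      qed
      show ?thesis using t(2) *[of 0] *[of n] ** by auto
    qed
    \<comment> \<open>The window around \<open>s0\<close> is cut off at the ends of \<gamma>: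
      subtraction truncates at 0, and there \<gamma> meets \<open>q\<close>, so \<open>near\<close>
      applies in every case.\<close>
    define a' b' where "a' = s0 - m" and "b' = min (s0 + m) L"
    have ab: "a' \<le> s0" "s0 \<le> b'" "b' \<le> L" using s0 by (auto simp: a'_def b'_def)
    have ga: "\<gamma> a' = q 0 \<or> d p (\<gamma> a') = real m" "d p (\<gamma> a') \<le> real m"
      using \<gamma> ab s0 by (auto simp: a'_def p_def gd discrete_geodesic_def)
    have gb: "\<gamma> b' = q n \<or> d p (\<gamma> b') = real m" "d p (\<gamma> b') \<le> real m"
      using \<gamma> ab s0 by (auto simp: b'_def p_def gd discrete_geodesic_def min_def)
    obtain i where i: "i \<le> n" "D \<le> gp p (\<gamma> a') (q i)" "d (\<gamma> a') (q i) \<le> D"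
      using near[of a'] ga ab s0 by auto
    obtain j where j: "j \<le> n" "D \<le> gp p (\<gamma> b') (q j)" "d (\<gamma> b') (q j) \<le> D"
      using near[of b'] gb ab s0 by auto
    have "d (q i) (q j) \<le> 6 * D + 2"
      using mdist_triangle[of "q i" X "\<gamma> a'" "q j"] mdist_triangle[of "\<gamma> a'" X "\<gamma> b'" "q j"]
        mdist_triangle[of "\<gamma> a'" X p "\<gamma> b'"] mdist_commute[of X "\<gamma> a'" p] mdist_commute[of X "\<gamma> a'" "q i"]
        i j ga gb m qM gM pM ab s0 by simp
    moreover have "\<bar>real i - real j\<bar> \<le> A * d (q i) (q j) + A"
      using q i j unfolding quasi_geodesic_def by blast
    ultimately have ij: "\<bar>real i - real j\<bar> \<le> A * (6 * D + 2) + A"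
      using A by (smt (verit) mult_left_mono)
    define r where "r = A * (6 * D + 2) + A + 1"
    have "1 \<le> r" using A D0 unfolding r_def by (smt (verit) mult_nonneg_nonneg)
    then obtain k where k: "r \<le> 2 ^ k" "2 ^ k \<le> 2 * r"
      using ex_pow2_between by blast
    have "D - A - real k * \<delta> \<le> gp p (q i) (q j)"
      by (rule quasi_geodesic_chain[OF A q i(1) j(1) pM Dp]) (use ij k r_def in auto)
    moreover have "gp p (\<gamma> a') (\<gamma> b') = 0"
      using ab s0 by (simp add: gromov_product_def p_def gd)
    moreover have "min (gp p (\<gamma> a') (q i)) (min (gp p (q i) (q j)) (gp p (q j) (\<gamma> b'))) - 2 * \<delta> \<le> gp p (\<gamma> a') (\<gamma> b')"
      using pM gM qM i j ab s0 by (intro five_point) auto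
    moreover have "0 \<le> real k * \<delta>" using delta_pos by simp
    ultimately have Dk: "D \<le> A + 2 * \<delta> + real k * \<delta>"
      using i j A gp_commute[of p "q j"] by (smt (verit))
    \<comment> \<open>\<open>D\<close> is at most linear in \<open>k\<close>, and
      \<open>2 ^ k\<close> at most linear in \<open>D\<close>: only boundedly many \<open>k\<close>
      remain.\<close>
    have "2 ^ k \<le> 2 * (A * (6 * (A + 2 * \<delta> + real k * \<delta>) + 2) + A + 1)"
      using k(2) Dk A unfolding r_def by (smt (verit) mult_left_mono)
    also have "\<dots> = a + b * real k" by (simp add: a_def b_def algebra_simps)
    finally have "k \<le> K" by (rule K)
    then have "real k * \<delta> \<le> real K * \<delta>" using delta_pos by (intro mult_right_mono) auto
    then have "D \<le> C" using Dk by (simp add: C_def)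
    then show ?thesis using dq_ex[of s] D_ge[OF s] by (smt (verit))
  qed
  then show thesis using that C0 by blast
qed

text \<open>Each vertex of \<gamma> is near some \<open>q (j s)\<close>, with index 0 at the start
  and \<open>n\<close> at the end. A unit step along \<gamma> changes this index by a bounded
  amount, so no index \<open>i\<close> is far from all of them.\<close>

lemma quasi_geodesic_near_geodesic:
  assumes A: "1 \<le> A"
  obtains C where "0 \<le> C" "\<And>\<gamma> L q n i. \<lbrakk>quasi_geodesic A q n; discrete_geodesic X (q 0) (q n) \<gamma> L; i \<le> n\<rbrakk>
    \<Longrightarrow> \<exists>s\<le>L. d (\<gamma> s) (q i) \<le> C"
proof -
  obtain C where C: "0 \<le> C" "\<And>\<gamma> L q n s. \<lbrakk>quasi_geodesic A q n; discrete_geodesic X (q 0) (q n) \<gamma> L; s \<le> L\<rbrakk>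
    \<Longrightarrow> \<exists>j\<le>n. d (\<gamma> s) (q j) \<le> C"
    using geodesic_near_quasi_geodesic[OF A] by blast
  \<comment> \<open>\<open>A * (2 * C + 1) + A\<close> bounds the index jump in one step of
    \<gamma>; another factor \<open>A\<close> turns an index difference into a distance.\<close>
  define C' where "C' = C + A * (A * (2 * C + 1) + A)"
  have "\<exists>s\<le>L. d (\<gamma> s) (q i) \<le> C'"
    if q: "quasi_geodesic A q n" and \<gamma>: "discrete_geodesic X (q 0) (q n) \<gamma> L" and i: "i \<le> n" for \<gamma> L q n i
  proof -
    \<comment> \<open>For \<open>L = 0\<close> the requirements at the two ends would clash, hence
      the guard \<open>s \<noteq> 0\<close>; that case is settled separately, since
      \<open>q 0 = q n\<close> makes \<open>n\<close> small.\<close>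
    have "\<forall>s. \<exists>j. s \<le> L \<longrightarrow> j \<le> n \<and> d (\<gamma> s) (q j) \<le> C \<and> (s = 0 \<longrightarrow> j = 0) \<and> (s = L \<and> s \<noteq> 0 \<longrightarrow> j = n)"
    proof
      fix s
      show "\<exists>j. s \<le> L \<longrightarrow> j \<le> n \<and> d (\<gamma> s) (q j) \<le> C \<and> (s = 0 \<longrightarrow> j = 0) \<and> (s = L \<and> s \<noteq> 0 \<longrightarrow> j = n)"
      proof (cases "s = 0 \<or> s = L")
        case True
        then show ?thesis
          using \<gamma> q C(1)
          by (cases "s = 0") (auto simp: discrete_geodesic_def quasi_geodesic_def)
      next
        case False
        then show ?thesis using C(2)[OF q \<gamma>, of s] by blast
      qed
    qed
    then obtain j where j: "\<And>s. s \<le> L \<Longrightarrow> j s \<le> n \<and> d (\<gamma> s) (q (j s)) \<le> C \<and> (s = 0 \<longrightarrow> j s = 0) \<and> (s = L \<and> s \<noteq> 0 \<longrightarrow> j s = n)"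
      by metis
    have qd: "d (q i) (q l) \<le> A * \<bar>real i - real l\<bar>" "\<bar>real i - real l\<bar> \<le> A * d (q i) (q l) + A"
      if "i \<le> n" "l \<le> n" for i l using q that by (auto simp: quasi_geodesic_def)
    have qM: "q i \<in> M" if "i \<le> n" for i using q that by (simp add: quasi_geodesic_def)
    have gM: "\<gamma> i \<in> M" if "i \<le> L" for i using \<gamma> that by (simp add: discrete_geodesic_def)
    have fin: ?thesis if s: "s \<le> L" and l: "\<bar>real i - real (j s)\<bar> \<le> A * (2 * C + 1) + A" for s
    proof -
      have "d (\<gamma> s) (q i) \<le> d (\<gamma> s) (q (j s)) + d (q i) (q (j s))"
        using mdist_triangle[of "\<gamma> s" X "q (j s)" "q i"] gM[OF s] qM i j[OF s] mdist_commute[of X "q i"] by simp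
      also have "\<dots> \<le> C + A * (A * (2 * C + 1) + A)"
        using j[OF s] qd(1)[OF i, of "j s"] mult_left_mono[OF l, of A] A by linarith
      finally show ?thesis using s by (auto simp: C'_def)
    qed
    show ?thesis
    proof (cases "L = 0")
      case True
      then have "q 0 = q n" using \<gamma> unfolding discrete_geodesic_def by metis
      then have "real n \<le> A" using qd(2)[of 0 n] qM by simp
      then have "real i \<le> A * (2 * C + 1) + A" using i A C(1) 
        by (smt (verit) of_nat_mono mult_nonneg_nonneg)
      then show ?thesis using fin[of 0] j[of 0] by simp
    next
      case False
      then have "j 0 = 0" "j L = n" using j[of 0] j[of L] by auto
      then obtain s where s: "s \<le> L" "j s \<le> i" "i \<le> j (Suc s) \<and> Suc s \<le> L \<or> j s = i"
        using discrete_crossing[of j i L] i by auto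
      show ?thesis
      proof (cases "j s = i")
        case True
        then show ?thesis using fin[OF s(1)] A C(1) by (auto simp: add_nonneg_nonneg)
      next
        case False
        then have s': "i \<le> j (Suc s)" "Suc s \<le> L" using s by auto
        have "d (\<gamma> s) (\<gamma> (Suc s)) = 1" using \<gamma> s s' by (simp add: discrete_geodesic_def)
        then have "d (q (j s)) (q (j (Suc s))) \<le> 2 * C + 1"
          using mdist_triangle[of "q (j s)" X "\<gamma> s" "q (j (Suc s))"]
            mdist_triangle[of "\<gamma> s" X "\<gamma> (Suc s)" "q (j (Suc s))"] mdist_commute[of X "\<gamma> s" "q (j s)"]
            j[OF s(1)] j[OF s'(2)] gM[OF s(1)] gM[OF s'(2)] qM by simp
        then have "\<bar>real (j s) - real (j (Suc s))\<bar> \<le> A * (2 * C + 1) + A"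
          using qd(2)[of "j s" "j (Suc s)"] j[OF s(1)] j[OF s'(2)] A by (smt (verit) mult_left_mono)
        then show ?thesis using fin[OF s(1)] s(2) s'(1) by simp
      qed
    qed
  qed
  moreover have "0 \<le> C'" using C(1) A by (simp add: C'_def)
  ultimately show thesis using that by blast
qed

end

section \<open>Geodesic spaces with a convex metric\<close>

definition unit_speed :: "'a metric \<Rightarrow> real \<Rightarrow> (real \<Rightarrow> 'a) \<Rightarrow> bool" where
  "unit_speed X L c \<longleftrightarrow> c \<in> {0..L} \<rightarrow> mspace X \<and>
     (\<forall>s\<in>{0..L}. \<forall>t\<in>{0..L}. mdist X (c s) (c t) = \<bar>s - t\<bar>)"

lemma geodesic_segment_unit_speed:
  "geodesic_segment X x y c \<longleftrightarrow> unit_speed X (mdist X x y) c \<and> c 0 = x \<and> c (mdist X x y) = y"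
  unfolding geodesic_segment_def unit_speed_def by auto

lemma unit_speed_subset: "unit_speed X L c \<Longrightarrow> T \<le> L \<Longrightarrow> unit_speed X T c"
  unfolding unit_speed_def by auto

lemma unit_speed_in: "unit_speed X L c \<Longrightarrow> 0 \<le> t \<Longrightarrow> t \<le> L \<Longrightarrow> c t \<in> mspace X"
  unfolding unit_speed_def by auto

lemma unit_speed_dist:
  "unit_speed X L c \<Longrightarrow> 0 \<le> s \<Longrightarrow> s \<le> L \<Longrightarrow> 0 \<le> t \<Longrightarrow> t \<le> L \<Longrightarrow> mdist X (c s) (c t) = \<bar>s - t\<bar>"
  unfolding unit_speed_def by auto

lemma unit_speed_segment:
  assumes "unit_speed X L c" "0 \<le> t" "t \<le> L"
  shows "geodesic_segment X (c 0) (c t) c"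
  using assms unit_speed_dist[OF assms(1), of 0 t] unit_speed_subset[OF assms(1,3)]
  by (simp add: geodesic_segment_unit_speed)

lemma unit_speed_reverse:
  assumes "unit_speed X L c" "0 \<le> t" "t \<le> L"
  shows "geodesic_segment X (c t) (c 0) (\<lambda>s. c (t - s))"
  using assms unit_speed_dist[OF assms(1), of t 0]
  by (auto simp: geodesic_segment_unit_speed unit_speed_def)

lemma geodesic_ray_unit_speed: "geodesic_ray X c \<Longrightarrow> unit_speed X L c"
  unfolding geodesic_ray_def unit_speed_def by auto

lemma geodesic_ray_in: "geodesic_ray X c \<Longrightarrow> 0 \<le> t \<Longrightarrow> c t \<in> mspace X"
  unfolding geodesic_ray_def by auto

lemma geodesic_ray_dist:
  "geodesic_ray X c \<Longrightarrow> 0 \<le> s \<Longrightarrow> 0 \<le> t \<Longrightarrow> mdist X (c s) (c t) = \<bar>s - t\<bar>"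
  unfolding geodesic_ray_def by auto

lemma geodesic_ray_eqI:
  assumes "geodesic_ray X c" "geodesic_ray X c'" "\<And>t. 0 \<le> t \<Longrightarrow> c t = c' t"
  shows "c = c'"
  using assms unfolding geodesic_ray_def
  by (intro PiE_ext[of c "{0..}" _ c']) auto

lemma equiv_asymptotic: "equiv (Collect (geodesic_ray X)) (asymptotic X)"
proof (rule equivI)
  show "asymptotic X \<subseteq> Collect (geodesic_ray X) \<times> Collect (geodesic_ray X)"
    by (auto simp: asymptotic_def)
  show "refl_on (Collect (geodesic_ray X)) (asymptotic X)"
    by (auto simp: refl_on_def asymptotic_def geodesic_ray_dist intro!: exI[of _ 0])
  show "sym (asymptotic X)"
    by (auto simp: sym_def asymptotic_def mdist_commute)
  show "trans (asymptotic X)"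
  proof (rule transI)
    fix a b c assume "(a, b) \<in> asymptotic X" "(b, c) \<in> asymptotic X"
    then obtain K K' where r: "geodesic_ray X a" "geodesic_ray X b" "geodesic_ray X c"
      and "\<forall>t\<ge>0. mdist X (a t) (b t) \<le> K" "\<forall>t\<ge>0. mdist X (b t) (c t) \<le> K'"
      by (auto simp: asymptotic_def)
    then have "\<forall>t\<ge>0. mdist X (a t) (c t) \<le> K + K'"
      using mdist_triangle[OF geodesic_ray_in[OF r(1)] geodesic_ray_in[OF r(2)] geodesic_ray_in[OF r(3)]]
      by (smt (verit))
    then show "(a, c) \<in> asymptotic X" using r by (auto simp: asymptotic_def)
  qed
qed

text \<open>A chosen geodesic. In a convex space its values up to the distance of the endpoints are
  determined (\<open>geod_eq\<close>); beyond it they are unspecified.\<close>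

definition geod :: "'a metric \<Rightarrow> 'a \<Rightarrow> 'a \<Rightarrow> real \<Rightarrow> 'a" where
  "geod X x y = (SOME c. geodesic_segment X x y c)"

text \<open>Convergence to a boundary point in the cone topology, see
  \<open>limitin_cone_iff\<close>. For each \<open>r\<close> only the tail of the sequence matters,
  where the geodesics are longer than \<open>r\<close>.\<close>

definition converges_to_ray :: "'a metric \<Rightarrow> 'a \<Rightarrow> (nat \<Rightarrow> 'a) \<Rightarrow> (real \<Rightarrow> 'a) \<Rightarrow> bool" where
  "converges_to_ray X x0 y \<alpha> \<longleftrightarrow> filterlim (\<lambda>n. mdist X x0 (y n)) at_top sequentially \<and>
     (\<forall>r\<ge>0. (\<lambda>n. mdist X (geod X x0 (y n) r) (\<alpha> r)) \<longlonglongrightarrow> 0)"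

text \<open>Convexity for two geodesics with a common origin, in proportional parameters. In this
  form it yields uniqueness of geodesics and rays, and it can be checked in each factor of a
  product.\<close>

locale convex_space =
  fixes X :: "'a metric"
  assumes geodesic: "geodesic_metric X"
    and complete: "mcomplete_of X"
    and convex: "\<And>x y z c c' s. \<lbrakk>x \<in> mspace X; y \<in> mspace X; z \<in> mspace X;
      geodesic_segment X x y c; geodesic_segment X x z c'; 0 \<le> s; s \<le> 1\<rbrakk> \<Longrightarrow>
      mdist X (c (s * mdist X x y)) (c' (s * mdist X x z)) \<le> s * mdist X y z"
begin

lemma complete_limit:
  assumes f: "\<And>n. f n \<in> mspace X" and c: "\<And>e. 0 < e \<Longrightarrow> \<exists>N. \<forall>m\<ge>N. \<forall>n\<ge>N. mdist X (f m) (f n) < e"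
  shows "\<exists>l\<in>mspace X. (\<lambda>n. mdist X (f n) l) \<longlonglongrightarrow> 0"
proof -
  interpret Metric_space "mspace X" "mdist X" by simp
  have "MCauchy f" unfolding MCauchy_def using f c by blast
  then obtain l where "limitin mtopology f l sequentially"
    using complete by (auto simp: mcomplete_of_def mcomplete_def)
  then have "l \<in> mspace X" "(\<lambda>n. mdist X (f n) l) \<longlonglongrightarrow> 0"
    by (auto simp: limit_metric_sequentially LIMSEQ_iff) blast
  then show ?thesis by blast
qed

text \<open>Convexity at the fraction t/T, with the denominator cleared so that \<open>T = 0\<close>
  is included.\<close>

lemma unit_speed_scale:
  assumes c: "unit_speed X T c" "unit_speed X T c'" "c 0 = c' 0" and t: "0 \<le> t" "t \<le> T"
  shows "T * mdist X (c t) (c' t) \<le> t * mdist X (c T) (c' T)"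
proof (cases "T = 0")
  case False
  then have T: "T > 0" using t by simp
  have d: "mdist X (c 0) (c T) = T" "mdist X (c 0) (c' T) = T"
    using unit_speed_dist[OF c(1), of 0 T] unit_speed_dist[OF c(2), of 0 T] c(3) T by auto
  have "mdist X (c ((t/T) * mdist X (c 0) (c T))) (c' ((t/T) * mdist X (c 0) (c' T)))
      \<le> (t/T) * mdist X (c T) (c' T)"
    using unit_speed_segment[OF c(1), of T] unit_speed_segment[OF c(2), of T] c(3) T t
      unit_speed_in[OF c(1)] unit_speed_in[OF c(2)]
    by (intro convex) auto
  then show ?thesis using T d by (simp add: field_simps)
qed (use t in auto)

lemma unit_speed_scale_le:
  assumes c: "unit_speed X T c" "unit_speed X T c'" "c 0 = c' 0" and t: "0 \<le> t" "t \<le> T"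
    and C: "mdist X (c T) (c' T) \<le> C"
  shows "mdist X (c t) (c' t) \<le> C"
proof (cases "T = 0")
  case False
  then have "T * mdist X (c t) (c' t) \<le> T * mdist X (c T) (c' T)"
    using unit_speed_scale[OF c t] mult_right_mono[OF t(2) mdist_nonneg, of X "c T" "c' T"] by linarith
  then have "mdist X (c t) (c' t) \<le> mdist X (c T) (c' T)"
    by (rule mult_left_le_imp_le) (use False t in simp)
  then show ?thesis using C by simp
qed (use t C in auto)

text \<open>The common endpoint makes the distance at the far end 0, and this bound is inherited by
  all earlier times.\<close>

lemma geodesic_segment_eq:
  assumes "x \<in> mspace X" "y \<in> mspace X" "geodesic_segment X x y c" "geodesic_segment X x y c'"
    "0 \<le> t" "t \<le> mdist X x y"
  shows "c t = c' t"
proof -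
  have "mdist X (c t) (c' t) \<le> 0"
  proof (rule unit_speed_scale_le)
    show "unit_speed X (mdist X x y) c" "unit_speed X (mdist X x y) c'" "c 0 = c' 0"
      using assms(3,4) by (simp_all add: geodesic_segment_unit_speed)
    have "c (mdist X x y) = y" "c' (mdist X x y) = y"
      using assms(3,4) by (simp_all add: geodesic_segment_unit_speed)
    then show "mdist X (c (mdist X x y)) (c' (mdist X x y)) \<le> 0"
      using assms(2) by simp
  qed (use assms in auto)
  moreover have "c t \<in> mspace X" "c' t \<in> mspace X"
    using assms unit_speed_in by (auto simp: geodesic_segment_unit_speed)
  ultimately show ?thesis by (metis antisym mdist_nonneg mdist_zero)
qed

lemma geod_segment: "x \<in> mspace X \<Longrightarrow> y \<in> mspace X \<Longrightarrow> geodesic_segment X x y (geod X x y)"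
  unfolding geod_def using geodesic by (metis geodesic_metric_def someI_ex)

lemma geod_eq:
  assumes "x \<in> mspace X" "y \<in> mspace X" "geodesic_segment X x y c" "0 \<le> t" "t \<le> mdist X x y"
  shows "geod X x y t = c t"
  using geodesic_segment_eq[OF assms(1,2) geod_segment[OF assms(1,2)]] assms by blast

lemma geod_unit_speed:
  "x \<in> mspace X \<Longrightarrow> y \<in> mspace X \<Longrightarrow> T \<le> mdist X x y \<Longrightarrow> unit_speed X T (geod X x y)"
  using geod_segment unit_speed_subset by (metis geodesic_segment_unit_speed)

lemma geod_0 [simp]: "x \<in> mspace X \<Longrightarrow> y \<in> mspace X \<Longrightarrow> geod X x y 0 = x"
  using geod_segment by (metis geodesic_segment_unit_speed)

lemma geod_end [simp]: "x \<in> mspace X \<Longrightarrow> y \<in> mspace X \<Longrightarrow> geod X x y (mdist X x y) = y"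
  using geod_segment by (metis geodesic_segment_unit_speed)

lemma geod_in:
  "x \<in> mspace X \<Longrightarrow> y \<in> mspace X \<Longrightarrow> 0 \<le> t \<Longrightarrow> t \<le> mdist X x y \<Longrightarrow> geod X x y t \<in> mspace X"
  using geod_unit_speed unit_speed_in by (metis order_refl)

lemma geod_dist:
  "x \<in> mspace X \<Longrightarrow> y \<in> mspace X \<Longrightarrow> 0 \<le> s \<Longrightarrow> s \<le> mdist X x y \<Longrightarrow> 0 \<le> t \<Longrightarrow> t \<le> mdist X x y \<Longrightarrow>
    mdist X (geod X x y s) (geod X x y t) = \<bar>s - t\<bar>"
  using geod_unit_speed unit_speed_dist by (metis order_refl)

section \<open>Limits expressed by distances to the limit point\<close>

lemma dist_le_if_limit:
  assumes "(\<lambda>n. mdist X (f n) a) \<longlonglongrightarrow> 0" "(\<lambda>n. mdist X (g n) b) \<longlonglongrightarrow> 0"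
    and ab: "a \<in> mspace X" "b \<in> mspace X"
    and "eventually (\<lambda>n. f n \<in> mspace X \<and> g n \<in> mspace X \<and> mdist X (f n) (g n) \<le> C) sequentially"
  shows "mdist X a b \<le> C"
proof -
  have "eventually (\<lambda>n. mdist X a b \<le> mdist X (f n) a + mdist X (g n) b + C) sequentially"
    using assms(5)
  proof eventually_elim
    case (elim n)
    then show ?case
      using mdist_triangle[of a X "f n" b] mdist_triangle[of "f n" X "g n" b] ab mdist_commute[of X a "f n"]
      by simp
  qed
  moreover have "(\<lambda>n. mdist X (f n) a + mdist X (g n) b + C) \<longlonglongrightarrow> 0 + 0 + C"
    by (intro tendsto_add assms tendsto_const)
  ultimately show ?thesis
    using tendsto_le[of sequentially "\<lambda>n. mdist X (f n) a + mdist X (g n) b + C" C "\<lambda>_. mdist X a b" "mdist X a b"]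
    by simp
qed

lemma dist_tendsto:
  assumes "(\<lambda>n. mdist X (f n) a) \<longlonglongrightarrow> 0" "(\<lambda>n. mdist X (g n) b) \<longlonglongrightarrow> 0"
    and ab: "a \<in> mspace X" "b \<in> mspace X"
    and ev: "eventually (\<lambda>n. f n \<in> mspace X \<and> g n \<in> mspace X) sequentially"
  shows "(\<lambda>n. mdist X (f n) (g n)) \<longlonglongrightarrow> mdist X a b"
proof -
  have "eventually (\<lambda>n. norm (mdist X (f n) (g n) - mdist X a b) \<le> mdist X (f n) a + mdist X (g n) b) sequentially"
    using ev
  proof eventually_elim
    case (elim n)
    then show ?case
      using mdist_triangle[of a X "f n" b] mdist_triangle[of "f n" X "g n" b] ab mdist_commute[of X a "f n"]
       mdist_triangle[of "f n" X a "g n"] mdist_triangle[of a X b "g n"] mdist_commute[of X b "g n"]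
      by (auto simp: abs_le_iff)
  qed
  moreover have "(\<lambda>n. mdist X (f n) a + mdist X (g n) b) \<longlonglongrightarrow> 0 + 0"
    by (intro tendsto_add assms)
  ultimately have "(\<lambda>n. mdist X (f n) (g n) - mdist X a b) \<longlonglongrightarrow> 0"
    using Lim_null_comparison[of "\<lambda>n. mdist X (f n) (g n) - mdist X a b"] by simp
  then show ?thesis by (simp add: LIM_zero_iff)
qed

lemma limit_unique:
  assumes "(\<lambda>n. mdist X (f n) a) \<longlonglongrightarrow> 0" "(\<lambda>n. mdist X (f n) b) \<longlonglongrightarrow> 0"
    and ab: "a \<in> mspace X" "b \<in> mspace X"
    and ev: "eventually (\<lambda>n. f n \<in> mspace X) sequentially"
  shows "a = b"
proof -
  have "mdist X a b \<le> 0"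
    by (rule dist_le_if_limit[OF assms(1,2) ab]) (rule eventually_mono[OF ev], simp)
  then show ?thesis using ab by (metis antisym mdist_nonneg mdist_zero)
qed

lemma eventually_geod_in:
  assumes "x0 \<in> mspace X" "\<And>n. y n \<in> mspace X" "filterlim (\<lambda>n. mdist X x0 (y n)) at_top sequentially" "0 \<le> r"
  shows "eventually (\<lambda>n. geod X x0 (y n) r \<in> mspace X) sequentially"
proof -
  have "eventually (\<lambda>n. r \<le> mdist X x0 (y n)) sequentially"
    using assms(3) by (auto simp: filterlim_at_top)
  then show ?thesis by eventually_elim (use assms geod_in in auto)
qed

lemma converges_to_ray_unique:
  assumes x0: "x0 \<in> mspace X" and y: "\<And>n. y n \<in> mspace X"
    and "geodesic_ray X \<alpha>" "geodesic_ray X \<beta>" "converges_to_ray X x0 y \<alpha>" "converges_to_ray X x0 y \<beta>"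
  shows "\<alpha> = \<beta>"
proof (rule geodesic_ray_eqI[OF assms(3,4)])
  fix t :: real assume "0 \<le> t"
  then show "\<alpha> t = \<beta> t"
    using assms(3-6) eventually_geod_in[OF x0 y, where r = t] geodesic_ray_in
    by (intro limit_unique[of "\<lambda>n. geod X x0 (y n) t"]) (auto simp: converges_to_ray_def)
qed

text \<open>
  By convexity, geodesics from a common point that are still \<open>C\<close>-close at time \<open>T\<close> are
  \<open>Cr/T\<close>-close at time \<open>r\<close>; so boundedness at arbitrarily large times is a Cauchy condition.
\<close>

lemma ex_limit_ray:
  assumes x0: "x0 \<in> mspace X" and y: "\<And>n. y n \<in> mspace X"
    and C: "\<And>T. 0 \<le> T \<Longrightarrow> \<exists>N. \<forall>m\<ge>N. \<forall>n\<ge>N. T \<le> mdist X x0 (y m) \<and> T \<le> mdist X x0 (y n) \<and>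
      mdist X (geod X x0 (y m) T) (geod X x0 (y n) T) \<le> C"
  shows "\<exists>\<alpha>. geodesic_ray X \<alpha> \<and> \<alpha> 0 = x0 \<and> converges_to_ray X x0 y \<alpha>"
proof -
  have far: "filterlim (\<lambda>n. mdist X x0 (y n)) at_top sequentially"
    unfolding filterlim_at_top eventually_sequentially
  proof
    fix Z
    obtain N where "\<forall>m\<ge>N. \<forall>n\<ge>N. max 0 Z \<le> mdist X x0 (y m)" using C[of "max 0 Z"] by auto
    then show "\<exists>N. \<forall>n\<ge>N. Z \<le> mdist X x0 (y n)" by auto
  qed
  define C' where "C' = max C 1"
  have "\<exists>l\<in>mspace X. (\<lambda>n. mdist X (geod X x0 (y n) r) l) \<longlonglongrightarrow> 0" if r: "0 \<le> r" for r
  proof -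
    \<comment> \<open>Shifting by \<open>N0\<close> discards the finitely many geodesics that may be
      too short to be evaluated at \<open>r\<close>.\<close>
    obtain N0 where N0: "\<And>n. n \<ge> N0 \<Longrightarrow> r \<le> mdist X x0 (y n)"
      using C[OF r] by blast
    have "\<exists>l\<in>mspace X. (\<lambda>n. mdist X (geod X x0 (y (n + N0)) r) l) \<longlonglongrightarrow> 0"
    proof (rule complete_limit)
      show "geod X x0 (y (n + N0)) r \<in> mspace X" for n
        using N0 x0 y r by (intro geod_in) auto
      fix e :: real assume e: "0 < e"
      \<comment> \<open>Chosen so that r C' / T < e: points \<open>C'\<close>-close at time
        \<open>T\<close> are then \<open>e\<close>-close at time \<open>r\<close>.\<close>
      define T where "T = r + 2 * r * C' / e + 1"
      have T: "r \<le> T" "0 < T" using r e by (simp_all add: T_def C'_def add_nonneg_pos)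
      obtain N where N: "\<forall>m\<ge>N. \<forall>n\<ge>N. T \<le> mdist X x0 (y m) \<and> T \<le> mdist X x0 (y n) \<and>
          mdist X (geod X x0 (y m) T) (geod X x0 (y n) T) \<le> C" using C[of T] T by auto
      have rC: "r * C' < e * T"
      proof -
        have "e * T = e * r + 2 * (r * C') + e" using e by (simp add: T_def algebra_simps)
        moreover have "0 \<le> r * C'" "0 \<le> e * r" using r e by (auto simp: C'_def)
        ultimately show ?thesis using e by linarith
      qed
      have "mdist X (geod X x0 (y m) r) (geod X x0 (y n) r) < e" if "m \<ge> N" "n \<ge> N" for m n
      proof -
        have 1: "T \<le> mdist X x0 (y m)" "T \<le> mdist X x0 (y n)"
          "mdist X (geod X x0 (y m) T) (geod X x0 (y n) T) \<le> C'"
          using N that unfolding C'_def by (meson le_max_iff_disj)+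
        have "T * mdist X (geod X x0 (y m) r) (geod X x0 (y n) r) \<le> r * mdist X (geod X x0 (y m) T) (geod X x0 (y n) T)"
          using 1 T r x0 y by (intro unit_speed_scale geod_unit_speed) auto
        also have "\<dots> \<le> r * C'" using 1 r by (intro mult_left_mono) auto
        finally have "T * mdist X (geod X x0 (y m) r) (geod X x0 (y n) r) < T * e"
          using rC by (simp add: mult.commute)
        then show ?thesis using T by simp
      qed
      then show "\<exists>N. \<forall>m\<ge>N. \<forall>n\<ge>N. mdist X (geod X x0 (y (m + N0)) r) (geod X x0 (y (n + N0)) r) < e"
        by (intro exI[of _ N]) auto
    qed
    then obtain l where "l \<in> mspace X" "(\<lambda>n. mdist X (geod X x0 (y (n + N0)) r) l) \<longlonglongrightarrow> 0" by blast
    then show ?thesis using LIMSEQ_offset[of "\<lambda>n. mdist X (geod X x0 (y n) r) l" N0 0] by blast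
  qed
  then obtain l where l: "\<And>r. 0 \<le> r \<Longrightarrow> l r \<in> mspace X \<and> (\<lambda>n. mdist X (geod X x0 (y n) r) (l r)) \<longlonglongrightarrow> 0"
    by metis
  define \<alpha> where "\<alpha> = restrict l {0..}"
  have "geodesic_ray X \<alpha>"
    unfolding geodesic_ray_def
  proof (intro conjI allI impI)
    show "\<alpha> \<in> {0..} \<rightarrow>\<^sub>E mspace X" using l by (auto simp: \<alpha>_def)
    fix s t :: real assume st: "0 \<le> s" "0 \<le> t"
    have "(\<lambda>n. mdist X (geod X x0 (y n) s) (geod X x0 (y n) t)) \<longlonglongrightarrow> mdist X (l s) (l t)"
      using l[OF st(1)] l[OF st(2)] eventually_geod_in[OF x0 y far, where r = s] eventually_geod_in[OF x0 y far, where r = t] st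
      by (intro dist_tendsto) (auto intro: eventually_conj)
    moreover have "eventually (\<lambda>n. mdist X (geod X x0 (y n) s) (geod X x0 (y n) t) = \<bar>s - t\<bar>) sequentially"
    proof -
      have "eventually (\<lambda>n. max s t \<le> mdist X x0 (y n)) sequentially"
        using far unfolding filterlim_at_top by blast
      then show ?thesis by eventually_elim (use st x0 y in \<open>auto intro!: geod_dist\<close>)
    qed
    ultimately have "mdist X (l s) (l t) = \<bar>s - t\<bar>"
      using LIMSEQ_unique tendsto_eventually by fast
    then show "mdist X (\<alpha> s) (\<alpha> t) = \<bar>s - t\<bar>" using st by (simp add: \<alpha>_def)
  qed
  moreover have "\<alpha> 0 = x0"
  proof -
    have "(\<lambda>n. mdist X (geod X x0 (y n) 0) (l 0)) \<longlonglongrightarrow> 0" using l by auto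
    then show ?thesis using x0 y l by (simp add: \<alpha>_def LIMSEQ_const_iff)
  qed
  moreover have "converges_to_ray X x0 y \<alpha>"
    using far l by (auto simp: converges_to_ray_def \<alpha>_def)
  ultimately show ?thesis by blast
qed

text \<open>Read from the far end \<open>c n\<close>, the two geodesics have a common origin, and
  convexity keeps them within \<open>mdist X x0 (c 0)\<close> at proportional times. Their lengths
  differ by at most the same amount, which pays for passing to equal times; hence the factor
  2.\<close>

lemma geod_to_ray_near:
  assumes x0: "x0 \<in> mspace X" and c: "geodesic_ray X c" and n: "0 \<le> n" and t: "0 \<le> t" "t \<le> n"
    "t \<le> mdist X x0 (c n)"
  shows "mdist X (geod X x0 (c n) t) (c t) \<le> 2 * mdist X x0 (c 0)"
proof -
  define l where "l = mdist X x0 (c n)"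
  have M: "c n \<in> mspace X" "c 0 \<in> mspace X" using c n geodesic_ray_in by auto
  have ln: "\<bar>n - l\<bar> \<le> mdist X x0 (c 0)"
    using mdist_triangle[of x0 X "c 0" "c n"] mdist_triangle[of "c 0" X x0 "c n"] x0 M
      geodesic_ray_dist[OF c, of 0 n] n mdist_commute[of X x0 "c 0"] unfolding l_def by auto
  show ?thesis
  proof (cases "l = 0")
    case True
    then have "t = 0" using t by (simp add: l_def)
    then show ?thesis using x0 M by simp
  next
    case False
    then have l: "l > 0" unfolding l_def by (metis antisym_conv2 mdist_nonneg)
    define s where "s = 1 - t / l"
    have s: "0 \<le> s" "s \<le> 1" using t l by (auto simp: s_def l_def)
    have c1: "geodesic_segment X (c n) x0 (\<lambda>s. geod X x0 (c n) (l - s))"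
      using unit_speed_reverse[OF geod_unit_speed[OF x0 M(1) order_refl], of l] x0 M l
      by (simp add: l_def)
    have c2: "geodesic_segment X (c n) (c 0) (\<lambda>s. c (n - s))"
      using unit_speed_reverse[OF geodesic_ray_unit_speed[OF c], of n n] n by simp
    have "mdist X (c n) x0 = l" "mdist X (c n) (c 0) = n"
      using geodesic_ray_dist[OF c, of n 0] n by (auto simp: l_def mdist_commute)
    then have "mdist X (geod X x0 (c n) (l - s * l)) (c (n - s * n)) \<le> s * mdist X x0 (c 0)"
      using convex[OF M(1) x0 M(2) c1 c2 s] by simp
    moreover have "l - s * l = t" "n - s * n = n * t / l"
      using l by (simp_all add: s_def field_simps)
    moreover have "s * mdist X x0 (c 0) \<le> mdist X x0 (c 0)"
      using s by (simp add: mult_left_le_one_le)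
    ultimately have 1: "mdist X (geod X x0 (c n) t) (c (n * t / l)) \<le> mdist X x0 (c 0)" by simp
    have "\<bar>n * t / l - t\<bar> = (t / l) * \<bar>n - l\<bar>"
    proof -
      have "n * t / l - t = (t / l) * (n - l)" using l by (simp add: field_simps)
      then show ?thesis using t l by (simp add: abs_mult)
    qed
    also have "\<dots> \<le> \<bar>n - l\<bar>" using t l by (intro mult_left_le_one_le) (auto simp: l_def)
    finally have 2: "mdist X (c (n * t / l)) (c t) \<le> mdist X x0 (c 0)"
      using geodesic_ray_dist[OF c, of "n * t / l" t] n t l ln by simp
    show ?thesis
      using 1 2 mdist_triangle[of "geod X x0 (c n) t" X "c (n * t / l)" "c t"] geod_in[OF x0 M(1) t(1,3)]
        geodesic_ray_in[OF c, of t] geodesic_ray_in[OF c, of "n * t / l"] n t l by simp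
  qed
qed

text \<open>The new ray is the limit of the segments from \<open>x0\<close> to \<open>c n\<close>.
  These stay \<open>2 * d0\<close>-close to \<open>c\<close>, hence \<open>4 * d0\<close>-close to
  each other, and the first bound survives in the limit.\<close>

lemma ex_asymptotic_ray:
  assumes x0: "x0 \<in> mspace X" and c: "geodesic_ray X c"
  shows "\<exists>c'. (c, c') \<in> asymptotic X \<and> c' 0 = x0"
proof -
  define d0 where "d0 = mdist X x0 (c 0)"
  define y where "y n = c (real n)" for n :: nat
  have y: "y n \<in> mspace X" for n using geodesic_ray_in[OF c] by (simp add: y_def)
  have c0: "c 0 \<in> mspace X" using geodesic_ray_in[OF c] by simp
  have yfar: "real n - d0 \<le> mdist X x0 (y n)" for n
    using mdist_triangle[of "c 0" X x0 "y n"] x0 y c0 geodesic_ray_dist[OF c, of 0 "real n"]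
    by (simp add: y_def d0_def mdist_commute)
  have near: "mdist X (geod X x0 (y n) t) (c t) \<le> 2 * d0" if "0 \<le> t" "t + d0 \<le> real n" for n t
    using geod_to_ray_near[OF x0 c, of "real n" t] that yfar[of n] mdist_nonneg[of X x0 "c 0"] 
    unfolding y_def d0_def by linarith
  have "\<exists>\<alpha>. geodesic_ray X \<alpha> \<and> \<alpha> 0 = x0 \<and> converges_to_ray X x0 y \<alpha>"
  proof (rule ex_limit_ray[OF x0 y, where C = "4 * d0"])
    fix T :: real assume T: "0 \<le> T"
    obtain N :: nat where N: "T + d0 \<le> real N" using real_arch_simple by blast
    have "T \<le> mdist X x0 (y m) \<and> T \<le> mdist X x0 (y n) \<and> mdist X (geod X x0 (y m) T) (geod X x0 (y n) T) \<le> 4 * d0"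
      if "m \<ge> N" "n \<ge> N" for m n
    proof -
      have mn: "T + d0 \<le> real m" "T + d0 \<le> real n" using N that by linarith+
      then have "T \<le> mdist X x0 (y m)" "T \<le> mdist X x0 (y n)"
        using yfar[of m] yfar[of n] by linarith+
      then show ?thesis
        using near[OF T mn(1)] near[OF T mn(2)] mdist_triangle[of "geod X x0 (y m) T" X "c T" "geod X x0 (y n) T"]
          geod_in[OF x0 y T] geodesic_ray_in[OF c T] mdist_commute[of X "c T"] by fastforce
    qed
    then show "\<exists>N. \<forall>m\<ge>N. \<forall>n\<ge>N. T \<le> mdist X x0 (y m) \<and> T \<le> mdist X x0 (y n) \<and>
      mdist X (geod X x0 (y m) T) (geod X x0 (y n) T) \<le> 4 * d0" by blast
  qed
  then obtain \<alpha> where \<alpha>: "geodesic_ray X \<alpha>" "\<alpha> 0 = x0" "converges_to_ray X x0 y \<alpha>" by blast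
  have "mdist X (c t) (\<alpha> t) \<le> 2 * d0" if t: "0 \<le> t" for t
  proof -
    have "mdist X (\<alpha> t) (c t) \<le> 2 * d0"
    proof (rule dist_le_if_limit[where f = "\<lambda>n. geod X x0 (y n) t" and g = "\<lambda>n. c t"])
      obtain N :: nat where "t + d0 \<le> real N" using real_arch_simple by blast
      then have "\<forall>n\<ge>N. mdist X (geod X x0 (y n) t) (c t) \<le> 2 * d0"
        using near t by (smt (verit) of_nat_mono)
      then have "eventually (\<lambda>n. mdist X (geod X x0 (y n) t) (c t) \<le> 2 * d0) sequentially"
        by (auto simp: eventually_sequentially)
      moreover have "eventually (\<lambda>n. geod X x0 (y n) t \<in> mspace X) sequentially"
        using eventually_geod_in[OF x0 y _ t] \<alpha>(3) by (simp add: converges_to_ray_def)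
      ultimately show "\<forall>\<^sub>F n in sequentially. geod X x0 (y n) t \<in> mspace X \<and> c t \<in> mspace X \<and>
          mdist X (geod X x0 (y n) t) (c t) \<le> 2 * d0"
        by eventually_elim (use geodesic_ray_in[OF c t] in auto)
    qed (use \<alpha>(3) t geodesic_ray_in[OF \<alpha>(1) t] geodesic_ray_in[OF c t] in \<open>simp_all add: converges_to_ray_def\<close>)
    then show ?thesis by (simp add: mdist_commute)
  qed
  then show ?thesis using \<alpha> c by (auto simp: asymptotic_def)
qed

text \<open>Scaling from time \<open>T\<close> back to \<open>t\<close> multiplies a bounded
  distance by t/T, which tends to 0.\<close>

lemma asymptotic_rays_eq:
  assumes "(c, c') \<in> asymptotic X" "c 0 = c' 0"
  shows "c = c'"
proof -
  obtain K where r: "geodesic_ray X c" "geodesic_ray X c'" and K: "\<And>t. 0 \<le> t \<Longrightarrow> mdist X (c t) (c' t) \<le> K"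
    using assms(1) by (auto simp: asymptotic_def)
  have "c t = c' t" if t: "0 \<le> t" for t
  proof -
    have *: "mdist X (c t) (c' t) * T \<le> t * K" if T: "t \<le> T" for T
    proof -
      have "T * mdist X (c t) (c' t) \<le> t * mdist X (c T) (c' T)"
        using r assms(2) t T by (intro unit_speed_scale geodesic_ray_unit_speed)
      also have "\<dots> \<le> t * K" using K[of T] t T by (intro mult_left_mono) auto
      finally show ?thesis by (simp add: mult.commute)
    qed
    have "mdist X (c t) (c' t) = 0"
    proof (rule ccontr)
      assume "mdist X (c t) (c' t) \<noteq> 0"
      then have p: "mdist X (c t) (c' t) > 0" by (metis antisym_conv2 mdist_nonneg)
      define T where "T = max t ((t * K + 1) / mdist X (c t) (c' t))"
      have "t * K + 1 \<le> mdist X (c t) (c' t) * T" using p unfolding T_def by (simp add: field_simps max_def)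
      then show False using *[of T] by (simp add: T_def)
    qed
    then show ?thesis using r t geodesic_ray_in by (metis mdist_zero)
  qed
  then show ?thesis using geodesic_ray_eqI r by blast
qed

text \<open>Makes the description in \<open>ray_from\<close> meaningful: existence by
  \<open>ex_asymptotic_ray\<close>, uniqueness because asymptotic rays with the same origin
  coincide.\<close>

lemma ray_from_unique:
  assumes x0: "x0 \<in> mspace X" and z: "\<zeta> \<in> visual_boundary X"
  shows "\<exists>!c. c \<in> \<zeta> \<and> c 0 = x0"
proof -
  obtain c where c: "geodesic_ray X c" "\<zeta> = asymptotic X `` {c}"
    using z by (auto simp: visual_boundary_def elim: quotientE)
  obtain c' where c': "(c, c') \<in> asymptotic X" "c' 0 = x0" using ex_asymptotic_ray[OF x0 c(1)] by blast
  show ?thesis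
  proof (rule ex1I[of _ c'])
    show "c' \<in> \<zeta> \<and> c' 0 = x0" using c c' by simp
    fix b assume b: "b \<in> \<zeta> \<and> b 0 = x0"
    then have "(b, c') \<in> asymptotic X"
      using c c' equiv_asymptotic[of X] by (meson Image_singleton_iff equivE symE transE)
    then show "b = c'" using asymptotic_rays_eq[of b c'] b c'(2) by metis
  qed
qed

lemma ray_from:
  assumes x0: "x0 \<in> mspace X" and z: "\<zeta> \<in> visual_boundary X"
  shows "ray_from X x0 \<zeta> \<in> \<zeta>" "ray_from X x0 \<zeta> 0 = x0" "geodesic_ray X (ray_from X x0 \<zeta>)"
    "asymptotic X `` {ray_from X x0 \<zeta>} = \<zeta>"
proof -
  show 1: "ray_from X x0 \<zeta> \<in> \<zeta>" "ray_from X x0 \<zeta> 0 = x0"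
    unfolding ray_from_def using theI'[OF ray_from_unique[OF assms]] by blast+
  obtain c where c: "geodesic_ray X c" "\<zeta> = asymptotic X `` {c}"
    using z by (auto simp: visual_boundary_def elim: quotientE)
  then show "geodesic_ray X (ray_from X x0 \<zeta>)" using 1 by (auto simp: asymptotic_def)
  show "asymptotic X `` {ray_from X x0 \<zeta>} = \<zeta>"
    using 1 c equiv_class_eq[OF equiv_asymptotic] by auto
qed

section \<open>Boundary points and neighbourhoods at infinity\<close>

lemma class_in_boundary: "geodesic_ray X c \<Longrightarrow> asymptotic X `` {c} \<in> visual_boundary X"
  by (simp add: visual_boundary_def quotientI)

lemma in_own_class: "geodesic_ray X c \<Longrightarrow> c \<in> asymptotic X `` {c}"
  using equiv_class_self[OF equiv_asymptotic, of c X] by simp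

lemma ray_from_class:
  assumes "geodesic_ray X c" "c 0 = x0"
  shows "ray_from X x0 (asymptotic X `` {c}) = c"
  using ray_from_unique[of x0, OF _ class_in_boundary[OF assms(1)]] in_own_class[OF assms(1)]
    geodesic_ray_in[OF assms(1), of 0] assms(2) ray_from[of x0, OF _ class_in_boundary[OF assms(1)]] by auto

lemma Inl_cone_nbhd:
  assumes "x0 \<in> mspace X" "0 < r"
  shows "Inl y \<in> cone_nbhd X x0 c r e \<longleftrightarrow>
    y \<in> mspace X \<and> r < mdist X x0 y \<and> mdist X (geod X x0 y r) (c r) < e"
proof -
  have "geod X x0 y r = \<sigma> r" if "y \<in> mspace X" "r < mdist X x0 y" "geodesic_segment X x0 y \<sigma>" for \<sigma>
    using assms that by (intro geod_eq) auto
  moreover have "geodesic_segment X x0 y (geod X x0 y)" if "y \<in> mspace X" using assms that geod_segment by simp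
  ultimately have "(\<exists>\<sigma>. geodesic_segment X x0 y \<sigma> \<and> mdist X (\<sigma> r) (c r) < e) \<longleftrightarrow>
      mdist X (geod X x0 y r) (c r) < e" if "y \<in> mspace X" "r < mdist X x0 y"
    using that by metis
  then show ?thesis unfolding cone_nbhd_def by auto
qed

lemma Inr_cone_nbhd:
  "Inr \<zeta> \<in> cone_nbhd X x0 c r e \<longleftrightarrow> \<zeta> \<in> visual_boundary X \<and> mdist X (ray_from X x0 \<zeta> r) (c r) < e"
  unfolding cone_nbhd_def by auto

lemma openin_cone_nbhd:
  assumes "geodesic_ray X c" "c 0 = x0" "0 < r" "0 < e"
  shows "openin (cone_topology X x0) (cone_nbhd X x0 c r e)"
  unfolding cone_topology_def using assms
  by (intro topology_generated_by_Basis UnI2) blast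

text \<open>Geodesics from \<open>x0\<close> that are close at time \<open>R\<close> are at least as
  close at every earlier time.\<close>

lemma cone_nbhd_mono:
  assumes x0: "x0 \<in> mspace X" and c: "geodesic_ray X c" "c 0 = x0" and r: "0 < r" "r \<le> R" and e: "e' \<le> e"
  shows "cone_nbhd X x0 c R e' \<subseteq> cone_nbhd X x0 c r e"
proof
  fix z assume z: "z \<in> cone_nbhd X x0 c R e'"
  show "z \<in> cone_nbhd X x0 c r e"
  proof (cases z)
    case (Inl y)
    then have y: "y \<in> mspace X" "R < mdist X x0 y" "mdist X (geod X x0 y R) (c R) < e'"
      using z Inl_cone_nbhd[OF x0] r by auto
    have "mdist X (geod X x0 y r) (c r) \<le> mdist X (geod X x0 y R) (c R)"
    proof (rule unit_speed_scale_le)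
      show "unit_speed X R (geod X x0 y)" using x0 y by (intro geod_unit_speed) auto
      show "unit_speed X R c" using c(1) by (rule geodesic_ray_unit_speed)
    qed (use r x0 y c in auto)
    then show ?thesis using Inl y Inl_cone_nbhd[OF x0] r e by auto
  next
    case (Inr \<zeta>)
    then have y: "\<zeta> \<in> visual_boundary X" "mdist X (ray_from X x0 \<zeta> R) (c R) < e'"
      using z Inr_cone_nbhd by auto
    have "mdist X (ray_from X x0 \<zeta> r) (c r) \<le> mdist X (ray_from X x0 \<zeta> R) (c R)"
    proof (rule unit_speed_scale_le)
      show "unit_speed X R (ray_from X x0 \<zeta>)" "unit_speed X R c"
        using ray_from(3)[OF x0 y(1)] c(1) by (simp_all add: geodesic_ray_unit_speed)
      show "ray_from X x0 \<zeta> 0 = c 0" using ray_from(2)[OF x0 y(1)] c(2) by simp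
    qed (use r in auto)
    then show ?thesis using Inr y Inr_cone_nbhd e by auto
  qed
qed

text \<open>The triangle inequality at time \<open>r\<close>; it lets a basic set be replaced by one
  centred at the ray of a boundary point that it contains.\<close>

lemma cone_nbhd_recentre:
  assumes x0: "x0 \<in> mspace X" and c: "geodesic_ray X c" and a: "geodesic_ray X \<alpha>" and r: "0 < r"
  shows "cone_nbhd X x0 \<alpha> r (e - mdist X (\<alpha> r) (c r)) \<subseteq> cone_nbhd X x0 c r e"
proof
  fix z assume z: "z \<in> cone_nbhd X x0 \<alpha> r (e - mdist X (\<alpha> r) (c r))"
  have M: "\<alpha> r \<in> mspace X" "c r \<in> mspace X" using geodesic_ray_in[OF a, of r] geodesic_ray_in[OF c, of r] r by auto
  show "z \<in> cone_nbhd X x0 c r e"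
  proof (cases z)
    case (Inl y)
    then have "y \<in> mspace X" "r < mdist X x0 y" using z Inl_cone_nbhd[OF x0 r] by auto
    moreover have "mdist X (geod X x0 y r) (c r) \<le> mdist X (geod X x0 y r) (\<alpha> r) + mdist X (\<alpha> r) (c r)"
      using M calculation x0 r by (intro mdist_triangle geod_in) auto
    ultimately show ?thesis using Inl z Inl_cone_nbhd[OF x0 r] by auto
  next
    case (Inr \<zeta>)
    then have "\<zeta> \<in> visual_boundary X" using z Inr_cone_nbhd by auto
    moreover have "mdist X (ray_from X x0 \<zeta> r) (c r) \<le> mdist X (ray_from X x0 \<zeta> r) (\<alpha> r) + mdist X (\<alpha> r) (c r)"
      using M calculation x0 r by (intro mdist_triangle geodesic_ray_in[OF ray_from(3)]) auto
    ultimately show ?thesis using Inr z Inr_cone_nbhd by auto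
  qed
qed

text \<open>The topology is given by a subbasis. Induction over its generation shows that the
  neighbourhoods centred at the ray of \<zeta> itself form a local base: balls miss the boundary,
  recentring handles basic sets, and monotonicity handles intersections.\<close>

lemma cone_nbhd_base:
  assumes x0: "x0 \<in> mspace X" and U: "openin (cone_topology X x0) U" and z: "\<zeta> \<in> visual_boundary X" "Inr \<zeta> \<in> U"
  shows "\<exists>r>0. \<exists>e>0. cone_nbhd X x0 (ray_from X x0 \<zeta>) r e \<subseteq> U"
proof -
  note \<alpha> = ray_from[OF x0 z(1)]
  have "generate_topology_on ({Inl ` mball_of X y r | y r. y \<in> mspace X \<and> r > 0} \<union>
      {cone_nbhd X x0 c r e | c r e. geodesic_ray X c \<and> c 0 = x0 \<and> r > 0 \<and> e > 0}) U"
    using U unfolding cone_topology_def openin_topology_generated_by_iff .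
  then show ?thesis using z(2)
  proof (induction rule: generate_topology_on.induct)
    case (Int a b)
    then obtain r e r' e' where re: "r > 0" "e > 0" "cone_nbhd X x0 (ray_from X x0 \<zeta>) r e \<subseteq> a"
      "r' > 0" "e' > 0" "cone_nbhd X x0 (ray_from X x0 \<zeta>) r' e' \<subseteq> b" by blast
    have "cone_nbhd X x0 (ray_from X x0 \<zeta>) (max r r') (min e e') \<subseteq> cone_nbhd X x0 (ray_from X x0 \<zeta>) r e"
      "cone_nbhd X x0 (ray_from X x0 \<zeta>) (max r r') (min e e') \<subseteq> cone_nbhd X x0 (ray_from X x0 \<zeta>) r' e'"
      using re \<alpha> x0 by (intro cone_nbhd_mono; simp)+
    then show ?case using re by (intro exI[of _ "max r r'"] exI[of _ "min e e'"] conjI) auto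
  next
    case (Basis s)
    then obtain c r e where c: "geodesic_ray X c" "c 0 = x0" "r > 0" "e > 0" "s = cone_nbhd X x0 c r e" by auto
    then have "mdist X (ray_from X x0 \<zeta> r) (c r) < e" using Basis Inr_cone_nbhd by auto
    then show ?case
      using cone_nbhd_recentre[OF x0 c(1) \<alpha>(3) c(3), of e] c(3,5)
      by (intro exI[of _ r] exI[of _ "e - mdist X (ray_from X x0 \<zeta> r) (c r)"] conjI) simp_all
  qed (simp, blast)
qed

lemma limitin_cone_iff:
  assumes x0: "x0 \<in> mspace X" and y: "\<And>n. y n \<in> mspace X" and z: "\<zeta> \<in> visual_boundary X"
  shows "limitin (cone_topology X x0) (\<lambda>n. Inl (y n)) (Inr \<zeta>) sequentially \<longleftrightarrow>
    converges_to_ray X x0 y (ray_from X x0 \<zeta>)" (is "?L \<longleftrightarrow> ?R")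
proof
  note \<alpha> = ray_from[OF x0 z]
  assume L: ?L
  have ev: "eventually (\<lambda>n. r < mdist X x0 (y n) \<and> mdist X (geod X x0 (y n) r) (ray_from X x0 \<zeta> r) < e) sequentially"
    if "0 < r" "0 < e" for r e
  proof -
    have "Inr \<zeta> \<in> cone_nbhd X x0 (ray_from X x0 \<zeta>) r e"
      using z \<alpha> that geodesic_ray_in[OF \<alpha>(3), of r] by (simp add: Inr_cone_nbhd)
    then have "eventually (\<lambda>n. Inl (y n) \<in> cone_nbhd X x0 (ray_from X x0 \<zeta>) r e) sequentially"
      using L openin_cone_nbhd[OF \<alpha>(3,2) that] unfolding limitin_def by blast
    then show ?thesis by eventually_elim (use Inl_cone_nbhd[OF x0 that(1)] in auto)
  qed
  show ?R unfolding converges_to_ray_def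
  proof (intro conjI allI impI)
    show "filterlim (\<lambda>n. mdist X x0 (y n)) at_top sequentially"
      unfolding filterlim_at_top
    proof
      fix Z show "eventually (\<lambda>n. Z \<le> mdist X x0 (y n)) sequentially"
        by (rule eventually_mono[OF ev[of "max Z 1" 1]]) auto
    qed
    fix r :: real assume r: "0 \<le> r"
    show "(\<lambda>n. mdist X (geod X x0 (y n) r) (ray_from X x0 \<zeta> r)) \<longlonglongrightarrow> 0"
    proof (cases "r = 0")
      case True
      then show ?thesis using \<alpha> x0 y by simp
    next
      case False
      then show ?thesis
        using ev[of r] r by (auto simp: tendsto_iff intro: eventually_mono)
    qed
  qed
next
  assume R: ?R
  have "Inr \<zeta> \<in> topspace (cone_topology X x0)"
  proof -
    have "Inr \<zeta> \<in> cone_nbhd X x0 (ray_from X x0 \<zeta>) 1 1"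
      using z ray_from[OF x0 z] geodesic_ray_in[OF ray_from(3)[OF x0 z], of 1] by (simp add: Inr_cone_nbhd)
    then show ?thesis using openin_subset[OF openin_cone_nbhd[OF ray_from(3,2)[OF x0 z], of 1 1]] by auto
  qed
  moreover have "eventually (\<lambda>n. Inl (y n) \<in> U) sequentially"
    if U: "openin (cone_topology X x0) U" "Inr \<zeta> \<in> U" for U
  proof -
    obtain r e where re: "r > 0" "e > 0" "cone_nbhd X x0 (ray_from X x0 \<zeta>) r e \<subseteq> U"
      using cone_nbhd_base[OF x0 U(1) z U(2)] by blast
    have "eventually (\<lambda>n. r < mdist X x0 (y n)) sequentially"
      using R by (auto simp: converges_to_ray_def filterlim_at_top_dense)
    moreover have "eventually (\<lambda>n. mdist X (geod X x0 (y n) r) (ray_from X x0 \<zeta> r) < e) sequentially"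
      using R re order_tendstoD(2)[of _ 0 sequentially e] by (auto simp: converges_to_ray_def)
    ultimately show ?thesis
      by eventually_elim (use re Inl_cone_nbhd[OF x0 re(1)] y in auto)
  qed
  ultimately show ?L unfolding limitin_def by blast
qed

lemma in_closure_iff:
  assumes x0: "x0 \<in> mspace X" and A: "A \<subseteq> mspace X" and z: "\<zeta> \<in> visual_boundary X"
  shows "Inr \<zeta> \<in> cone_topology X x0 closure_of (Inl ` A) \<longleftrightarrow>
    (\<exists>y. range y \<subseteq> A \<and> converges_to_ray X x0 y (ray_from X x0 \<zeta>))" (is "?L \<longleftrightarrow> ?R")
proof
  note \<alpha> = ray_from[OF x0 z]
  assume L: ?L
  have "\<exists>y\<in>A. r < mdist X x0 y \<and> mdist X (geod X x0 y r) (ray_from X x0 \<zeta> r) < e" if "0 < r" "0 < e" for r e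
  proof -
    have "Inr \<zeta> \<in> cone_nbhd X x0 (ray_from X x0 \<zeta>) r e"
      using z \<alpha> that geodesic_ray_in[OF \<alpha>(3), of r] by (simp add: Inr_cone_nbhd)
    then obtain y where "y \<in> A" "Inl y \<in> cone_nbhd X x0 (ray_from X x0 \<zeta>) r e"
      using L openin_cone_nbhd[OF \<alpha>(3,2) \<open>0 < r\<close> \<open>0 < e\<close>] unfolding in_closure_of by blast
    then show ?thesis using Inl_cone_nbhd[OF x0 \<open>0 < r\<close>] by auto
  qed
  \<comment> \<open>Radius and tolerance are tied to one integer; by convexity, closeness at radius
    \<open>Suc n\<close> also controls every smaller radius.\<close>
  then have "\<forall>n. \<exists>y\<in>A. real (Suc n) < mdist X x0 y \<and>
      mdist X (geod X x0 y (real (Suc n))) (ray_from X x0 \<zeta> (real (Suc n))) < inverse (real (Suc n))"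
    by simp
  then obtain y where y: "\<And>n. y n \<in> A" "\<And>n. real (Suc n) < mdist X x0 (y n)"
    "\<And>n. mdist X (geod X x0 (y n) (real (Suc n))) (ray_from X x0 \<zeta> (real (Suc n))) < inverse (real (Suc n))"
    by metis
  have "converges_to_ray X x0 y (ray_from X x0 \<zeta>)"
    unfolding converges_to_ray_def
  proof (intro conjI allI impI)
    have "filterlim (\<lambda>n. real (Suc n)) at_top sequentially"
      by real_asymp
    then show "filterlim (\<lambda>n. mdist X x0 (y n)) at_top sequentially"
      by (rule filterlim_at_top_mono) (use y(2) in \<open>auto intro!: always_eventually less_imp_le\<close>)
    fix r :: real assume r: "0 \<le> r"
    obtain N :: nat where N: "r \<le> real N" using real_arch_simple by blast
    have "mdist X (geod X x0 (y n) r) (ray_from X x0 \<zeta> r) \<le> inverse (real (Suc n))" if "n \<ge> N" for n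
    proof (rule unit_speed_scale_le)
      show "unit_speed X (real (Suc n)) (geod X x0 (y n))"
        using x0 y(1)[of n] y(2)[of n] A by (intro geod_unit_speed) auto
      show "unit_speed X (real (Suc n)) (ray_from X x0 \<zeta>)" using \<alpha>(3) by (rule geodesic_ray_unit_speed)
      show "geod X x0 (y n) 0 = ray_from X x0 \<zeta> 0" using x0 y(1)[of n] A \<alpha>(2) by auto
    qed (use that N r y(3)[of n] in \<open>auto simp: less_imp_le\<close>)
    then have "eventually (\<lambda>n. norm (mdist X (geod X x0 (y n) r) (ray_from X x0 \<zeta> r)) \<le> inverse (real (Suc n))) sequentially"
      by (auto simp: eventually_sequentially)
    then show "(\<lambda>n. mdist X (geod X x0 (y n) r) (ray_from X x0 \<zeta> r)) \<longlonglongrightarrow> 0"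
      by (rule Lim_null_comparison[OF _ LIMSEQ_inverse_real_of_nat])
  qed
  then show ?R using y(1) by auto
next
  assume ?R
  then obtain y where y: "range y \<subseteq> A" "converges_to_ray X x0 y (ray_from X x0 \<zeta>)" by blast
  then have "limitin (cone_topology X x0) (\<lambda>n. Inl (y n)) (Inr \<zeta>) sequentially"
    using limitin_cone_iff[OF x0 _ z, of y] A by auto
  then have lim: "Inr \<zeta> \<in> topspace (cone_topology X x0)"
    "\<And>U. openin (cone_topology X x0) U \<Longrightarrow> Inr \<zeta> \<in> U \<Longrightarrow> eventually (\<lambda>n. Inl (y n) \<in> U) sequentially"
    by (auto simp: limitin_def)
  have "\<exists>a\<in>Inl ` A. a \<in> U" if "openin (cone_topology X x0) U" "Inr \<zeta> \<in> U" for U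
    using eventually_happens[OF lim(2)[OF that]] y(1) by auto
  then show ?L unfolding in_closure_of using lim(1) by blast
qed

text \<open>On the boundary, cone neighbourhoods reduce to closeness of rays at one time; the union
  of the neighbourhoods around the points of \<open>V\<close> is an open set of the compactification
  that cuts out \<open>V\<close>.\<close>

lemma openin_visual_iff:
  assumes x0: "x0 \<in> mspace X"
  shows "openin (visual_topology X x0) V \<longleftrightarrow> V \<subseteq> visual_boundary X \<and>
    (\<forall>\<zeta>\<in>V. \<exists>r>0. \<exists>e>0. \<forall>\<eta>\<in>visual_boundary X.
       mdist X (ray_from X x0 \<eta> r) (ray_from X x0 \<zeta> r) < e \<longrightarrow> \<eta> \<in> V)" (is "?L \<longleftrightarrow> ?R")
proof
  assume ?L
  then obtain U where U: "openin (cone_topology X x0) U" "V = Inr -` U \<inter> visual_boundary X"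
    by (auto simp: visual_topology_def openin_pullback_topology)
  show ?R
  proof (intro conjI ballI)
    show "V \<subseteq> visual_boundary X" using U by auto
    fix \<zeta> assume z: "\<zeta> \<in> V"
    then have "\<zeta> \<in> visual_boundary X" "Inr \<zeta> \<in> U" using U(2) by auto
    then obtain r e where re: "r > 0" "e > 0" "cone_nbhd X x0 (ray_from X x0 \<zeta>) r e \<subseteq> U"
      using cone_nbhd_base[OF x0 U(1)] by blast
    have "\<eta> \<in> V" if "\<eta> \<in> visual_boundary X" "mdist X (ray_from X x0 \<eta> r) (ray_from X x0 \<zeta> r) < e" for \<eta>
      using that re(3) U(2) Inr_cone_nbhd[of \<eta> x0 "ray_from X x0 \<zeta>" r e] by auto
    then show "\<exists>r>0. \<exists>e>0. \<forall>\<eta>\<in>visual_boundary X. mdist X (ray_from X x0 \<eta> r) (ray_from X x0 \<zeta> r) < e \<longrightarrow> \<eta> \<in> V"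
      using re(1,2) by blast
  qed
next
  assume R: ?R
  then obtain r e where re: "\<And>\<zeta>. \<zeta> \<in> V \<Longrightarrow> r \<zeta> > 0 \<and> e \<zeta> > 0 \<and> (\<forall>\<eta>\<in>visual_boundary X.
       mdist X (ray_from X x0 \<eta> (r \<zeta>)) (ray_from X x0 \<zeta> (r \<zeta>)) < e \<zeta> \<longrightarrow> \<eta> \<in> V)" by metis
  define U where "U = (\<Union>\<zeta>\<in>V. cone_nbhd X x0 (ray_from X x0 \<zeta>) (r \<zeta>) (e \<zeta>))"
  have "openin (cone_topology X x0) U"
    unfolding U_def using R re ray_from(2,3)[OF x0] by (intro openin_Union) (auto intro!: openin_cone_nbhd)
  moreover have "Inr -` U \<inter> visual_boundary X = V"
  proof
    show "Inr -` U \<inter> visual_boundary X \<subseteq> V"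
      using re by (auto simp: U_def Inr_cone_nbhd)
    show "V \<subseteq> Inr -` U \<inter> visual_boundary X"
    proof
      fix \<zeta> assume z: "\<zeta> \<in> V"
      then have zb: "\<zeta> \<in> visual_boundary X" using R by auto
      have "Inr \<zeta> \<in> cone_nbhd X x0 (ray_from X x0 \<zeta>) (r \<zeta>) (e \<zeta>)"
        using zb re[OF z] geodesic_ray_in[OF ray_from(3)[OF x0 zb], of "r \<zeta>"] by (simp add: Inr_cone_nbhd)
      then show "\<zeta> \<in> Inr -` U \<inter> visual_boundary X" using z zb by (auto simp: U_def)
    qed
  qed
  ultimately show ?L unfolding visual_topology_def openin_pullback_topology by auto
qed

lemma topspace_visual: "x0 \<in> mspace X \<Longrightarrow> topspace (visual_topology X x0) = visual_boundary X"
proof -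
  assume x0: "x0 \<in> mspace X"
  have "openin (visual_topology X x0) (visual_boundary X)"
    unfolding openin_visual_iff[OF x0] by (auto intro!: exI[of _ 1])
  then show ?thesis using openin_visual_iff[OF x0] by (meson openin_subset openin_topspace subset_antisym)
qed

end

section \<open>CAT(0) spaces and products\<close>

text \<open>One side is laid along the first axis, and the third vertex is placed by the law of
  cosines, with first coordinate \<open>u\<close>.\<close>

lemma comparison_triangle:
  fixes a b e :: real
  assumes "0 \<le> a" "0 \<le> b" "0 \<le> e" "a \<le> b + e" "b \<le> a + e" "e \<le> a + b"
  shows "\<exists>y z :: real^2. dist 0 y = a \<and> dist 0 z = b \<and> dist y z = e"
proof (cases "a = 0")
  case True
  then have "b = e" using assms by simp
  then show ?thesis using True assms
    by (intro exI[of _ 0] exI[of _ "vector [b, 0]"]) (simp add: dist_vec_def L2_set_def sum_2)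
next
  case False
  define u where "u = (a\<^sup>2 + b\<^sup>2 - e\<^sup>2) / (2 * a)"
  have au: "2 * a * u = a\<^sup>2 + b\<^sup>2 - e\<^sup>2" using False by (simp add: u_def)
  \<comment> \<open>Heron's factorization: the triangle inequalities make both factors nonnegative,
    so that |u| \<le> b and the second coordinate is real.\<close>
  have "(2 * a * b)\<^sup>2 - (2 * a * u)\<^sup>2 = (e\<^sup>2 - (a - b)\<^sup>2) * ((a + b)\<^sup>2 - e\<^sup>2)"
    unfolding au by (simp add: power2_eq_square algebra_simps)
  moreover have "(a - b)\<^sup>2 \<le> e\<^sup>2" using assms by (intro power2_le_iff_abs_le[THEN iffD2]) auto
  moreover have "e\<^sup>2 \<le> (a + b)\<^sup>2" using assms by (intro power_mono) auto
  ultimately have "(2 * a * u)\<^sup>2 \<le> (2 * a * b)\<^sup>2" by (metis diff_ge_0_iff_ge mult_nonneg_nonneg)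
  then have ub: "u\<^sup>2 \<le> b\<^sup>2" using False by (simp add: power_mult_distrib)
  have ab: "a\<^sup>2 - 2 * a * u + b\<^sup>2 = e\<^sup>2" using au by simp
  have "sqrt ((a - u)\<^sup>2 + (sqrt (b\<^sup>2 - u\<^sup>2))\<^sup>2) = e"
  proof -
    have "(a - u)\<^sup>2 + (sqrt (b\<^sup>2 - u\<^sup>2))\<^sup>2 = a\<^sup>2 - 2 * a * u + b\<^sup>2"
      using ub by (simp add: power2_diff)
    then show ?thesis using ab assms by simp
  qed
  moreover have "sqrt (u\<^sup>2 + (sqrt (b\<^sup>2 - u\<^sup>2))\<^sup>2) = b" using ub assms by simp
  ultimately show ?thesis using assms
    by (intro exI[of _ "vector [a, 0]"] exI[of _ "vector [u, sqrt (b\<^sup>2 - u\<^sup>2)]"])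
      (simp add: dist_vec_def L2_set_def sum_2 dist_real_def)
qed

text \<open>In a comparison triangle with apex 0 the points at the fraction \<open>s\<close> are the
  multiples of \<open>y'\<close> and \<open>z'\<close> by \<open>s\<close>, whose distance is
  exactly \<open>s\<close> times the opposite side.\<close>

lemma CAT0_convex:
  assumes X: "CAT0 X" and M: "x \<in> mspace X" "y \<in> mspace X" "z \<in> mspace X"
    and c: "geodesic_segment X x y c" "geodesic_segment X x z c'" and s: "0 \<le> s" "s \<le> 1"
  shows "mdist X (c (s * mdist X x y)) (c' (s * mdist X x z)) \<le> s * mdist X y z"
proof -
  obtain y' z' :: "real^2" where yz: "dist 0 y' = mdist X x y" "dist 0 z' = mdist X x z" "dist y' z' = mdist X y z"
    using comparison_triangle[of "mdist X x y" "mdist X x z" "mdist X y z"]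
      mdist_triangle[of x X z y] mdist_triangle[of x X y z] mdist_triangle[of y X x z] M
    by (auto simp: mdist_commute)
  have "mdist X (c (dist 0 (s *\<^sub>R y'))) (c' (dist 0 (s *\<^sub>R z'))) \<le> dist (s *\<^sub>R y') (s *\<^sub>R z')"
  proof -
    have "s *\<^sub>R y' \<in> closed_segment 0 y'" "s *\<^sub>R z' \<in> closed_segment 0 z'"
      using s by (auto simp: in_segment)
    then show ?thesis using X M c yz unfolding CAT0_def by blast
  qed
  moreover have "dist 0 (s *\<^sub>R y') = s * mdist X x y" "dist 0 (s *\<^sub>R z') = s * mdist X x z"
    using yz s by simp_all
  moreover have "dist (s *\<^sub>R y') (s *\<^sub>R z') = s * mdist X y z"
    using yz(3) s by (simp add: dist_norm flip: scaleR_diff_right)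
  ultimately show ?thesis by simp
qed

lemma proper_complete:
  assumes "proper_metric X"
  shows "mcomplete_of X"
proof -
  interpret Metric_space "mspace X" "mdist X" by simp
  have "\<exists>l. limitin mtopology f l sequentially" if f: "MCauchy f" for f
  proof -
    have "mbounded (range f)" using f by (rule MCauchy_imp_mbounded)
    then obtain x B where xB: "range f \<subseteq> mcball x B" by (auto simp: mbounded_def)
    then have x: "x \<in> mspace X" by force
    have "compactin mtopology (mcball x B)"
      using assms x by (auto simp: proper_metric_def mtopology_of_def mcball_of_def)
    then obtain l r where "strict_mono r" "limitin mtopology (f \<circ> r) l sequentially"
      using xB unfolding compactin_sequentially by blast
    then show ?thesis using MCauchy_convergent_subsequence[OF f] by blast
  qed
  then show ?thesis by (simp add: mcomplete_of_def mcomplete_def)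
qed

lemma convex_space_if_proper_CAT0:
  assumes "proper_metric X" "CAT0 X"
  shows "convex_space X"
proof
  show "geodesic_metric X" using assms by (simp add: CAT0_def)
  show "mcomplete_of X" using assms by (simp add: proper_complete)
qed (rule CAT0_convex[OF assms(2)])

text \<open>Equality in the triangle inequality of the plane for the vectors (a, a') and (b, b') of
  lengths \<open>S\<close> and \<open>T\<close> forces them to be proportional. They will be the
  displacements in the two factors over consecutive time intervals of a product geodesic, and (e,
  e') the total one.\<close>

lemma minkowski_equality:
  fixes a b e a' b' e' S T :: real
  assumes nn: "0 \<le> a" "0 \<le> b" "0 \<le> e" "0 \<le> a'" "0 \<le> b'" "0 \<le> e'" and ST: "0 < S" "0 < T"
    and sq: "a\<^sup>2 + a'\<^sup>2 = S\<^sup>2" "b\<^sup>2 + b'\<^sup>2 = T\<^sup>2" "e\<^sup>2 + e'\<^sup>2 = (S + T)\<^sup>2" and tri: "e \<le> a + b" "e' \<le> a' + b'"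
  shows "a * T = b * S" "a' * T = b' * S" "e * S = a * (S + T)" "e' * S = a' * (S + T)"
proof -
  have "e\<^sup>2 \<le> (a + b)\<^sup>2" "e'\<^sup>2 \<le> (a' + b')\<^sup>2" using nn tri by (auto intro!: power_mono)
  then have "(S + T)\<^sup>2 \<le> (a + b)\<^sup>2 + (a' + b')\<^sup>2" using sq by linarith
  then have "S * T \<le> a * b + a' * b'" using sq by (simp add: power2_sum)
  then have "(S * T) * (S * T) \<le> (S * T) * (a * b + a' * b')" using ST by (intro mult_left_mono) auto
  \<comment> \<open>The left side measures the failure of proportionality; the lower bound on the
    inner product just obtained makes it nonpositive.\<close>
  moreover have "(a * T - b * S)\<^sup>2 + (a' * T - b' * S)\<^sup>2
      = (a\<^sup>2 + a'\<^sup>2) * T\<^sup>2 + (b\<^sup>2 + b'\<^sup>2) * S\<^sup>2 - 2 * ((S * T) * (a * b + a' * b'))"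
    by (simp add: power2_eq_square algebra_simps)
  ultimately have "(a * T - b * S)\<^sup>2 + (a' * T - b' * S)\<^sup>2 \<le> 0"
    unfolding sq by (simp add: power2_eq_square algebra_simps)
  then have "(a * T - b * S)\<^sup>2 = 0" "(a' * T - b' * S)\<^sup>2 = 0"
    using zero_le_power2[of "a * T - b * S"] zero_le_power2[of "a' * T - b' * S"] by linarith+
  then show 1: "a * T = b * S" "a' * T = b' * S" by auto
  have e: "e * S \<le> a * (S + T)" "e' * S \<le> a' * (S + T)"
    using mult_right_mono[OF tri(1), of S] mult_right_mono[OF tri(2), of S] ST 1 by (auto simp: algebra_simps)
  have "(a * (S + T))\<^sup>2 + (a' * (S + T))\<^sup>2 = (e * S)\<^sup>2 + (e' * S)\<^sup>2"
  proof -
    have "(a * (S + T))\<^sup>2 + (a' * (S + T))\<^sup>2 = (a\<^sup>2 + a'\<^sup>2) * (S + T)\<^sup>2"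
      by (simp only: power_mult_distrib distrib_right)
    also have "\<dots> = (e\<^sup>2 + e'\<^sup>2) * S\<^sup>2" using sq by simp
    finally show ?thesis by (simp only: power_mult_distrib distrib_right)
  qed
  moreover have "(e * S)\<^sup>2 \<le> (a * (S + T))\<^sup>2" "(e' * S)\<^sup>2 \<le> (a' * (S + T))\<^sup>2"
    using e nn ST by (auto intro!: power_mono)
  ultimately have "(e * S)\<^sup>2 = (a * (S + T))\<^sup>2" "(e' * S)\<^sup>2 = (a' * (S + T))\<^sup>2" by linarith+
  then show "e * S = a * (S + T)" "e' * S = a' * (S + T)" using nn ST by (auto simp: power2_eq_iff_nonneg)
qed

section \<open>Geodesics of the Euclidean product\<close>

abbreviation "d_prod X1 X2 \<equiv> mdist (prod_metric X1 X2)"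

lemma prod_dist_sq:
  "(d_prod X1 X2 p q)\<^sup>2 = (mdist X1 (fst p) (fst q))\<^sup>2 + (mdist X2 (snd p) (snd q))\<^sup>2"
  by (simp add: prod_dist_def case_prod_unfold)

text \<open>Any three times on a geodesic of the product give equality in the triangle inequality,
  so by \<open>minkowski_equality\<close> the displacement in each factor is proportional to
  time.\<close>

lemma prod_unit_speed:
  assumes c: "unit_speed (prod_metric X1 X2) L c"
  obtains l1 l2 where "0 \<le> l1" "0 \<le> l2"
    "\<And>s t. \<lbrakk>s \<in> {0..L}; t \<in> {0..L}\<rbrakk> \<Longrightarrow> mdist X1 (fst (c s)) (fst (c t)) = l1 * \<bar>s - t\<bar>"
    "\<And>s t. \<lbrakk>s \<in> {0..L}; t \<in> {0..L}\<rbrakk> \<Longrightarrow> mdist X2 (snd (c s)) (snd (c t)) = l2 * \<bar>s - t\<bar>"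
proof (cases "L > 0")
  case False
  have cM: "c t \<in> mspace X1 \<times> mspace X2" if "t \<in> {0..L}" for t
    using c that unit_speed_in by fastforce
  show thesis
  proof (rule that[of 0 0])
    fix s t assume "s \<in> {0..L}" "t \<in> {0..L}"
    then have "s = t" "t \<in> {0..L}" using False by auto
    then show "mdist X1 (fst (c s)) (fst (c t)) = 0 * \<bar>s - t\<bar>" "mdist X2 (snd (c s)) (snd (c t)) = 0 * \<bar>s - t\<bar>"
      using cM[of t] by (simp_all add: mem_Times_iff)
  qed auto
next
  case L: True
  define a where "a s t = mdist X1 (fst (c s)) (fst (c t))" for s t
  define b where "b s t = mdist X2 (snd (c s)) (snd (c t))" for s t
  have cM: "fst (c t) \<in> mspace X1" "snd (c t) \<in> mspace X2" if "t \<in> {0..L}" for t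
    using c that unit_speed_in[OF c, of t] by (auto simp: mem_Times_iff)
  have nn: "0 \<le> a s t" "0 \<le> b s t" for s t by (auto simp: a_def b_def)
  have sq: "(a s t)\<^sup>2 + (b s t)\<^sup>2 = (t - s)\<^sup>2" if "s \<in> {0..L}" "t \<in> {0..L}" for s t
    using prod_dist_sq[of X1 X2 "c s" "c t"] unit_speed_dist[OF c, of s t] that
    by (simp add: a_def b_def power2_commute)
  have tri: "a s u \<le> a s t + a t u" "b s u \<le> b s t + b t u" if "s \<in> {0..L}" "t \<in> {0..L}" "u \<in> {0..L}" for s t u
    using that cM by (auto simp: a_def b_def intro!: mdist_triangle)
  have *: "a s t * (u - t) = a t u * (t - s)" "b s t * (u - t) = b t u * (t - s)"
     "a s u * (t - s) = a s t * (u - s)" "b s u * (t - s) = b s t * (u - s)"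
    if "0 \<le> s" "s < t" "t < u" "u \<le> L" for s t u
    using minkowski_equality[of "a s t" "a t u" "a s u" "b s t" "b t u" "b s u" "t - s" "u - t"]
      nn sq tri that by auto
  define l1 l2 where "l1 = a 0 L / L" and "l2 = b 0 L / L"
  have 0: "a 0 t = l1 * t" "b 0 t = l2 * t" if "0 \<le> t" "t \<le> L" for t
  proof -
    have "a 0 t = l1 * t \<and> b 0 t = l2 * t"
    proof (cases "t = 0 \<or> t = L")
      case True
      then show ?thesis using L cM[of 0] by (auto simp: l1_def l2_def a_def b_def)
    next
      case False
      then show ?thesis using *(3,4)[of 0 t L] that L by (auto simp: l1_def l2_def field_simps)
    qed
    then show "a 0 t = l1 * t" "b 0 t = l2 * t" by auto
  qed
  have lt: "a s t = l1 * (t - s) \<and> b s t = l2 * (t - s)" if "0 \<le> s" "s < t" "t \<le> L" for s t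
  proof (cases "s = 0")
    case True
    then show ?thesis using 0[of t] that by simp
  next
    case False
    then have "a s t * s = (l1 * (t - s)) * s" "b s t * s = (l2 * (t - s)) * s"
      using *(1,2)[of 0 s t] 0[of s] that by (auto simp: algebra_simps)
    then show ?thesis using False by simp
  qed
  have fin: "a s t = l1 * \<bar>s - t\<bar> \<and> b s t = l2 * \<bar>s - t\<bar>" if "s \<in> {0..L}" "t \<in> {0..L}" for s t
  proof -
    consider "s < t" | "t < s" | "s = t" by linarith
    then show ?thesis
    proof cases
      case 2
      then show ?thesis using lt[of t s] that by (simp add: a_def b_def mdist_commute)
    next
      case 3
      then show ?thesis using cM that by (simp add: a_def b_def)
    qed (use lt[of s t] that in auto)
  qed
  show thesis
  proof (rule that[of l1 l2])
    show "0 \<le> l1" "0 \<le> l2" using nn L by (auto simp: l1_def l2_def)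
  qed (use fin in \<open>auto simp only: a_def b_def\<close>)
qed

text \<open>Parametrizing by the fraction \<open>u\<close> of the whole path covers constant
  components too, where passing to arc length would divide by 0.\<close>

lemma constant_speed_segment:
  assumes L: "0 \<le> L" and f: "\<And>t. t \<in> {0..L} \<Longrightarrow> f t \<in> mspace X" and l: "0 \<le> l"
    and d: "\<And>s t. \<lbrakk>s \<in> {0..L}; t \<in> {0..L}\<rbrakk> \<Longrightarrow> mdist X (f s) (f t) = l * \<bar>s - t\<bar>"
  obtains c where "geodesic_segment X (f 0) (f L) c"
    "\<And>u. 0 \<le> u \<Longrightarrow> u \<le> 1 \<Longrightarrow> f (u * L) = c (u * mdist X (f 0) (f L))"
proof (cases "l = 0 \<or> L = 0")
  case True
  have dL: "mdist X (f 0) (f L) = 0" using d[of 0 L] L True by auto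
  have eq: "f t = f 0" if "t \<in> {0..L}" for t
    using d[of 0 t] f[of 0] f[OF that] that L True by (auto simp: mdist_zero)
  show thesis
  proof (rule that[of "\<lambda>_. f 0"])
    show "geodesic_segment X (f 0) (f L) (\<lambda>_. f 0)"
      using dL f[of 0] L eq[of L] by (simp add: geodesic_segment_def)
    show "f (u * L) = f 0" if "0 \<le> u" "u \<le> 1" for u
      by (rule eq) (use that L in \<open>auto intro: mult_left_le_one_le\<close>)
  qed
next
  case False
  then have l: "0 < l" "0 < L" using l L by auto
  have dL: "mdist X (f 0) (f L) = l * L" using d[of 0 L] L by simp
  show thesis
  proof (rule that[of "\<lambda>r. f (r / l)"])
    have r: "r / l \<in> {0..L}" if "0 \<le> r" "r \<le> l * L" for r
      using that l by (simp add: field_simps)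
    show "geodesic_segment X (f 0) (f L) (\<lambda>r. f (r / l))"
      unfolding geodesic_segment_def dL
    proof (intro conjI ballI)
      fix s t assume "s \<in> {0..l * L}" "t \<in> {0..l * L}"
      then have "mdist X (f (s / l)) (f (t / l)) = l * \<bar>s / l - t / l\<bar>" by (intro d r) auto
      also have "\<dots> = \<bar>s - t\<bar>" using l by (simp flip: diff_divide_distrib)
      finally show "mdist X (f (s / l)) (f (t / l)) = \<bar>s - t\<bar>" .
    qed (use l f r in auto)
    show "f (u * L) = f (u * mdist X (f 0) (f L) / l)" for u using l by (simp add: dL)
  qed
qed

lemma prod_segment_components:
  assumes c: "geodesic_segment (prod_metric X1 X2) x y c"
  obtains c1 c2 where "geodesic_segment X1 (fst x) (fst y) c1" "geodesic_segment X2 (snd x) (snd y) c2"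
    "\<And>u. \<lbrakk>0 \<le> u; u \<le> 1\<rbrakk> \<Longrightarrow> c (u * d_prod X1 X2 x y) =
      (c1 (u * mdist X1 (fst x) (fst y)), c2 (u * mdist X2 (snd x) (snd y)))"
proof -
  define L where "L = d_prod X1 X2 x y"
  have c': "unit_speed (prod_metric X1 X2) L c" "c 0 = x" "c L = y"
    using c by (auto simp: geodesic_segment_unit_speed L_def)
  obtain l1 l2 where l: "0 \<le> l1" "0 \<le> l2"
    "\<And>s t. \<lbrakk>s \<in> {0..L}; t \<in> {0..L}\<rbrakk> \<Longrightarrow> mdist X1 (fst (c s)) (fst (c t)) = l1 * \<bar>s - t\<bar>"
    "\<And>s t. \<lbrakk>s \<in> {0..L}; t \<in> {0..L}\<rbrakk> \<Longrightarrow> mdist X2 (snd (c s)) (snd (c t)) = l2 * \<bar>s - t\<bar>"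
    using prod_unit_speed[OF c'(1)] by blast
  have L0: "0 \<le> L" unfolding L_def by (rule mdist_nonneg)
  have cM: "fst (c t) \<in> mspace X1" "snd (c t) \<in> mspace X2" if "t \<in> {0..L}" for t
    using that unit_speed_in[OF c'(1), of t] by (auto simp: mem_Times_iff)
  obtain c1 where c1: "geodesic_segment X1 (fst (c 0)) (fst (c L)) c1"
    "\<And>u. 0 \<le> u \<Longrightarrow> u \<le> 1 \<Longrightarrow> fst (c (u * L)) = c1 (u * mdist X1 (fst (c 0)) (fst (c L)))"
    using constant_speed_segment[of L "\<lambda>t. fst (c t)" X1 l1] L0 cM l by blast
  obtain c2 where c2: "geodesic_segment X2 (snd (c 0)) (snd (c L)) c2"
    "\<And>u. 0 \<le> u \<Longrightarrow> u \<le> 1 \<Longrightarrow> snd (c (u * L)) = c2 (u * mdist X2 (snd (c 0)) (snd (c L)))"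
    using constant_speed_segment[of L "\<lambda>t. snd (c t)" X2 l2] L0 cM l by blast
  show thesis
    by (rule that[of c1 c2]) (use c1 c2 c' in \<open>auto simp: L_def prod_eq_iff\<close>)
qed

lemma prod_segmentI:
  assumes c: "geodesic_segment X1 x1 y1 c1" "geodesic_segment X2 x2 y2 c2"
    and D: "D = d_prod X1 X2 (x1, x2) (y1, y2)" "0 < D"
  shows "geodesic_segment (prod_metric X1 X2) (x1, x2) (y1, y2)
    (\<lambda>t. (c1 (t * mdist X1 x1 y1 / D), c2 (t * mdist X2 x2 y2 / D)))"
  unfolding geodesic_segment_def D(1)[symmetric]
proof (intro conjI ballI)
  have u: "t * e / D \<in> {0..e}" if "t \<in> {0..D}" "0 \<le> e" for t e
    using that D(2) mult_right_mono[of t D e] by (simp add: field_simps)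
  have sq: "D\<^sup>2 = (mdist X1 x1 y1)\<^sup>2 + (mdist X2 x2 y2)\<^sup>2"
    using prod_dist_sq[of X1 X2 "(x1, x2)" "(y1, y2)"] D by simp
  show "(\<lambda>t. (c1 (t * mdist X1 x1 y1 / D), c2 (t * mdist X2 x2 y2 / D))) \<in> {0..D} \<rightarrow> mspace (prod_metric X1 X2)"
    using c u by (auto simp: geodesic_segment_def Pi_iff)
  fix s t assume st: "s \<in> {0..D}" "t \<in> {0..D}"
  define e1 e2 where "e1 = mdist X1 x1 y1" and "e2 = mdist X2 x2 y2"
  have d: "mdist X1 (c1 (s * e1 / D)) (c1 (t * e1 / D)) = \<bar>s - t\<bar> * e1 / D"
    "mdist X2 (c2 (s * e2 / D)) (c2 (t * e2 / D)) = \<bar>s - t\<bar> * e2 / D"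
  proof -
    have *: "\<bar>s * e / D - t * e / D\<bar> = \<bar>s - t\<bar> * e / D" if "0 \<le> e" for e
    proof -
      have "s * e / D - t * e / D = (s - t) * (e / D)" by (simp add: algebra_simps diff_divide_distrib)
      then show ?thesis using that D by (simp add: abs_mult)
    qed
    show "mdist X1 (c1 (s * e1 / D)) (c1 (t * e1 / D)) = \<bar>s - t\<bar> * e1 / D"
      using c(1) u[OF st(1), of e1] u[OF st(2), of e1] *[of e1] by (simp add: geodesic_segment_def e1_def)
    show "mdist X2 (c2 (s * e2 / D)) (c2 (t * e2 / D)) = \<bar>s - t\<bar> * e2 / D"
      using c(2) u[OF st(1), of e2] u[OF st(2), of e2] *[of e2] by (simp add: geodesic_segment_def e2_def)
  qed
  have "(\<bar>s - t\<bar> * e1 / D)\<^sup>2 + (\<bar>s - t\<bar> * e2 / D)\<^sup>2 = (s - t)\<^sup>2 * (e1\<^sup>2 + e2\<^sup>2) / D\<^sup>2"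
    by (simp add: power_mult_distrib power_divide algebra_simps add_divide_distrib)
  also have "\<dots> = (s - t)\<^sup>2" using D(2) unfolding e1_def e2_def sq[symmetric] by simp
  finally have "mdist (prod_metric X1 X2) (c1 (s * e1 / D), c2 (s * e2 / D)) (c1 (t * e1 / D), c2 (t * e2 / D)) = sqrt ((s - t)\<^sup>2)"
    by (simp add: prod_dist_def d)
  then show "mdist (prod_metric X1 X2) (c1 (s * mdist X1 x1 y1 / D), c2 (s * mdist X2 x2 y2 / D))
      (c1 (t * mdist X1 x1 y1 / D), c2 (t * mdist X2 x2 y2 / D)) = \<bar>s - t\<bar>"
    by (simp add: e1_def e2_def)
qed (use c D in \<open>auto simp: geodesic_segment_def\<close>)

lemma geodesic_segment_trivial: "x \<in> mspace X \<Longrightarrow> geodesic_segment X x x (\<lambda>_. x)"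
  by (simp add: geodesic_segment_def)

text \<open>Geodesics of the product split into geodesics of the factors at the same fraction
  \<open>s\<close>; the two convexity bounds are then combined by the theorem of Pythagoras.\<close>

lemma convex_space_prod:
  assumes "convex_space X1" "convex_space X2"
  shows "convex_space (prod_metric X1 X2)"
proof
  interpret X1: convex_space X1 by fact
  interpret X2: convex_space X2 by fact
  show "geodesic_metric (prod_metric X1 X2)"
    unfolding geodesic_metric_def
  proof (intro ballI)
    fix x y assume xy: "x \<in> mspace (prod_metric X1 X2)" "y \<in> mspace (prod_metric X1 X2)"
    show "\<exists>c. geodesic_segment (prod_metric X1 X2) x y c"
    proof (cases "d_prod X1 X2 x y = 0")
      case True
      then have "x = y" using mdist_zero[OF xy] by blast
      then show ?thesis using geodesic_segment_trivial[OF xy(1)] by blast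
    next
      case False
      then have "0 < d_prod X1 X2 x y" by (metis antisym_conv2 mdist_nonneg)
      moreover obtain x1 x2 y1 y2 where "x = (x1, x2)" "y = (y1, y2)" by fastforce
      ultimately show ?thesis
        using prod_segmentI[OF X1.geod_segment[of x1 y1] X2.geod_segment[of x2 y2] refl] xy by auto
    qed
  qed
  show "mcomplete_of (prod_metric X1 X2)"
    using X1.complete X2.complete Metric_space12.mcomplete_prod_metric[OF Metric_space12_mspace_mdist, of X1 X2]
    by (simp add: mcomplete_of_def)
  fix x y z c c' s
  assume M: "x \<in> mspace (prod_metric X1 X2)" "y \<in> mspace (prod_metric X1 X2)" "z \<in> mspace (prod_metric X1 X2)"
    and c: "geodesic_segment (prod_metric X1 X2) x y c" "geodesic_segment (prod_metric X1 X2) x z c'"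
    and s: "0 \<le> s" "s \<le> (1::real)"
  obtain c1 c2 where c1: "geodesic_segment X1 (fst x) (fst y) c1" "geodesic_segment X2 (snd x) (snd y) c2"
    "c (s * d_prod X1 X2 x y) = (c1 (s * mdist X1 (fst x) (fst y)), c2 (s * mdist X2 (snd x) (snd y)))"
    using prod_segment_components[OF c(1)] s by metis
  obtain c1' c2' where c2: "geodesic_segment X1 (fst x) (fst z) c1'" "geodesic_segment X2 (snd x) (snd z) c2'"
    "c' (s * d_prod X1 X2 x z) = (c1' (s * mdist X1 (fst x) (fst z)), c2' (s * mdist X2 (snd x) (snd z)))"
    using prod_segment_components[OF c(2)] s by metis
  define A B where "A = mdist X1 (c1 (s * mdist X1 (fst x) (fst y))) (c1' (s * mdist X1 (fst x) (fst z)))"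
    and "B = mdist X2 (c2 (s * mdist X2 (snd x) (snd y))) (c2' (s * mdist X2 (snd x) (snd z)))"
  have AB: "0 \<le> A" "0 \<le> B" "A \<le> s * mdist X1 (fst y) (fst z)" "B \<le> s * mdist X2 (snd y) (snd z)"
    using X1.convex[OF _ _ _ c1(1) c2(1) s] X2.convex[OF _ _ _ c1(2) c2(2) s] M
    by (auto simp: A_def B_def)
  have "(d_prod X1 X2 (c (s * d_prod X1 X2 x y)) (c' (s * d_prod X1 X2 x z)))\<^sup>2 = A\<^sup>2 + B\<^sup>2"
    unfolding c1 c2 prod_dist_sq by (simp add: A_def B_def)
  also have "\<dots> \<le> (s * mdist X1 (fst y) (fst z))\<^sup>2 + (s * mdist X2 (snd y) (snd z))\<^sup>2"
    using AB by (intro add_mono power_mono) auto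
  also have "\<dots> = (s * d_prod X1 X2 y z)\<^sup>2"
    unfolding power_mult_distrib prod_dist_sq by (simp add: algebra_simps)
  finally show "d_prod X1 X2 (c (s * d_prod X1 X2 x y)) (c' (s * d_prod X1 X2 x z)) \<le> s * d_prod X1 X2 y z"
    by (rule power2_le_imp_le) (use s mdist_nonneg[of "prod_metric X1 X2" y z] in \<open>simp del: mdist_prod_metric\<close>)
qed

lemma geod_prod:
  assumes "convex_space X1" "convex_space X2"
    and M: "x1 \<in> mspace X1" "y1 \<in> mspace X1" "x2 \<in> mspace X2" "y2 \<in> mspace X2"
    and D: "D = d_prod X1 X2 (x1, x2) (y1, y2)" "0 < D" and t: "0 \<le> t" "t \<le> D"
  shows "geod (prod_metric X1 X2) (x1, x2) (y1, y2) t =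
    (geod X1 x1 y1 (t * mdist X1 x1 y1 / D), geod X2 x2 y2 (t * mdist X2 x2 y2 / D))"
proof -
  interpret X1: convex_space X1 by fact
  interpret X2: convex_space X2 by fact
  interpret P: convex_space "prod_metric X1 X2" using assms convex_space_prod by blast
  show ?thesis
    using prod_segmentI[OF X1.geod_segment[OF M(1,2)] X2.geod_segment[OF M(3,4)] D] M t D(1)
    by (intro P.geod_eq) (auto simp del: mdist_prod_metric)
qed

section \<open>The Gromov boundary and word metrics\<close>

context hyperbolic_graph
begin

definition products_diverge :: "'p \<Rightarrow> (nat \<Rightarrow> 'p) \<Rightarrow> (nat \<Rightarrow> 'p) \<Rightarrow> bool" where
  "products_diverge w u v \<longleftrightarrow> (\<forall>Z. \<exists>N. \<forall>i\<ge>N. \<forall>j\<ge>N. Z \<le> gp w (u i) (v j))"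

lemma filterlim_products_iff:
  "filterlim (\<lambda>(i, j). gp w (u i) (v j)) at_top (sequentially \<times>\<^sub>F sequentially) \<longleftrightarrow> products_diverge w u v"
  unfolding filterlim_at_top eventually_prod_sequentially products_diverge_def by fastforce

lemma converges_to_infinity_iff:
  "converges_to_infinity X w u \<longleftrightarrow> range u \<subseteq> M \<and> products_diverge w u u"
  by (simp add: converges_to_infinity_def filterlim_products_iff)

lemma gromov_equiv_iff:
  "(u, v) \<in> gromov_equiv X w \<longleftrightarrow> range u \<subseteq> M \<and> range v \<subseteq> M \<and>
    products_diverge w u u \<and> products_diverge w v v \<and> products_diverge w u v"
  by (auto simp: gromov_equiv_def converges_to_infinity_iff filterlim_products_iff)

lemma products_diverge_sym: "products_diverge w u v \<Longrightarrow> products_diverge w v u"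
  unfolding products_diverge_def by (metis gp_commute)

text \<open>The four point condition through a far term of \<open>v\<close>; the loss of \<delta> is
  harmless because the bound is arbitrary.\<close>

lemma products_diverge_trans:
  assumes "w \<in> M" "range u \<subseteq> M" "range v \<subseteq> M" "range x \<subseteq> M"
    and uv: "products_diverge w u v" and vx: "products_diverge w v x"
  shows "products_diverge w u x"
  unfolding products_diverge_def
proof
  fix Z
  obtain N where N: "\<forall>i\<ge>N. \<forall>j\<ge>N. Z + \<delta> \<le> gp w (u i) (v j)" using uv unfolding products_diverge_def by blast
  obtain N' where N': "\<forall>i\<ge>N'. \<forall>j\<ge>N'. Z + \<delta> \<le> gp w (v i) (x j)" using vx unfolding products_diverge_def by blast
  have "Z \<le> gp w (u i) (x j)" if "max N N' \<le> i" "max N N' \<le> j" for i j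
  proof -
    have "Z + \<delta> \<le> gp w (u i) (v (max N N'))" "Z + \<delta> \<le> gp w (v (max N N')) (x j)"
      using N N' that by auto
    moreover have "u i \<in> M" "v (max N N') \<in> M" "x j \<in> M" using assms(2-4) by auto
    ultimately show ?thesis using four_point[of w "u i" "v (max N N')" "x j"] assms(1) by linarith
  qed
  then show "\<exists>N. \<forall>i\<ge>N. \<forall>j\<ge>N. Z \<le> gp w (u i) (x j)" by blast
qed

lemma equiv_gromov:
  assumes "w \<in> M"
  shows "equiv (Collect (converges_to_infinity X w)) (gromov_equiv X w)"
proof (rule equivI)
  show "gromov_equiv X w \<subseteq> Collect (converges_to_infinity X w) \<times> Collect (converges_to_infinity X w)"
    by (auto simp: gromov_equiv_def)
  show "refl_on (Collect (converges_to_infinity X w)) (gromov_equiv X w)"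
    by (auto simp: refl_on_def gromov_equiv_iff converges_to_infinity_iff)
  show "sym (gromov_equiv X w)"
    by (auto simp: sym_def gromov_equiv_iff intro: products_diverge_sym)
  show "trans (gromov_equiv X w)"
    using products_diverge_trans[OF assms] unfolding trans_def gromov_equiv_iff by blast
qed

section \<open>Boundary points and their representing sequences\<close>

lemma boundary_class:
  assumes w: "w \<in> M" and \<xi>: "\<xi> \<in> gromov_boundary X w"
  obtains u where "u \<in> \<xi>"
  using \<xi> equiv_class_self[OF equiv_gromov[OF w]] unfolding gromov_boundary_def by (auto elim!: quotientE)

lemma boundary_rep:
  assumes w: "w \<in> M" and \<xi>: "\<xi> \<in> gromov_boundary X w" and u: "u \<in> \<xi>"
  shows "\<xi> = gromov_equiv X w `` {u}" "range u \<subseteq> M" "products_diverge w u u"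
proof -
  obtain v where v: "converges_to_infinity X w v" "\<xi> = gromov_equiv X w `` {v}"
    using \<xi> unfolding gromov_boundary_def by (auto elim!: quotientE)
  then have "(v, u) \<in> gromov_equiv X w" using u by simp
  then show "\<xi> = gromov_equiv X w `` {u}" "range u \<subseteq> M" "products_diverge w u u"
    using v(2) equiv_class_eq[OF equiv_gromov[OF w]] by (auto simp: gromov_equiv_iff)
qed

lemma boundary_memI:
  assumes w: "w \<in> M" and \<xi>: "\<xi> \<in> gromov_boundary X w" and u: "u \<in> \<xi>"
    and v: "range v \<subseteq> M" "products_diverge w v v" "products_diverge w u v"
  shows "v \<in> \<xi>"
  using boundary_rep[OF w \<xi> u] v by (auto simp: gromov_equiv_iff)

lemma boundary_reps_diverge:
  assumes w: "w \<in> M" and \<xi>: "\<xi> \<in> gromov_boundary X w" and u: "u \<in> \<xi>" "v \<in> \<xi>"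
  shows "products_diverge w u v"
  using boundary_rep(1)[OF w \<xi> u(1)] u(2) by (auto simp: gromov_equiv_iff)

lemma boundary_eqI:
  assumes w: "w \<in> M" and \<xi>: "\<xi> \<in> gromov_boundary X w" "\<eta> \<in> gromov_boundary X w"
    and u: "u \<in> \<xi>" "v \<in> \<eta>" "products_diverge w u v"
  shows "\<xi> = \<eta>"
  using boundary_rep[OF w \<xi>(1) u(1)] boundary_rep[OF w \<xi>(2) u(2)] u(3)
    equiv_class_eq[OF equiv_gromov[OF w], of u v] by (auto simp: gromov_equiv_iff)

lemma class_in_gromov_boundary:
  assumes w: "w \<in> M" and u: "range u \<subseteq> M" "products_diverge w u u"
  shows "gromov_equiv X w `` {u} \<in> gromov_boundary X w" "u \<in> gromov_equiv X w `` {u}"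
  using u by (auto simp: gromov_boundary_def converges_to_infinity_iff gromov_equiv_iff intro!: quotientI)

lemma products_diverge_far:
  assumes w: "w \<in> M" and u: "range u \<subseteq> M" "products_diverge w u u"
  shows "\<exists>N. \<forall>i\<ge>N. Z \<le> d w (u i)"
proof -
  obtain N where N: "\<forall>i\<ge>N. \<forall>j\<ge>N. Z \<le> gp w (u i) (u j)" using u(2) unfolding products_diverge_def by blast
  then have "\<forall>i\<ge>N. Z \<le> d w (u i)" using gp_self[OF w] u(1) by (metis UNIV_I image_subset_iff)
  then show ?thesis by blast
qed

lemma in_gromov_nbhd_iff:
  "\<eta> \<in> gromov_nbhd X w \<xi> R \<longleftrightarrow> \<eta> \<in> gromov_boundary X w \<and>
    (\<exists>u\<in>\<xi>. \<exists>v\<in>\<eta>. \<exists>N. \<forall>i\<ge>N. \<forall>j\<ge>N. R \<le> gp w (u i) (v j))"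
  unfolding gromov_nbhd_def eventually_prod_sequentially by fastforce

end

locale word_hyperbolic_group = group G for G (structure) +
  fixes S :: "'a set" and \<delta> :: real
  assumes finite_S: "finite S" and S_closed: "S \<subseteq> carrier G" and S_gen: "generate G S = carrier G"
    and graph: "hyperbolic_graph (word_metric G S) \<delta>"
begin

sublocale W: hyperbolic_graph "word_metric G S" \<delta> by (rule graph)

end

text \<open>The prefixes of a shortest word for \<open>inv g \<otimes> h\<close>, translated by
  \<open>g\<close>, form the geodesic.\<close>

lemma (in group) word_geodesic:
  assumes S: "S \<subseteq> carrier G" "generate G S = carrier G" and gh: "g \<in> carrier G" "h \<in> carrier G"
  shows "\<exists>\<gamma> n. discrete_geodesic (word_metric G S) g h \<gamma> n"
proof -
  define k where "k = inv g \<otimes> h"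
  have k: "k \<in> carrier G" using gh by (simp add: k_def)
  obtain ws where ws: "length ws = word_norm G S k" "is_word S ws" "val ws = k"
    using word_norm_attained[OF S k] .
  define n where "n = word_norm G S k"
  define \<gamma> where "\<gamma> i = g \<otimes> val (take i ws)" for i
  have w: "is_word S (take i ws)" "is_word S (drop i (take j ws))" for i j
    using ws(2) by (auto dest: in_set_takeD in_set_dropD)
  have vc: "val (take i ws) \<in> carrier G" "val (drop i (take j ws)) \<in> carrier G" for i j
    using val_closed[OF S(1)] w by blast+
  have gc: "\<gamma> i \<in> carrier G" for i using gh vc by (simp add: \<gamma>_def)
  have D: "Metric_space (carrier G) (word_dist G S)" using Metric_space_word_dist[OF S] .
  have le: "word_dist G S (\<gamma> i) (\<gamma> j) \<le> real (j - i)" if "i \<le> j" "j \<le> n" for i j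
  proof -
    have "take j ws = take i ws @ drop i (take j ws)"
      using that by (metis append_take_drop_id min.absorb1 take_take)
    then have "val (take j ws) = val (take i ws) \<otimes> val (drop i (take j ws))"
      using val_append[OF S(1) w(1) w(2), of i i j] by (metis (no_types, lifting))
    then have "\<gamma> j = \<gamma> i \<otimes> val (drop i (take j ws))"
      using gh vc by (simp add: \<gamma>_def m_assoc)
    then have "inv (\<gamma> i) \<otimes> \<gamma> j = val (drop i (take j ws))"
      using gc[of i] vc by (simp flip: m_assoc)
    moreover have "length (drop i (take j ws)) \<le> j - i" by simp
    ultimately show ?thesis
      using word_norm_le[OF w(2), of i j] gc by (simp add: word_dist_def)
  qed
  have ends: "\<gamma> 0 = g" "\<gamma> n = h"
    using gh ws by (auto simp: \<gamma>_def n_def k_def simp flip: m_assoc)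
  have tot: "word_dist G S (\<gamma> 0) (\<gamma> n) = real n"
    unfolding ends using gh by (simp add: word_dist_def n_def k_def)
  have eq: "word_dist G S (\<gamma> i) (\<gamma> j) = real j - real i" if "i \<le> j" "j \<le> n" for i j
  proof -
    \<comment> \<open>The three distances are bounded by lengths of subwords, and these bounds add
      up to the exact total, so none of them can be strict.\<close>
    have "word_dist G S (\<gamma> 0) (\<gamma> n) \<le> word_dist G S (\<gamma> 0) (\<gamma> i) + (word_dist G S (\<gamma> i) (\<gamma> j) + word_dist G S (\<gamma> j) (\<gamma> n))"
      using Metric_space.triangle[OF D gc[of 0] gc[of i] gc[of n]]
        Metric_space.triangle[OF D gc[of i] gc[of j] gc[of n]] by linarith
    then show ?thesis using tot le[of 0 i] le[of i j] le[of j n] that by simp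
  qed
  have "word_dist G S (\<gamma> i) (\<gamma> j) = \<bar>real i - real j\<bar>" if "i \<le> n" "j \<le> n" for i j
    using eq[of i j] eq[of j i] that Metric_space.commute[OF D, of "\<gamma> i" "\<gamma> j"] by (cases "i \<le> j") auto
  then show ?thesis
    using ends gc mspace_word_metric[OF S] mdist_word_metric[OF S]
    by (intro exI[of _ \<gamma>] exI[of _ n]) (auto simp: discrete_geodesic_def)
qed

lemma hyperbolic_group_word_hyperbolic:
  assumes "hyperbolic_group G S"
  shows "\<exists>\<delta>. word_hyperbolic_group G S \<delta>"
proof -
  interpret group G using assms by (simp add: hyperbolic_group_def)
  have S: "finite S" "S \<subseteq> carrier G" "generate G S = carrier G" and h: "gromov_hyperbolic (word_metric G S)"
    using assms by (auto simp: hyperbolic_group_def)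
  obtain \<delta> where d: "0 \<le> \<delta>" "\<forall>w\<in>mspace (word_metric G S). \<forall>x\<in>mspace (word_metric G S). \<forall>y\<in>mspace (word_metric G S). \<forall>z\<in>mspace (word_metric G S).
        gromov_product (word_metric G S) w x z \<ge> min (gromov_product (word_metric G S) w x y) (gromov_product (word_metric G S) w y z) - \<delta>"
    using h unfolding gromov_hyperbolic_def by blast
  \<comment> \<open>The hyperbolicity constant may be 0, whereas \<open>hyperbolic_graph\<close>
    wants a positive one.\<close>
  have "hyperbolic_graph (word_metric G S) (\<delta> + 1)"
  proof
    show "min (gromov_product (word_metric G S) w x y) (gromov_product (word_metric G S) w y z) - (\<delta> + 1)
        \<le> gromov_product (word_metric G S) w x z"
      if "w \<in> mspace (word_metric G S)" "x \<in> mspace (word_metric G S)" "y \<in> mspace (word_metric G S)" "z \<in> mspace (word_metric G S)" for w x y z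
      using d(2) that by force
    show "\<exists>\<gamma> n. discrete_geodesic (word_metric G S) x y \<gamma> n"
      if "x \<in> mspace (word_metric G S)" "y \<in> mspace (word_metric G S)" for x y
      using word_geodesic[OF S(2,3)] that mspace_word_metric[OF S(2,3)] by blast
  qed (use d in auto)
  then have "word_hyperbolic_group G S (\<delta> + 1)"
    using S by (intro word_hyperbolic_group.intro word_hyperbolic_group_axioms.intro is_group)
  then show ?thesis by blast
qed

context word_hyperbolic_group
begin

section \<open>Left-invariant computations in the word metric\<close>

abbreviation "dG \<equiv> mdist (word_metric G S)"
abbreviation "gp \<equiv> gromov_product (word_metric G S)"
abbreviation "len g \<equiv> mdist (word_metric G S) \<one> g"

lemma W_carrier [simp]: "mspace (word_metric G S) = carrier G"
  by (rule mspace_word_metric[OF S_closed S_gen])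

lemma dG_eq: "dG = word_dist G S"
  by (rule mdist_word_metric[OF S_closed S_gen])

lemma len_eq: "g \<in> carrier G \<Longrightarrow> len g = real (word_norm G S g)"
  by (simp add: dG_eq word_dist_def)

lemma dG_len: "g \<in> carrier G \<Longrightarrow> h \<in> carrier G \<Longrightarrow> dG g h = len (inv g \<otimes> h)"
  by (simp add: dG_eq word_dist_def)

lemma dG_left:
  assumes "a \<in> carrier G" "g \<in> carrier G" "h \<in> carrier G"
  shows "dG (a \<otimes> g) (a \<otimes> h) = dG g h"
proof -
  have "inv (a \<otimes> g) \<otimes> (a \<otimes> h) = inv g \<otimes> (inv a \<otimes> (a \<otimes> h))"
    using assms by (simp add: inv_mult_group m_assoc)
  also have "inv a \<otimes> (a \<otimes> h) = h" using assms m_assoc[of "inv a" a h] by simp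
  finally have "inv (a \<otimes> g) \<otimes> (a \<otimes> h) = inv g \<otimes> h" .
  then show ?thesis using assms dG_len[of g h] dG_len[of "a \<otimes> g" "a \<otimes> h"] by simp
qed

lemma dG_left': "a \<in> carrier G \<Longrightarrow> g \<in> carrier G \<Longrightarrow> h \<in> carrier G \<Longrightarrow> dG (inv a \<otimes> g) h = dG g (a \<otimes> h)"
  using dG_left[of a "inv a \<otimes> g" h] m_assoc[of a "inv a" g, symmetric] by simp

lemma len_inv: "g \<in> carrier G \<Longrightarrow> len (inv g) = len g"
  using dG_left'[of g \<one> \<one>] mdist_commute[of "word_metric G S" "inv g"] by simp

text \<open>The way to \<open>u \<otimes> g\<close> follows the way to \<open>u\<close> except for
  what cancels: \<open>gp \<one> (inv u) g\<close> measures how far \<open>g\<close> runs back along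
  \<open>u\<close>.\<close>

lemma gp_mult:
  assumes "u \<in> carrier G" "g \<in> carrier G"
  shows "gp \<one> (u \<otimes> g) u = len u - gp \<one> (inv u) g"
proof -
  have "dG (u \<otimes> g) u = len g"
    using dG_left[of u g \<one>] assms by (simp add: mdist_commute)
  moreover have "len (u \<otimes> g) = dG (inv u) g"
    using dG_left'[of u \<one> g] assms by simp
  ultimately show ?thesis using assms by (simp add: gromov_product_def len_inv field_simps)
qed

lemma finite_ball: "finite {g \<in> carrier G. len g \<le> r}"
proof -
  have "{g \<in> carrier G. len g \<le> r} \<subseteq> (\<lambda>ws. val ws) ` {ws. set ws \<subseteq> S \<union> m_inv G ` S \<and> length ws \<le> nat \<lfloor>r\<rfloor>}"
  proof
    fix g assume g: "g \<in> {g \<in> carrier G. len g \<le> r}"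
    then have c: "g \<in> carrier G" by simp
    obtain ws where ws: "length ws = word_norm G S g" "is_word S ws" "val ws = g"
      using word_norm_attained[OF S_closed S_gen c] .
    have "length ws \<le> nat \<lfloor>r\<rfloor>" using g ws(1) by (simp add: len_eq[OF c] le_nat_floor)
    then show "g \<in> (\<lambda>ws. val ws) ` {ws. set ws \<subseteq> S \<union> m_inv G ` S \<and> length ws \<le> nat \<lfloor>r\<rfloor>}"
      using ws by blast
  qed
  then show ?thesis
    by (rule finite_subset) (intro finite_imageI finite_lists_length_le, simp add: finite_S)
qed

lemma len_ge_diff: "g \<in> carrier G \<Longrightarrow> h \<in> carrier G \<Longrightarrow> len g \<le> len h + dG h g"
  by (rule mdist_triangle) auto

end

section \<open>Short elements that separate directions\<close>

lemma (in group) inv_cancel [simp]: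
  assumes "a \<in> carrier G" "g \<in> carrier G"
  shows "inv a \<otimes> (a \<otimes> g) = g" "a \<otimes> (inv a \<otimes> g) = g"
  using assms by (simp_all flip: m_assoc)

text \<open>A diagonal argument in the style of Koenig's lemma: the limit is fixed one coordinate at
  a time, keeping infinitely many sequences that agree with it so far.\<close>

lemma ex_limit_sequence:
  fixes \<gamma> :: "nat \<Rightarrow> nat \<Rightarrow> 'b"
  assumes fin: "\<And>i. finite (B i)" and \<gamma>: "\<And>n i. i \<le> n \<Longrightarrow> \<gamma> n i \<in> B i"
  shows "\<exists>p. \<forall>T n0. \<exists>n\<ge>n0. \<forall>i<T. \<gamma> n i = p i"
proof -
  define P where "P k f \<longleftrightarrow> infinite {n. \<forall>i<k. \<gamma> n i = f i}" for k and f :: "nat \<Rightarrow> 'b"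
  define Q where "Q k f f' \<longleftrightarrow> (\<forall>i<k. f' i = f i)" for k and f f' :: "nat \<Rightarrow> 'b"
  have "\<exists>F. \<forall>k. P k (F k) \<and> Q k (F k) (F (Suc k))"
  proof (rule dependent_nat_choice)
    show "\<exists>f. P 0 f" by (simp add: P_def)
    fix f k assume f: "P k f"
    \<comment> \<open>Indices below \<open>k\<close> are dropped because \<open>\<gamma> n k\<close>
      is known to lie in the finite set \<open>B k\<close> only for k \<le> n.\<close>
    define A where "A = {n. \<forall>i<k. \<gamma> n i = f i} - {..<k}"
    have A: "infinite A" using f by (simp add: A_def P_def)
    have "finite ((\<lambda>n. \<gamma> n k) ` A)" by (rule finite_subset[OF _ fin[of k]]) (auto simp: A_def not_less intro: \<gamma>)
    then obtain n0 where n0: "infinite {n \<in> A. \<gamma> n k = \<gamma> n0 k}"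
      using pigeonhole_infinite[OF A] by blast
    have "{n \<in> A. \<gamma> n k = \<gamma> n0 k} \<subseteq> {n. \<forall>i<Suc k. \<gamma> n i = (f(k := \<gamma> n0 k)) i}"
      by (auto simp: A_def less_Suc_eq)
    then have "P (Suc k) (f(k := \<gamma> n0 k))" unfolding P_def using n0 finite_subset by blast
    then show "\<exists>f'. P (Suc k) f' \<and> Q k f f'" by (intro exI[of _ "f(k := \<gamma> n0 k)"]) (simp add: Q_def)
  qed
  then obtain F where F: "\<And>k. P k (F k)" "\<And>k. Q k (F k) (F (Suc k))" by blast
  have eq: "i < k \<Longrightarrow> F k i = F (Suc i) i" for i k
  proof (induction k)
    case (Suc k)
    then show ?case using F(2)[of k] by (cases "i = k") (auto simp: Q_def)
  qed simp
  have "\<exists>n\<ge>n0. \<forall>i<T. \<gamma> n i = F (Suc i) i" for T n0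
  proof -
    have "\<exists>n\<ge>n0. n \<in> {n. \<forall>i<T. \<gamma> n i = F T i}"
      using F(1)[of T] unfolding P_def infinite_nat_iff_unbounded_le by (rule spec)
    then obtain n where n: "n \<ge> n0" "\<forall>i<T. \<gamma> n i = F T i" by auto
    have "\<gamma> n i = F (Suc i) i" if "i < T" for i
    proof -
      have "\<gamma> n i = F T i" using n(2) that by blast
      also have "\<dots> = F (Suc i) i" using that by (rule eq)
      finally show ?thesis .
    qed
    then show ?thesis using n(1) by blast
  qed
  then show ?thesis by (intro exI[of _ "\<lambda>i. F (Suc i) i"]) simp
qed

context word_hyperbolic_group
begin

text \<open>The chain from \<open>a \<otimes> \<gamma> T\<close> over \<open>a \<otimes> v\<close>
  and \<open>v\<close> to \<open>\<gamma> t\<close> has a large Gromov product at each link. Its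
  ends have length \<open>t\<close> and product at least t - 3\<delta>, hence distance at most
  6\<delta>.\<close>

lemma translate_fellow_travels:
  assumes v: "v \<in> carrier G" and a: "a \<in> carrier G" and \<gamma>: "discrete_geodesic (word_metric G S) \<one> v \<gamma> N"
    and n: "real n \<le> gp \<one> (a \<otimes> v) v" and T: "T \<le> N" "len a + \<delta> < real T"
    and t: "real t = len (a \<otimes> \<gamma> T)" "t \<le> n"
  shows "t \<le> N" "dG (a \<otimes> \<gamma> T) (\<gamma> t) \<le> 6 * \<delta>"
proof -
  have g: "\<gamma> 0 = \<one>" "\<gamma> N = v" "\<And>i. i \<le> N \<Longrightarrow> \<gamma> i \<in> carrier G"
    "\<And>i j. i \<le> N \<Longrightarrow> j \<le> N \<Longrightarrow> dG (\<gamma> i) (\<gamma> j) = \<bar>real i - real j\<bar>"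
    using \<gamma> by (auto simp: discrete_geodesic_def)
  have lenv: "len v = real N" using g(4)[of 0 N] g(1,2) by simp
  have "real n \<le> real N" using n W.gp_le'[of \<one> "a \<otimes> v" v] a v lenv by simp
  then show tN: "t \<le> N" using t by simp
  define x where "x = a \<otimes> \<gamma> T"
  have x: "x \<in> carrier G" using a g T by (simp add: x_def)
  have d: "dG x a = real T" "dG x (a \<otimes> v) = real N - real T" "dG a (a \<otimes> v) = real N"
    using dG_left[OF a, of "\<gamma> T" \<one>] dG_left[OF a, of "\<gamma> T" v] dG_left[OF a, of \<one> v] g(4)[of T 0] g(4)[of T N]
      g T a v lenv by (auto simp: x_def)
  \<comment> \<open>\<open>x\<close> lies on the geodesic from \<open>a\<close> to
    \<open>a \<otimes> v\<close>. As its product with \<open>a\<close> and \<one> exceeds \<delta>,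
    the other entry of the minimum must be small: seen from \<open>x\<close>, the points \<one> and
    \<open>a \<otimes> v\<close> lie on opposite sides.\<close>
  have "gp x a (a \<otimes> v) = 0" using d by (simp add: gromov_product_def)
  moreover have "min (gp x a \<one>) (gp x \<one> (a \<otimes> v)) - \<delta> \<le> gp x a (a \<otimes> v)"
    using x a v by (intro W.four_point) auto
  moreover have "real T - len a \<le> gp x a \<one>"
    using W.gp_ge[of x a \<one>] x a d by (simp add: mdist_commute)
  ultimately have "gp x \<one> (a \<otimes> v) \<le> \<delta>" using T by linarith
  moreover have "gp \<one> x (a \<otimes> v) = len x - gp x \<one> (a \<otimes> v)"
    unfolding gromov_product_def using mdist_commute[of "word_metric G S" x \<one>] by (simp add: field_simps)
  ultimately have 1: "real t - \<delta> \<le> gp \<one> x (a \<otimes> v)" using t by (simp add: x_def)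
  have lt: "len (\<gamma> t) = real t" using g(4)[of 0 t] g(1) tN by simp
  have 2: "gp \<one> v (\<gamma> t) = real t"
    using g(4)[of N t] g(2) tN lt by (simp add: gromov_product_def lenv)
  have "min (gp \<one> x (a \<otimes> v)) (min (gp \<one> (a \<otimes> v) v) (gp \<one> v (\<gamma> t))) - 2 * \<delta> \<le> gp \<one> x (\<gamma> t)"
    using x a v g tN by (intro W.five_point) auto
  then have "real t - 3 * \<delta> \<le> gp \<one> x (\<gamma> t)" using 1 2 n t(2) W.delta_pos by linarith
  then show "dG (a \<otimes> \<gamma> T) (\<gamma> t) \<le> 6 * \<delta>"
    using t(1) lt by (simp add: gromov_product_def x_def)
qed

text \<open>A failure of separation at level \<open>n\<close>: short left factors turn neither
  \<open>v\<close> nor its inverse away from the direction of \<open>v\<close>. The translates of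
  \<open>v\<close> yield an invariant ray in the limit, and the condition on \<open>inv v\<close>
  then contradicts it.\<close>

definition unseparated :: "nat \<Rightarrow> 'a \<Rightarrow> bool" where
  "unseparated n v \<longleftrightarrow> v \<in> carrier G \<and> (\<forall>a\<in>carrier G. len a \<le> real n \<longrightarrow>
     real n \<le> gp \<one> (a \<otimes> v) v \<and> real n \<le> gp \<one> (a \<otimes> inv v) v)"

text \<open>
  A geodesic ray representing a boundary point fixed by the whole group, in a quantitative form.
\<close>

definition invariant_ray :: "(nat \<Rightarrow> 'a) \<Rightarrow> bool" where
  "invariant_ray p \<longleftrightarrow> p 0 = \<one> \<and> (\<forall>t. p t \<in> carrier G) \<and> (\<forall>i j. dG (p i) (p j) = \<bar>real i - real j\<bar>) \<and>
    (\<forall>a\<in>carrier G. \<forall>T t. len a + \<delta> < real T \<and> real t = len (a \<otimes> p T) \<longrightarrow> dG (a \<otimes> p T) (p t) \<le> 6 * \<delta>)"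

text \<open>Geodesics to elements unseparated at ever higher levels subconverge since balls are
  finite. Fellow travelling of a translate involves only two vertices at a time, so it passes to the
  limit.\<close>

lemma ex_invariant_ray:
  assumes "\<And>n. \<exists>v. unseparated n v"
  shows "\<exists>p. invariant_ray p"
proof -
  obtain v where v: "\<And>n. unseparated n (v n)" using assms by metis
  have vG: "v n \<in> carrier G" for n using v by (simp add: unseparated_def)
  have "\<forall>n. \<exists>\<gamma> N. discrete_geodesic (word_metric G S) \<one> (v n) \<gamma> N"
    using W.discrete_geodesic_ex vG by auto
  then obtain \<gamma> N where \<gamma>: "\<And>n. discrete_geodesic (word_metric G S) \<one> (v n) (\<gamma> n) (N n)" by metis
  have g: "\<gamma> n 0 = \<one>" "\<And>i. i \<le> N n \<Longrightarrow> \<gamma> n i \<in> carrier G"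
    "\<And>i j. i \<le> N n \<Longrightarrow> j \<le> N n \<Longrightarrow> dG (\<gamma> n i) (\<gamma> n j) = \<bar>real i - real j\<bar>" for n
    using \<gamma>[of n] by (auto simp: discrete_geodesic_def)
  have nN: "n \<le> N n" for n
  proof -
    \<comment> \<open>The case \<open>a = \<one>\<close> shows that the geodesic to
      \<open>v n\<close> has at least \<open>n\<close> steps.\<close>
    have "real n \<le> gp \<one> (\<one> \<otimes> v n) (v n)"
      using v[of n] one_closed unfolding unseparated_def by (metis W_carrier mdist_self of_nat_0_le_iff)
    also have "\<dots> \<le> len (v n)" using vG by (intro W.gp_le') auto
    also have "\<dots> = real (N n)" using W.discrete_geodesic_dist[OF \<gamma>] .
    finally show ?thesis by simp
  qed
  define B where "B i = {g \<in> carrier G. len g \<le> real i}" for i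
  have "\<gamma> n i \<in> B i" if "i \<le> n" for n i
    using g(1)[of n] g(2)[of i n] g(3)[of 0 n i] nN[of n] that by (simp add: B_def)
  then obtain p where p: "\<And>T n0. \<exists>n\<ge>n0. \<forall>i<T. \<gamma> n i = p i"
    using ex_limit_sequence[of B \<gamma>] finite_ball by (auto simp: B_def)
  have "p 0 = \<one>" using p[of 0 1] g(1) by auto
  moreover have "p t \<in> carrier G" for t
  proof -
    obtain n where "n \<ge> t" "\<gamma> n t = p t" using p[of t "Suc t"] by auto
    then show ?thesis using g(2)[of t n] nN[of n] by auto
  qed
  moreover have "dG (p i) (p j) = \<bar>real i - real j\<bar>" for i j
  proof -
    obtain n where "n \<ge> max i j" "\<gamma> n i = p i" "\<gamma> n j = p j" using p[of "max i j" "Suc (max i j)"] by auto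
    then show ?thesis using g(3)[of i n j] nN[of n] by auto
  qed
  moreover have "dG (a \<otimes> p T) (p t) \<le> 6 * \<delta>"
    if a: "a \<in> carrier G" and T: "len a + \<delta> < real T" and t: "real t = len (a \<otimes> p T)" for a T t
  proof -
    \<comment> \<open>Large enough for the vertices \<open>T\<close> and \<open>t\<close> to exist
      and for \<open>a\<close> to be among the left factors that \<open>unseparated n\<close>
      controls.\<close>
    define n0 where "n0 = max (max T t) (nat \<lceil>len a\<rceil>)"
    obtain n where n: "n \<ge> n0" "\<forall>i<Suc (max T t). \<gamma> n i = p i" using p by blast
    have n': "T \<le> n" "t \<le> n" "len a \<le> real n" using n(1) unfolding n0_def by (auto simp: le_max_iff_disj)
    have eq: "\<gamma> n T = p T" "\<gamma> n t = p t" using n(2) by auto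
    have "real n \<le> gp \<one> (a \<otimes> v n) (v n)" using v[of n] a n' unfolding unseparated_def by blast
    then show ?thesis
      using translate_fellow_travels(2)[OF vG a \<gamma>, of n n T t] T t n' nN[of n] eq by auto
  qed
  ultimately show ?thesis unfolding invariant_ray_def by blast
qed

context
  fixes p assumes p: "invariant_ray p"
begin

section \<open>Translations along an invariant ray\<close>

lemma ray_basic: "p 0 = \<one>" "p t \<in> carrier G" "dG (p i) (p j) = \<bar>real i - real j\<bar>" "len (p t) = real t"
proof -
  show 0: "p 0 = \<one>" "p t \<in> carrier G" "dG (p i) (p j) = \<bar>real i - real j\<bar>" for t i j
    using p by (auto simp: invariant_ray_def)
  show "len (p t) = real t" using 0(3)[of 0 t] 0(1) by simp
qed

lemma ray_translate:
  "a \<in> carrier G \<Longrightarrow> len a + \<delta> < real T \<Longrightarrow> real t = len (a \<otimes> p T) \<Longrightarrow> dG (a \<otimes> p T) (p t) \<le> 6 * \<delta>"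
  using p unfolding invariant_ray_def by blast

text \<open>Translation by the inverse of \<open>p s\<close> takes \<open>p (s + t)\<close> to an
  element of length \<open>t\<close>, hence close to \<open>p t\<close>. So \<open>p\<close> is
  additive up to a bounded error; for \<open>t\<close> at most \<delta> the triangle inequality
  suffices.\<close>

lemma ray_add: "dG (p (s + t)) (p s \<otimes> p t) \<le> 6 * \<delta> + 2"
proof (cases "\<delta> < real t")
  case True
  have "len (inv (p s) \<otimes> p (s + t)) = real t"
    using dG_len[of "p s" "p (s + t)"] ray_basic by simp
  then have "dG (inv (p s) \<otimes> p (s + t)) (p t) \<le> 6 * \<delta>"
    using True ray_basic len_inv[of "p s"] by (intro ray_translate) auto
  then show ?thesis using dG_left'[of "p s" "p (s + t)" "p t"] ray_basic by simp
next
  case False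
  have "dG (p (s + t)) (p s \<otimes> p t) \<le> dG (p (s + t)) (p s) + dG (p s \<otimes> \<one>) (p s \<otimes> p t)"
    using mdist_triangle[of "p (s + t)" "word_metric G S" "p s" "p s \<otimes> p t"] ray_basic by simp
  also have "\<dots> = 2 * real t" using dG_left[of "p s" \<one> "p t"] ray_basic by simp
  finally show ?thesis using False by simp
qed

text \<open>The part of the group that does not shift far along the ray. With the tolerance
  \<open>k\<close> it need not be a subgroup; what matters is that it is finite.\<close>

definition ray_stabilizer :: "real \<Rightarrow> 'a set" where
  "ray_stabilizer k = {e \<in> carrier G. \<exists>T0. \<forall>T\<ge>T0. dG (e \<otimes> p T) (p T) \<le> k}"

text \<open>
  Far along the ray, conjugation by \<open>p T\<close> moves any finite part of the stabilizer into a fixed ball.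
\<close>

lemma finite_ray_stabilizer: "finite (ray_stabilizer k)"
proof (rule ccontr)
  define B where "B = {g \<in> carrier G. len g \<le> k}"
  assume "infinite (ray_stabilizer k)"
  then obtain F where F: "finite F" "card F = Suc (card B)" "F \<subseteq> ray_stabilizer k"
    using infinite_arbitrarily_large by blast
  then have "\<forall>e\<in>F. \<exists>T0. \<forall>T\<ge>T0. dG (e \<otimes> p T) (p T) \<le> k" by (auto simp: ray_stabilizer_def)
  then obtain T0 where T0: "\<forall>e\<in>F. \<forall>T\<ge>T0 e. dG (e \<otimes> p T) (p T) \<le> k" by metis
  define T where "T = Max (insert 0 (T0 ` F))"
  have T: "dG (e \<otimes> p T) (p T) \<le> k" if "e \<in> F" for e
    using T0 that F(1) by (simp add: T_def)
  have FG: "F \<subseteq> carrier G" using F(3) by (auto simp: ray_stabilizer_def)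
  have "inj_on (\<lambda>e. inv (p T) \<otimes> (e \<otimes> p T)) F"
  proof (rule inj_onI)
    fix x y assume xy: "x \<in> F" "y \<in> F" "inv (p T) \<otimes> (x \<otimes> p T) = inv (p T) \<otimes> (y \<otimes> p T)"
    then have "x \<in> carrier G" "y \<in> carrier G" using FG by auto
    then show "x = y" using xy(3) ray_basic(2)[of T] by simp
  qed
  moreover have "(\<lambda>e. inv (p T) \<otimes> (e \<otimes> p T)) ` F \<subseteq> B"
  proof clarify
    fix e assume e: "e \<in> F"
    then have "e \<in> carrier G" using FG by auto
    then show "inv (p T) \<otimes> (e \<otimes> p T) \<in> B"
      using T[OF e] dG_len[of "p T" "e \<otimes> p T"] ray_basic(2)[of T] by (simp add: B_def mdist_commute)
  qed
  ultimately have "card F \<le> card B" using finite_ball by (intro card_inj_on_le) (auto simp: B_def)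
  then show False using F by simp
qed

text \<open>The length of \<open>a \<otimes> p T\<close> differs from \<open>T\<close> by an almost
  constant amount, a discrete Busemann shift. Its value at \<open>T0\<close> is taken as
  \<open>s\<close>; comparing two times costs 12\<delta>, and \<open>ray_translate\<close> another
  6\<delta>.\<close>

lemma ray_translate_shift:
  assumes a: "a \<in> carrier G"
  obtains s :: int where "\<And>T. real T > 4 * len a + 2 * \<delta> + 4 \<Longrightarrow> 0 \<le> int T + s \<and>
    dG (a \<otimes> p T) (p (nat (int T + s))) \<le> 18 * \<delta>"
proof -
  define \<tau> where "\<tau> T = word_norm G S (a \<otimes> p T)" for T
  have \<tau>: "real (\<tau> T) = len (a \<otimes> p T)" for T using a ray_basic by (simp add: \<tau>_def len_eq)
  have \<tau>b: "\<bar>real (\<tau> T) - real T\<bar> \<le> len a" for T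
  proof -
    have "dG a (a \<otimes> p T) = real T" using dG_left[OF a, of \<one> "p T"] a ray_basic by simp
    then show ?thesis
      using \<tau> mdist_triangle[of \<one> "word_metric G S" a "a \<otimes> p T"] mdist_triangle[of a "word_metric G S" \<one> "a \<otimes> p T"]
        mdist_commute[of "word_metric G S" a \<one>] a ray_basic by simp
  qed
  define T0 where "T0 = nat \<lceil>len a + \<delta> + 1\<rceil>"
  have l0: "0 \<le> len a" by simp
  have T0: "len a + \<delta> < real T0" "real T0 \<le> len a + \<delta> + 2" using W.delta_pos l0 unfolding T0_def by linarith+
  define s where "s = int (\<tau> T0) - int T0"
  show thesis
  proof (rule that[of s])
    \<comment> \<open>Beyond this threshold \<open>\<tau> T\<close> is at least
      \<open>\<tau> T0\<close> and the shifted index is nonnegative, so absolute values and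
      \<open>nat\<close> can be removed.\<close>
    fix T assume T: "real T > 4 * len a + 2 * \<delta> + 4"
    then have T': "len a + \<delta> < real T" "real T0 + 2 * len a < real T" "T0 < T"
      using T0 W.delta_pos l0 by linarith+
    have 1: "dG (a \<otimes> p T) (p (\<tau> T)) \<le> 6 * \<delta>" using a T' \<tau> by (intro ray_translate) auto
    have 2: "dG (a \<otimes> p T0) (p (\<tau> T0)) \<le> 6 * \<delta>" using a T0 \<tau> by (intro ray_translate) auto
    have "dG (a \<otimes> p T) (a \<otimes> p T0) = real T - real T0" using dG_left[OF a, of "p T" "p T0"] ray_basic T' by simp
    moreover have "dG (p (\<tau> T)) (p (\<tau> T0)) = real (\<tau> T) - real (\<tau> T0)"
      using ray_basic \<tau>b[of T] \<tau>b[of T0] T' by (simp add: abs_le_iff)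
    moreover have "dG (a \<otimes> p T) (a \<otimes> p T0) \<le> dG (a \<otimes> p T) (p (\<tau> T)) + dG (p (\<tau> T)) (p (\<tau> T0)) + dG (p (\<tau> T0)) (a \<otimes> p T0)"
      using a ray_basic by (intro triangle4) auto
    moreover have "dG (p (\<tau> T)) (p (\<tau> T0)) \<le> dG (p (\<tau> T)) (a \<otimes> p T) + dG (a \<otimes> p T) (a \<otimes> p T0) + dG (a \<otimes> p T0) (p (\<tau> T0))"
      using a ray_basic by (intro triangle4) auto
    ultimately have 3: "\<bar>real (\<tau> T) - real T - of_int s\<bar> \<le> 12 * \<delta>"
      using 1 2 mdist_commute[of "word_metric G S" "p (\<tau> T)" "a \<otimes> p T"]
        mdist_commute[of "word_metric G S" "p (\<tau> T0)" "a \<otimes> p T0"] by (simp add: s_def abs_le_iff)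
    have nn: "0 \<le> int T + s" using T' \<tau>b[of T0] unfolding s_def by linarith
    have "dG (p (\<tau> T)) (p (nat (int T + s))) = \<bar>real (\<tau> T) - real (nat (int T + s))\<bar>" by (rule ray_basic)
    also have "\<dots> \<le> 12 * \<delta>" using 3 nn by simp
    finally have "dG (a \<otimes> p T) (p (nat (int T + s))) \<le> 18 * \<delta>"
      using 1 mdist_triangle[of "a \<otimes> p T" "word_metric G S" "p (\<tau> T)" "p (nat (int T + s))"] a ray_basic by simp
    then show "0 \<le> int T + s \<and> dG (a \<otimes> p T) (p (nat (int T + s))) \<le> 18 * \<delta>" using nn by blast
  qed
qed

text \<open>Undoing the shift of \<open>a\<close> by \<open>p s\<close> or its inverse leaves an
  element that no longer shifts. The tolerance adds 18\<delta> from the shift and 6\<delta> + 2 from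
  the additivity of \<open>p\<close>.\<close>

lemma ray_decomposition:
  assumes a: "a \<in> carrier G"
  shows "\<exists>s. \<exists>e\<in>ray_stabilizer (24 * \<delta> + 2). a = p s \<otimes> e \<or> a = inv (p s) \<otimes> e"
proof -
  obtain s where s: "\<And>T. real T > 4 * len a + 2 * \<delta> + 4 \<Longrightarrow> 0 \<le> int T + s \<and>
    dG (a \<otimes> p T) (p (nat (int T + s))) \<le> 18 * \<delta>" using ray_translate_shift[OF a] by blast
  define T1 where "T1 = nat \<lceil>4 * len a + 2 * \<delta> + 5\<rceil>"
  have T1: "real T > 4 * len a + 2 * \<delta> + 4" if "T \<ge> T1" for T using that unfolding T1_def by linarith
  show ?thesis
  proof (cases "0 \<le> s")
    case True
    define k where "k = nat s"
    define e where "e = inv (p k) \<otimes> a"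
    have eG: "e \<in> carrier G" using a ray_basic by (simp add: e_def)
    have "dG (e \<otimes> p T) (p T) \<le> 24 * \<delta> + 2" if T: "T \<ge> T1" for T
    proof -
      have "nat (int T + s) = k + T" using True by (simp add: k_def nat_add_distrib)
      then have "dG (a \<otimes> p T) (p (k + T)) \<le> 18 * \<delta>" using s[OF T1[OF T]] by simp
      then have "dG (a \<otimes> p T) (p k \<otimes> p T) \<le> 24 * \<delta> + 2"
        using ray_add[of k T] mdist_triangle[of "a \<otimes> p T" "word_metric G S" "p (k + T)" "p k \<otimes> p T"] a ray_basic by simp
      then show ?thesis using dG_left'[of "p k" "a \<otimes> p T" "p T"] a ray_basic by (simp add: e_def m_assoc)
    qed
    then have "e \<in> ray_stabilizer (24 * \<delta> + 2)" using eG by (auto simp: ray_stabilizer_def)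
    moreover have "a = p k \<otimes> e" using a ray_basic by (simp add: e_def)
    ultimately show ?thesis by blast
  next
    case False
    define k where "k = nat (- s)"
    define e where "e = p k \<otimes> a"
    have eG: "e \<in> carrier G" using a ray_basic by (simp add: e_def)
    have "dG (e \<otimes> p T) (p T) \<le> 24 * \<delta> + 2" if T: "T \<ge> T1" for T
    proof -
      have k: "k \<le> T" "nat (int T + s) = T - k" using False s[OF T1[OF T]] by (auto simp: k_def)
      then have "dG (a \<otimes> p T) (p (T - k)) \<le> 18 * \<delta>" using s[OF T1[OF T]] by simp
      then have "dG (p k \<otimes> (a \<otimes> p T)) (p k \<otimes> p (T - k)) \<le> 18 * \<delta>"
        using dG_left[of "p k" "a \<otimes> p T" "p (T - k)"] a ray_basic by simp
      moreover have "dG (p k \<otimes> p (T - k)) (p T) \<le> 6 * \<delta> + 2"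
        using ray_add[of k "T - k"] k(1) by (simp add: mdist_commute)
      ultimately show ?thesis
        using mdist_triangle[of "p k \<otimes> (a \<otimes> p T)" "word_metric G S" "p k \<otimes> p (T - k)" "p T"] a ray_basic
        by (simp add: e_def m_assoc)
    qed
    then have "e \<in> ray_stabilizer (24 * \<delta> + 2)" using eG by (auto simp: ray_stabilizer_def)
    moreover have "a = inv (p k) \<otimes> e" using a ray_basic by (simp add: e_def)
    ultimately show ?thesis by blast
  qed
qed

text \<open>Each element is controlled along the whole ray, late by \<open>k\<close> and early by
  the triangle inequality; finiteness makes the bound uniform.\<close>

lemma ray_stabilizer_bounded:
  "\<exists>c\<ge>0. \<forall>e\<in>ray_stabilizer k. len e \<le> c \<and> (\<forall>s. dG (e \<otimes> p s) (p s) \<le> c)"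
proof -
  have "\<forall>e\<in>ray_stabilizer k. \<exists>c. len e \<le> c \<and> (\<forall>s. dG (e \<otimes> p s) (p s) \<le> c)"
  proof
    fix e assume "e \<in> ray_stabilizer k"
    then obtain T0 where e: "e \<in> carrier G" and T0: "\<And>T. T \<ge> T0 \<Longrightarrow> dG (e \<otimes> p T) (p T) \<le> k"
      by (auto simp: ray_stabilizer_def)
    define c where "c = max k (2 * real T0 + len e)"
    have "dG (e \<otimes> p s) (p s) \<le> c" for s
    proof (cases "s \<ge> T0")
      case True
      then show ?thesis using T0[OF True] by (simp add: c_def)
    next
      case False
      have "dG (e \<otimes> p s) (p s) \<le> dG (e \<otimes> p s) (e \<otimes> \<one>) + dG (e \<otimes> \<one>) \<one> + dG \<one> (p s)"
        using e ray_basic by (intro triangle4) auto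
      also have "\<dots> = 2 * real s + len e"
        using dG_left[OF e, of "p s" \<one>] ray_basic e by (simp add: mdist_commute)
      finally show ?thesis using False by (simp add: c_def)
    qed
    then show "\<exists>c. len e \<le> c \<and> (\<forall>s. dG (e \<otimes> p s) (p s) \<le> c)" by (intro exI[of _ c]) (simp add: c_def le_max_iff_disj)
  qed
  then obtain c where c: "\<forall>e\<in>ray_stabilizer k. len e \<le> c e \<and> (\<forall>s. dG (e \<otimes> p s) (p s) \<le> c e)" by metis
  define C where "C = Max (insert 0 (c ` ray_stabilizer k))"
  have C: "c e \<le> C" if "e \<in> ray_stabilizer k" for e
    using that finite_ray_stabilizer by (simp add: C_def)
  have "0 \<le> C" using finite_ray_stabilizer by (simp add: C_def)
  then show ?thesis using c C by (intro exI[of _ C]) (meson order_trans)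
qed

text \<open>The square of \<open>w\<close> contains
  \<open>p s \<otimes> ((y \<otimes> x) \<otimes> p s)\<close>, which is close to
  \<open>p (s + s)\<close> and so about twice as long as \<open>w\<close>. Little cancellation in
  the square means a small Gromov product of \<open>inv w\<close> and \<open>w\<close>.\<close>

lemma ray_square:
  assumes xy: "x \<in> carrier G" "y \<in> carrier G" "len x \<le> c" "len y \<le> c"
    and c: "dG ((y \<otimes> x) \<otimes> p s) (p s) \<le> c" and w: "w = x \<otimes> (p s \<otimes> y)"
  shows "gp \<one> (inv w) w \<le> 4 * c + 3 * \<delta> + 1"
proof -
  define z where "z = p s \<otimes> ((y \<otimes> x) \<otimes> p s)"
  have G: "w \<in> carrier G" "z \<in> carrier G" "p s \<in> carrier G" using xy w ray_basic by (auto simp: z_def)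
  have "2 * real s \<le> len (p s \<otimes> p s) + (6 * \<delta> + 2)"
    using ray_add[of s s] len_ge_diff[of "p (s + s)" "p s \<otimes> p s"] ray_basic by (simp add: mdist_commute)
  moreover have "len (p s \<otimes> p s) \<le> len z + c"
    using len_ge_diff[of "p s \<otimes> p s" z] dG_left[of "p s" "(y \<otimes> x) \<otimes> p s" "p s"] c xy G by (simp add: z_def)
  moreover have "len z \<le> len (w \<otimes> w) + 2 * c"
  proof -
    have ww: "w \<otimes> w = x \<otimes> (z \<otimes> y)" using xy G by (simp add: w z_def m_assoc)
    have "len z \<le> len (z \<otimes> y) + dG (z \<otimes> y) (z \<otimes> \<one>)"
      using len_ge_diff[of z "z \<otimes> y"] xy G by simp
    also have "dG (z \<otimes> y) (z \<otimes> \<one>) = len y" using dG_left[of z y \<one>] xy G by (simp add: mdist_commute)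
    also have "len (z \<otimes> y) = dG x (x \<otimes> (z \<otimes> y))" using dG_left[of x \<one> "z \<otimes> y"] xy G by simp
    also have "\<dots> \<le> len x + len (w \<otimes> w)"
      using mdist_triangle[of x "word_metric G S" \<one> "w \<otimes> w"] xy G mdist_commute[of "word_metric G S" x \<one>]
      by (simp flip: ww)
    finally show ?thesis using xy by simp
  qed
  moreover have "len w \<le> real s + 2 * c"
  proof -
    have "len w \<le> len x + dG (x \<otimes> \<one>) (x \<otimes> (p s \<otimes> y))"
      using len_ge_diff[of w x] xy G by (simp add: w)
    also have "dG (x \<otimes> \<one>) (x \<otimes> (p s \<otimes> y)) = len (p s \<otimes> y)" using xy G by (intro dG_left) auto
    also have "\<dots> \<le> len (p s) + dG (p s \<otimes> \<one>) (p s \<otimes> y)" using len_ge_diff[of "p s \<otimes> y" "p s"] xy G by simp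
    also have "dG (p s \<otimes> \<one>) (p s \<otimes> y) = len y" using xy G by (intro dG_left) auto
    finally show ?thesis using xy ray_basic by simp
  qed
  moreover have "dG (inv w) w = len (w \<otimes> w)" using dG_left'[of w \<one> w] G by simp
  moreover have "0 \<le> c" by (rule order_trans[OF mdist_nonneg xy(3)])
  moreover have "2 * gp \<one> (inv w) w = len (inv w) + len w - dG (inv w) w" by (simp add: gromov_product_def)
  ultimately show ?thesis using len_inv[OF G(1)] W.delta_pos by linarith
qed

text \<open>Every \<open>v\<close> has the form treated by \<open>ray_square\<close>, possibly after
  inversion, so \<open>v\<close> and \<open>inv v\<close> part early; being unseparated at level
  \<open>n\<close> would force their product up to \<open>n\<close>.\<close>

lemma ray_bounds_unseparated: "\<exists>n. \<forall>v. \<not> unseparated n v"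
proof -
  obtain c where c: "0 \<le> c" "\<And>e. e \<in> ray_stabilizer (24 * \<delta> + 2) \<Longrightarrow> len e \<le> c"
    "\<And>e s. e \<in> ray_stabilizer (24 * \<delta> + 2) \<Longrightarrow> dG (e \<otimes> p s) (p s) \<le> c"
    using ray_stabilizer_bounded[of "24 * \<delta> + 2"] by blast
  define n where "n = nat \<lceil>4 * c + 3 * \<delta> + 2\<rceil>"
  have n: "4 * c + 3 * \<delta> + 1 < real n" unfolding n_def by linarith
  have "\<not> unseparated n v" for v
  proof
    assume v: "unseparated n v"
    then have vG: "v \<in> carrier G" by (simp add: unseparated_def)
    have "real n \<le> gp \<one> (\<one> \<otimes> inv v) v"
      using v one_closed unfolding unseparated_def by (metis W_carrier mdist_self of_nat_0_le_iff)
    then have big: "real n \<le> gp \<one> (inv v) v" using vG by simp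
    obtain s e where e: "e \<in> ray_stabilizer (24 * \<delta> + 2)" "v = p s \<otimes> e \<or> v = inv (p s) \<otimes> e"
      using ray_decomposition[OF vG] by blast
    have eG: "e \<in> carrier G" using e by (simp add: ray_stabilizer_def)
    have "gp \<one> (inv v) v \<le> 4 * c + 3 * \<delta> + 1"
    proof (cases "v = p s \<otimes> e")
      case True
      then show ?thesis using c(1) c(2,3)[OF e(1)] eG ray_basic by (intro ray_square[of \<one> e]) auto
    next
      case False
      then have v: "v = inv (p s) \<otimes> e" using e by blast
      have iv: "inv v = inv e \<otimes> (p s \<otimes> \<one>)" using eG ray_basic by (simp add: v inv_mult_group)
      have "dG (inv e \<otimes> p s) (p s) = dG (p s) (e \<otimes> p s)" using eG ray_basic by (intro dG_left') auto
      then have "gp \<one> (inv (inv v)) (inv v) \<le> 4 * c + 3 * \<delta> + 1"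
        using c(1) c(2,3)[OF e(1)] eG ray_basic iv len_inv[OF eG] mdist_commute[of "word_metric G S" "p s"]
        by (intro ray_square[of "inv e" \<one>]) auto
      then show ?thesis using vG W.gp_commute[of \<one> v] by simp
    qed
    then show False using big n by linarith
  qed
  then show ?thesis by blast
qed

end

text \<open>If all short \<open>a\<close> fail, then \<open>v\<close> (take
  \<open>a = \<one>\<close>), \<open>a \<otimes> v\<close> and \<open>a \<otimes> inv v\<close> all
  point along \<open>u\<close>, hence along each other up to \<delta>, and \<open>v\<close> is
  unseparated.\<close>

theorem ex_separating_elements:
  "\<exists>n. \<forall>u\<in>carrier G. \<forall>v\<in>carrier G. \<exists>a\<in>carrier G. len a \<le> real n \<and>
    (gp \<one> u (a \<otimes> v) \<le> real n + \<delta> \<or> gp \<one> u (a \<otimes> inv v) \<le> real n + \<delta>)"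
proof -
  obtain n where n: "\<And>v. \<not> unseparated n v"
  proof (cases "\<forall>n. \<exists>v. unseparated n v")
    case True
    then obtain p where "invariant_ray p" using ex_invariant_ray by blast
    then show thesis using ray_bounds_unseparated that by blast
  qed (use that in blast)
  have "\<exists>a\<in>carrier G. len a \<le> real n \<and> (gp \<one> u (a \<otimes> v) \<le> real n + \<delta> \<or> gp \<one> u (a \<otimes> inv v) \<le> real n + \<delta>)"
    if uv: "u \<in> carrier G" "v \<in> carrier G" for u v
  proof (rule ccontr)
    assume "\<not> ?thesis"
    then have far: "real n + \<delta> < gp \<one> u (a \<otimes> v)" "real n + \<delta> < gp \<one> u (a \<otimes> inv v)"
      if "a \<in> carrier G" "len a \<le> real n" for a using that by force+
    have v: "real n + \<delta> < gp \<one> u v" using far(1)[of \<one>] uv by simp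
    have "unseparated n v"
      unfolding unseparated_def
    proof (intro conjI ballI impI)
      fix a assume a: "a \<in> carrier G" "len a \<le> real n"
      show "real n \<le> gp \<one> (a \<otimes> v) v" "real n \<le> gp \<one> (a \<otimes> inv v) v"
        using W.four_point[of \<one> "a \<otimes> v" u v] W.four_point[of \<one> "a \<otimes> inv v" u v] far[OF a] v a uv
          W.gp_commute[of \<one> u] by auto
    qed (rule uv)
    then show False using n by blast
  qed
  then show ?thesis by blast
qed

end

section \<open>Geometric actions\<close>

locale geometric_action = word_hyperbolic_group G S \<delta> + convex_space X
  for G :: "('g, 'm) monoid_scheme" (structure) and S \<delta> and X :: "'b metric" +
  fixes \<phi> :: "'g \<Rightarrow> 'b \<Rightarrow> 'b" and x0 :: 'b
  assumes proper: "proper_metric X" and action: "acts_geometrically G X \<phi>" and x0: "x0 \<in> mspace X"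
begin

section \<open>Displacements of the base point\<close>

abbreviation "dX \<equiv> mdist X"
abbreviation "orb g \<equiv> \<phi> g x0"
abbreviation "nrm g \<equiv> dX x0 (\<phi> g x0)"
abbreviation "sg g \<equiv> geod X x0 (\<phi> g x0)"

lemma group_action_X: "group_action G (mspace X) \<phi>"
  using action by (simp add: acts_geometrically_def)

lemma act_in: "g \<in> carrier G \<Longrightarrow> x \<in> mspace X \<Longrightarrow> \<phi> g x \<in> mspace X"
  using group_action.element_image[OF group_action_X] by blast

lemma orb_in [simp]: "g \<in> carrier G \<Longrightarrow> orb g \<in> mspace X"
  using act_in x0 by simp

lemma act_iso: "g \<in> carrier G \<Longrightarrow> x \<in> mspace X \<Longrightarrow> y \<in> mspace X \<Longrightarrow> dX (\<phi> g x) (\<phi> g y) = dX x y"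
  using action by (simp add: acts_geometrically_def)

lemma orb_mult: "g \<in> carrier G \<Longrightarrow> h \<in> carrier G \<Longrightarrow> orb (g \<otimes> h) = \<phi> g (orb h)"
  using group_action.composition_rule[OF group_action_X x0] by simp

lemma orb_one [simp]: "orb \<one> = x0"
proof -
  have "\<phi> \<one> = (\<lambda>x\<in>mspace X. x)" using group_action.id_eq_one[OF group_action_X] by simp
  then show ?thesis using x0 by simp
qed

lemma orb_dist: "g \<in> carrier G \<Longrightarrow> h \<in> carrier G \<Longrightarrow> dX (orb g) (orb h) = nrm (inv g \<otimes> h)"
  using act_iso[of g x0 "orb (inv g \<otimes> h)"] x0 orb_mult[of g "inv g \<otimes> h"] by simp

lemma nrm_inv: "g \<in> carrier G \<Longrightarrow> nrm (inv g) = nrm g"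
  using orb_dist[of g \<one>] by (simp add: mdist_commute)

lemma nrm_mult_diff:
  assumes "g \<in> carrier G" "h \<in> carrier G"
  shows "\<bar>nrm (g \<otimes> h) - nrm h\<bar> \<le> nrm g"
proof -
  have "dX (orb g) (orb (g \<otimes> h)) = nrm h" using orb_dist[of g "g \<otimes> h"] assms by simp
  then show ?thesis
    using mdist_triangle[of x0 X "orb g" "orb (g \<otimes> h)"] mdist_triangle[of "orb g" X x0 "orb (g \<otimes> h)"]
      mdist_commute[of X "orb g" x0] x0 assms by simp
qed

lemma finite_nrm_ball: "finite {g \<in> carrier G. nrm g \<le> r}"
proof -
  have "compactin (mtopology_of X) (mcball_of X x0 (max r 0))"
    using proper x0 by (auto simp: proper_metric_def)
  then have "finite {g \<in> carrier G. \<phi> g ` mcball_of X x0 (max r 0) \<inter> mcball_of X x0 (max r 0) \<noteq> {}}"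
    using action unfolding acts_geometrically_def by blast
  moreover have "\<phi> g ` mcball_of X x0 (max r 0) \<inter> mcball_of X x0 (max r 0) \<noteq> {}"
    if "g \<in> carrier G" "nrm g \<le> r" for g
  proof -
    have "orb g \<in> mcball_of X x0 (max r 0)" "x0 \<in> mcball_of X x0 (max r 0)" using that x0 by auto
    then show ?thesis by blast
  qed
  ultimately show ?thesis by (auto elim: rev_finite_subset)
qed

lemma cobounded: "\<exists>D\<ge>0. \<forall>y\<in>mspace X. \<exists>g\<in>carrier G. dX (orb g) y \<le> D"
proof -
  have "\<exists>K. compactin (mtopology_of X) K \<and> (\<Union>g\<in>carrier G. \<phi> g ` K) = mspace X"
    using action unfolding acts_geometrically_def by (elim conjE)
  then obtain K where K: "compactin (mtopology_of X) K" "(\<Union>g\<in>carrier G. \<phi> g ` K) = mspace X"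
    by (elim exE conjE)
  interpret Metric_space "mspace X" "mdist X" by simp
  have "mbounded K" using K(1) by (intro compactin_imp_mbounded) (simp add: mtopology_of_def)
  then obtain x B where xB: "K \<subseteq> mcball x B" by (auto simp: mbounded_def)
  define D where "D = max 0 (dX x0 x + B)"
  have "\<exists>g\<in>carrier G. dX (orb g) y \<le> D" if y: "y \<in> mspace X" for y
  proof -
    obtain g k where gk: "g \<in> carrier G" "k \<in> K" "y = \<phi> g k" using K(2) y by blast
    then have "k \<in> mspace X" "x \<in> mspace X" "dX x k \<le> B" using xB by auto
    then have "dX x0 k \<le> D" using mdist_triangle[of x0 X x k] x0 by (simp add: D_def)
    then show ?thesis using gk act_iso[of g x0 k] x0 \<open>k \<in> mspace X\<close> by (intro bexI[of _ g]) auto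
  qed
  then show ?thesis by (intro exI[of _ D]) (simp add: D_def)
qed

text \<open>The geodesic is sampled at integer times, the last ones clamped to its length, and orbit
  points are chosen nearby. The end samples are forced to be \<open>g\<close> and \<open>h\<close>
  themselves.\<close>

lemma ex_discretization:
  assumes D: "0 \<le> D" "\<And>y. y \<in> mspace X \<Longrightarrow> \<exists>g\<in>carrier G. dX (orb g) y \<le> D"
    and gh: "g \<in> carrier G" "h \<in> carrier G"
  obtains q where "q 0 = g" "q (Suc (nat \<lceil>dX (orb g) (orb h)\<rceil>)) = h"
    "\<And>i. q i \<in> carrier G" "\<And>i. i \<le> Suc (nat \<lceil>dX (orb g) (orb h)\<rceil>) \<Longrightarrow>
      dX (orb (q i)) (geod X (orb g) (orb h) (min (real i) (dX (orb g) (orb h)))) \<le> D"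
proof -
  define L where "L = dX (orb g) (orb h)"
  \<comment> \<open>The successor keeps the indices 0 and \<open>n\<close> apart even if different
    \<open>g\<close> and \<open>h\<close> have the same orbit point.\<close>
  define n where "n = Suc (nat \<lceil>L\<rceil>)"
  have L0: "0 \<le> L" by (simp add: L_def)
  have Ln: "L \<le> real n" by (simp add: n_def) linarith
  define \<sigma> where "\<sigma> i = geod X (orb g) (orb h) (min (real i) L)" for i
  have \<sigma>M: "\<sigma> i \<in> mspace X" for i
    unfolding \<sigma>_def using gh L0 by (intro geod_in) (auto simp: L_def)
  have ends: "\<sigma> 0 = orb g" "\<sigma> n = orb h"
    using gh Ln L0 by (auto simp: \<sigma>_def min_def L_def)
  have "\<forall>i. \<exists>k\<in>carrier G. dX (orb k) (\<sigma> i) \<le> D \<and> (i = 0 \<longrightarrow> k = g) \<and> (i = n \<longrightarrow> k = h)"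
  proof
    fix i
    consider "i = 0" | "i = n" "i \<noteq> 0" | "i \<noteq> 0" "i \<noteq> n" by blast
    then show "\<exists>k\<in>carrier G. dX (orb k) (\<sigma> i) \<le> D \<and> (i = 0 \<longrightarrow> k = g) \<and> (i = n \<longrightarrow> k = h)"
    proof cases
      case 1
      then show ?thesis using ends gh D by (intro bexI[of _ g]) (auto simp: n_def)
    next
      case 2
      then show ?thesis using ends gh D by (intro bexI[of _ h]) auto
    next
      case 3
      then show ?thesis using D(2)[OF \<sigma>M[of i]] by blast
    qed
  qed
  then obtain q where q: "\<And>i. q i \<in> carrier G \<and> dX (orb (q i)) (\<sigma> i) \<le> D \<and> (i = 0 \<longrightarrow> q i = g) \<and> (i = n \<longrightarrow> q i = h)"
    by metis
  show thesis
    by (rule that[of q]) (use q in \<open>auto simp: n_def L_def \<sigma>_def\<close>)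
qed

lemma orbit_map_Lipschitz: "\<exists>A\<ge>1. \<forall>g\<in>carrier G. \<forall>h\<in>carrier G. dX (orb g) (orb h) \<le> A * dG g h"
proof -
  define B where "B = {g \<in> carrier G. len g \<le> 1}"
  define A where "A = Max (insert 1 ((\<lambda>g. nrm g) ` B))"
  have fB: "finite B" unfolding B_def by (rule finite_ball)
  have A: "nrm g \<le> A" if "g \<in> B" for g using fB that by (simp add: A_def)
  have "dX (orb g) (orb h) \<le> A * dG g h" if gh: "g \<in> carrier G" "h \<in> carrier G" for g h
  proof -
    obtain \<gamma> n where \<gamma>: "discrete_geodesic (word_metric G S) g h \<gamma> n"
      using W.discrete_geodesic_ex[of g h] gh by auto
    then have g: "\<gamma> 0 = g" "\<gamma> n = h" "\<And>i. i \<le> n \<Longrightarrow> \<gamma> i \<in> carrier G"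
      "\<And>i j. i \<le> n \<Longrightarrow> j \<le> n \<Longrightarrow> dG (\<gamma> i) (\<gamma> j) = \<bar>real i - real j\<bar>"
      by (auto simp: discrete_geodesic_def)
    have "dX (orb (\<gamma> 0)) (orb (\<gamma> n)) \<le> real n * A"
    proof (rule mdist_chain)
      fix i assume i: "i < n"
      then have "inv (\<gamma> i) \<otimes> \<gamma> (Suc i) \<in> B"
        using g(3)[of i] g(3)[of "Suc i"] g(4)[of i "Suc i"] dG_len[of "\<gamma> i" "\<gamma> (Suc i)"] by (simp add: B_def)
      then show "dX (orb (\<gamma> i)) (orb (\<gamma> (Suc i))) \<le> A"
        using orb_dist[of "\<gamma> i" "\<gamma> (Suc i)"] g(3) i A by simp
    qed (use g in simp)
    then show ?thesis using g W.discrete_geodesic_dist[OF \<gamma>] by (simp add: mult.commute)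
  qed
  moreover have "1 \<le> A" using fB by (simp add: A_def)
  ultimately show ?thesis by blast
qed

text \<open>The Milnor-Schwarz argument: consecutive samples of a geodesic differ by elements that
  displace \<open>x0\<close> by at most 2D + 1; properness leaves finitely many of those, so their
  word length is at most some \<open>N\<close>.\<close>

lemma orbit_map_quasi_isometry:
  "\<exists>A\<ge>1. \<forall>g\<in>carrier G. \<forall>h\<in>carrier G. dX (orb g) (orb h) \<le> A * dG g h \<and> dG g h \<le> A * dX (orb g) (orb h) + A"
proof -
  obtain A where A: "1 \<le> A" "\<forall>g\<in>carrier G. \<forall>h\<in>carrier G. dX (orb g) (orb h) \<le> A * dG g h"
    using orbit_map_Lipschitz by blast
  obtain D where D: "0 \<le> D" "\<And>y. y \<in> mspace X \<Longrightarrow> \<exists>g\<in>carrier G. dX (orb g) y \<le> D"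
    using cobounded by blast
  define N where "N = Max (insert 0 ((\<lambda>g. len g) ` {g \<in> carrier G. nrm g \<le> 2 * D + 1}))"
  have N0: "0 \<le> N" using finite_nrm_ball by (simp add: N_def)
  have N: "len g \<le> N" if "g \<in> carrier G" "nrm g \<le> 2 * D + 1" for g
    unfolding N_def using finite_nrm_ball that by (intro Max_ge) auto
  have lower: "dG g h \<le> N * dX (orb g) (orb h) + 2 * N" if gh: "g \<in> carrier G" "h \<in> carrier G" for g h
  proof -
    define L where "L = dX (orb g) (orb h)"
    define n where "n = Suc (nat \<lceil>L\<rceil>)"
    obtain q where q: "q 0 = g" "q n = h" "\<And>i. q i \<in> carrier G"
      "\<And>i. i \<le> n \<Longrightarrow> dX (orb (q i)) (geod X (orb g) (orb h) (min (real i) L)) \<le> D"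
      using ex_discretization[OF D gh] unfolding n_def L_def by metis
    have "dG (q 0) (q n) \<le> real n * N"
    proof (rule mdist_chain)
      fix i assume i: "i < n"
      let ?a = "geod X (orb g) (orb h) (min (real i) L)" and ?b = "geod X (orb g) (orb h) (min (real (Suc i)) L)"
      have M: "?a \<in> mspace X" "?b \<in> mspace X" using gh by (auto intro!: geod_in simp: L_def)
      have "dX ?a ?b = \<bar>min (real i) L - min (real (Suc i)) L\<bar>"
        using gh by (intro geod_dist) (auto simp: L_def)
      also have "\<dots> \<le> 1" by (auto simp: min_def)
      finally have "dX (orb (q i)) (orb (q (Suc i))) \<le> 2 * D + 1"
        using triangle4[of "orb (q i)" X ?a ?b "orb (q (Suc i))"] q(3)[of i] q(3)[of "Suc i"] q(4)[of i] q(4)[of "Suc i"] i M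
          mdist_commute[of X "orb (q (Suc i))" ?b] by simp
      then show "dG (q i) (q (Suc i)) \<le> N"
        using N[of "inv (q i) \<otimes> q (Suc i)"] q(3) orb_dist[of "q i" "q (Suc i)"] dG_len[of "q i" "q (Suc i)"] by simp
    qed (use q in simp)
    moreover have "real n \<le> L + 2" unfolding n_def L_def using mdist_nonneg[of X "orb g" "orb h"] by linarith
    ultimately have "dG g h \<le> (L + 2) * N" using q N0 by (smt (verit) mult_right_mono)
    then show ?thesis by (simp add: L_def algebra_simps)
  qed
  show ?thesis
  proof (intro exI[of _ "A + 2 * N"] conjI ballI)
    show "1 \<le> A + 2 * N" using A N0 by simp
    fix g h assume gh: "g \<in> carrier G" "h \<in> carrier G"
    have "dX (orb g) (orb h) \<le> A * dG g h" using A gh by blast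
    also have "\<dots> \<le> (A + 2 * N) * dG g h" using N0 by (intro mult_right_mono) auto
    finally show "dX (orb g) (orb h) \<le> (A + 2 * N) * dG g h" .
    have "dG g h \<le> N * dX (orb g) (orb h) + 2 * N" by (rule lower[OF gh])
    also have "\<dots> \<le> (A + 2 * N) * dX (orb g) (orb h) + (A + 2 * N)"
      using N0 A by (intro add_mono mult_right_mono) auto
    finally show "dG g h \<le> (A + 2 * N) * dX (orb g) (orb h) + (A + 2 * N)" .
  qed
qed

text \<open>The stability theorem lives in the word metric, so the geodesic of the space is sampled
  by the orbit and becomes a quasi-geodesic there. Both inclusions are then carried back by the
  orbit map.\<close>

lemma orbit_geodesics_near:
  "\<exists>C\<ge>0. \<forall>g\<in>carrier G. \<forall>h\<in>carrier G. \<forall>\<gamma> L. discrete_geodesic (word_metric G S) g h \<gamma> L \<longrightarrow>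
      (\<forall>s\<le>L. \<exists>t\<in>{0..dX (orb g) (orb h)}. dX (orb (\<gamma> s)) (geod X (orb g) (orb h) t) \<le> C) \<and>
      (\<forall>t\<in>{0..dX (orb g) (orb h)}. \<exists>s\<le>L. dX (orb (\<gamma> s)) (geod X (orb g) (orb h) t) \<le> C)"
proof -
  obtain A where A: "1 \<le> A" "\<And>g h. g \<in> carrier G \<Longrightarrow> h \<in> carrier G \<Longrightarrow> dX (orb g) (orb h) \<le> A * dG g h"
    "\<And>g h. g \<in> carrier G \<Longrightarrow> h \<in> carrier G \<Longrightarrow> dG g h \<le> A * dX (orb g) (orb h) + A"
    using orbit_map_quasi_isometry by blast
  obtain D where D: "0 \<le> D" "\<And>y. y \<in> mspace X \<Longrightarrow> \<exists>g\<in>carrier G. dX (orb g) y \<le> D"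
    using cobounded by blast
  \<comment> \<open>Dominates A + A (2D + 1), from the upper bound for distinct samples, and 2D + 2,
    from the clamped sampling.\<close>
  define B where "B = A * (2 * D + 2)"
  have "1 * 1 \<le> A * (2 * D + 2)" using A D by (intro mult_mono) auto
  then have B1: "1 \<le> B" by (simp add: B_def)
  obtain C1 where C1: "0 \<le> C1" "\<And>\<gamma> L q n s. \<lbrakk>W.quasi_geodesic B q n; discrete_geodesic (word_metric G S) (q 0) (q n) \<gamma> L; s \<le> L\<rbrakk>
    \<Longrightarrow> \<exists>j\<le>n. dG (\<gamma> s) (q j) \<le> C1" using W.geodesic_near_quasi_geodesic[OF B1] by blast
  obtain C2 where C2: "0 \<le> C2" "\<And>\<gamma> L q n i. \<lbrakk>W.quasi_geodesic B q n; discrete_geodesic (word_metric G S) (q 0) (q n) \<gamma> L; i \<le> n\<rbrakk>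
    \<Longrightarrow> \<exists>s\<le>L. dG (\<gamma> s) (q i) \<le> C2" using W.quasi_geodesic_near_geodesic[OF B1] by blast
  define C where "C = A * (C1 + C2) + D + 1"
  have C: "0 \<le> C" "A * C1 + D \<le> C" "A * C2 + D + 1 \<le> C" using A C1 C2 D by (auto simp: C_def algebra_simps)
  have main: "(\<forall>s\<le>L. \<exists>t\<in>{0..dX (orb g) (orb h)}. dX (orb (\<gamma> s)) (geod X (orb g) (orb h) t) \<le> C) \<and>
      (\<forall>t\<in>{0..dX (orb g) (orb h)}. \<exists>s\<le>L. dX (orb (\<gamma> s)) (geod X (orb g) (orb h) t) \<le> C)"
    if gh: "g \<in> carrier G" "h \<in> carrier G" and \<gamma>: "discrete_geodesic (word_metric G S) g h \<gamma> L" for g h \<gamma> L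
  proof -
    define l where "l = dX (orb g) (orb h)"
    define n where "n = Suc (nat \<lceil>l\<rceil>)"
    obtain q where q: "q 0 = g" "q n = h" "\<And>i. q i \<in> carrier G"
      "\<And>i. i \<le> n \<Longrightarrow> dX (orb (q i)) (geod X (orb g) (orb h) (min (real i) l)) \<le> D"
      using ex_discretization[OF D gh] unfolding n_def l_def by metis
    have l0: "0 \<le> l" by (simp add: l_def)
    have n: "l + 1 \<le> real n" "real n \<le> l + 2" unfolding n_def using l0 by linarith+
    define \<sigma> where "\<sigma> i = geod X (orb g) (orb h) (min (real i) l)" for i
    have \<sigma>: "\<sigma> i \<in> mspace X" "dX (\<sigma> i) (\<sigma> j) = \<bar>min (real i) l - min (real j) l\<bar>" for i j
      using gh l0 by (auto simp: \<sigma>_def l_def intro!: geod_in geod_dist)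
    have q\<sigma>: "dX (orb (q i)) (\<sigma> i) \<le> D" if "i \<le> n" for i using q(4)[OF that] by (simp add: \<sigma>_def)
    have gM: "\<gamma> i \<in> carrier G" if "i \<le> L" for i using \<gamma> that by (simp add: discrete_geodesic_def)
    have QG: "W.quasi_geodesic B q n"
      unfolding W.quasi_geodesic_def
    proof (intro conjI allI impI)
      fix i j assume ij: "i \<le> n" "j \<le> n"
      have u: "dX (orb (q i)) (orb (q j)) \<le> dX (\<sigma> i) (\<sigma> j) + 2 * D"
        using triangle4[of "orb (q i)" X "\<sigma> i" "\<sigma> j" "orb (q j)"] q\<sigma>[OF ij(1)] q\<sigma>[OF ij(2)] \<sigma> q(3)
          mdist_commute[of X "\<sigma> j" "orb (q j)"] by simp
      have v: "dX (\<sigma> i) (\<sigma> j) \<le> dX (orb (q i)) (orb (q j)) + 2 * D"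
        using triangle4[of "\<sigma> i" X "orb (q i)" "orb (q j)" "\<sigma> j"] q\<sigma>[OF ij(1)] q\<sigma>[OF ij(2)] \<sigma> q(3)
          mdist_commute[of X "\<sigma> i" "orb (q i)"] by simp
      show "dG (q i) (q j) \<le> B * \<bar>real i - real j\<bar>"
      proof (cases "i = j")
        case False
        then have ge1: "1 \<le> \<bar>real i - real j\<bar>" by linarith
        have "dX (\<sigma> i) (\<sigma> j) \<le> \<bar>real i - real j\<bar>" unfolding \<sigma> by (auto simp: min_def)
        then have "dX (orb (q i)) (orb (q j)) \<le> \<bar>real i - real j\<bar> + 2 * D" using u by simp
        then have "A * dX (orb (q i)) (orb (q j)) + A \<le> A * (\<bar>real i - real j\<bar> + 2 * D) + A"
          using A by simp
        also have "\<dots> = A * (\<bar>real i - real j\<bar> + (2 * D + 1) * 1)" by (simp add: algebra_simps)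
        also have "\<dots> \<le> A * (\<bar>real i - real j\<bar> + (2 * D + 1) * \<bar>real i - real j\<bar>)"
          using A D ge1 by (intro mult_left_mono add_left_mono) auto
        also have "\<dots> = B * \<bar>real i - real j\<bar>" by (simp add: B_def algebra_simps)
        finally show ?thesis using A(3)[of "q i" "q j"] q(3) by simp
      qed (use q in simp)
      have "\<bar>real i - real j\<bar> \<le> dX (\<sigma> i) (\<sigma> j) + 2"
        unfolding \<sigma> using ij n by (auto simp: min_def)
      also have "\<dots> \<le> A * dG (q i) (q j) + (2 * D + 2)" using v A(2)[of "q i" "q j"] q(3) by simp
      also have "\<dots> \<le> B * dG (q i) (q j) + B"
      proof (intro add_mono mult_right_mono)
        have "A * 1 \<le> A * (2 * D + 2)" using A D by (intro mult_left_mono) auto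
        then show "A \<le> B" by (simp add: B_def)
        have "1 * (2 * D + 2) \<le> A * (2 * D + 2)" using A D by (intro mult_right_mono) auto
        then show "2 * D + 2 \<le> B" by (simp add: B_def)
      qed auto
      finally show "\<bar>real i - real j\<bar> \<le> B * dG (q i) (q j) + B" .
    qed (use q in simp)
    have \<gamma>': "discrete_geodesic (word_metric G S) (q 0) (q n) \<gamma> L" using \<gamma> q by simp
    have tr: "dX (orb (\<gamma> s)) (\<sigma> j) \<le> A * K + D" if "s \<le> L" "j \<le> n" "dG (\<gamma> s) (q j) \<le> K" for s j K
    proof -
      have "dX (orb (\<gamma> s)) (orb (q j)) \<le> A * dG (\<gamma> s) (q j)" using A(2) gM that q(3) by simp
      also have "\<dots> \<le> A * K" using A that by (intro mult_left_mono) auto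
      finally show ?thesis
        using mdist_triangle[of "orb (\<gamma> s)" X "orb (q j)" "\<sigma> j"] q\<sigma>[OF that(2)] gM[OF that(1)] q(3)[of j] \<sigma>(1)[of j] by simp
    qed
    show ?thesis
    proof (intro conjI allI impI ballI)
      fix s assume s: "s \<le> L"
      obtain j where j: "j \<le> n" "dG (\<gamma> s) (q j) \<le> C1" using C1(2)[OF QG \<gamma>' s] by blast
      show "\<exists>t\<in>{0..dX (orb g) (orb h)}. dX (orb (\<gamma> s)) (geod X (orb g) (orb h) t) \<le> C"
        using tr[OF s j] C(2) l0 by (intro bexI[of _ "min (real j) l"]) (auto simp: \<sigma>_def l_def)
    next
      fix t assume t: "t \<in> {0..dX (orb g) (orb h)}"
      define i where "i = nat \<lfloor>t\<rfloor>"
      have i: "real i \<le> t" "t \<le> real i + 1" using t unfolding i_def by auto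
      have il: "real i \<le> l" "i \<le> n" using i t n by (auto simp: l_def)
      obtain s where s: "s \<le> L" "dG (\<gamma> s) (q i) \<le> C2" using C2(2)[OF QG \<gamma>' il(2)] by blast
      have "dX (\<sigma> i) (geod X (orb g) (orb h) t) = \<bar>real i - t\<bar>"
        unfolding \<sigma>_def using gh t il by (simp add: min_def) (intro geod_dist, auto simp: l_def)
      then have "dX (orb (\<gamma> s)) (geod X (orb g) (orb h) t) \<le> A * C2 + D + 1"
        using mdist_triangle[of "orb (\<gamma> s)" X "\<sigma> i" "geod X (orb g) (orb h) t"] tr[OF s(1) il(2) s(2)] i gM[OF s(1)] \<sigma>(1)[of i]
          geod_in[of "orb g" "orb h" t] gh t by auto
      then show "\<exists>s\<le>L. dX (orb (\<gamma> s)) (geod X (orb g) (orb h) t) \<le> C" using s C(3) by auto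
    qed
  qed
  show ?thesis
    using C(1) main by (intro exI[of _ C]) blast
qed

section \<open>Gromov products against geodesics of the space\<close>

lemma gp_on_geodesic:
  assumes "discrete_geodesic (word_metric G S) \<one> g \<gamma> L" "s \<le> L"
  shows "\<gamma> s \<in> carrier G" "gp \<one> g (\<gamma> s) = real s" "len (\<gamma> s) = real s"
proof -
  have g: "\<gamma> 0 = \<one>" "\<gamma> L = g" "\<And>i. i \<le> L \<Longrightarrow> \<gamma> i \<in> carrier G"
    "\<And>i j. i \<le> L \<Longrightarrow> j \<le> L \<Longrightarrow> dG (\<gamma> i) (\<gamma> j) = \<bar>real i - real j\<bar>"
    using assms(1) by (auto simp: discrete_geodesic_def)
  show "\<gamma> s \<in> carrier G" "len (\<gamma> s) = real s" using g(3)[of s] g(4)[of 0 s] g(1) assms(2) by auto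
  then show "gp \<one> g (\<gamma> s) = real s"
    using W.discrete_geodesic_dist[OF assms(1)] g(4)[of L s] g(2) assms(2) by (simp add: gromov_product_def)
qed

text \<open>At time about \<open>gp \<one> g h\<close> the word geodesics to \<open>g\<close> and
  \<open>h\<close> are 4\<delta>-close. Stability carries this to points of the two geodesics of the
  space, at late and nearly equal times, and convexity spreads the closeness to all earlier
  times.\<close>

lemma geodesics_fellow_travel:
  "\<exists>C>0. \<forall>g\<in>carrier G. \<forall>h\<in>carrier G. \<forall>t\<ge>0. C * t + C \<le> gp \<one> g h \<longrightarrow>
     t \<le> nrm g \<and> t \<le> nrm h \<and> dX (sg g t) (sg h t) \<le> C"
proof -
  obtain A where A: "1 \<le> A" "\<And>g h. g \<in> carrier G \<Longrightarrow> h \<in> carrier G \<Longrightarrow> dX (orb g) (orb h) \<le> A * dG g h"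
    "\<And>g h. g \<in> carrier G \<Longrightarrow> h \<in> carrier G \<Longrightarrow> dG g h \<le> A * dX (orb g) (orb h) + A"
    using orbit_map_quasi_isometry by blast
  obtain C1 where C1: "0 \<le> C1"
    "\<And>g h \<gamma> L. \<lbrakk>g \<in> carrier G; h \<in> carrier G; discrete_geodesic (word_metric G S) g h \<gamma> L\<rbrakk> \<Longrightarrow>
      (\<forall>s\<le>L. \<exists>t\<in>{0..dX (orb g) (orb h)}. dX (orb (\<gamma> s)) (geod X (orb g) (orb h) t) \<le> C1) \<and>
      (\<forall>t\<in>{0..dX (orb g) (orb h)}. \<exists>s\<le>L. dX (orb (\<gamma> s)) (geod X (orb g) (orb h) t) \<le> C1)"
    using orbit_geodesics_near by blast
  define C2 where "C2 = 2 * C1 + 4 * \<delta> * A"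
  have C2: "0 \<le> C2" using C1 A W.delta_pos by (simp add: C2_def)
  define C where "C = A + 2 * C2 + A * (1 + C1 + C2) + 1"
  have CA: "0 < C" "A \<le> C" "A * (1 + C1 + C2) + 1 \<le> C" "2 * C2 \<le> C"
    using A C1 C2 by (auto simp: C_def add_nonneg_nonneg add_nonneg_pos)
  have "t \<le> nrm g \<and> t \<le> nrm h \<and> dX (sg g t) (sg h t) \<le> C"
    if gh: "g \<in> carrier G" "h \<in> carrier G" and t: "0 \<le> t" "C * t + C \<le> gp \<one> g h" for g h t
  proof -
    obtain \<gamma> L where \<gamma>: "discrete_geodesic (word_metric G S) \<one> g \<gamma> L" using W.discrete_geodesic_ex[of \<one> g] gh by auto
    obtain \<gamma>' L' where \<gamma>': "discrete_geodesic (word_metric G S) \<one> h \<gamma>' L'"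
      using W.discrete_geodesic_ex[of \<one> h] gh by auto
    have gp0: "0 \<le> gp \<one> g h" using gh by (intro W.gp_nonneg) auto
    define T where "T = nat \<lfloor>gp \<one> g h\<rfloor>"
    have T: "real T \<le> gp \<one> g h" "gp \<one> g h - 1 \<le> real T" using gp0 unfolding T_def by linarith+
    have "gp \<one> g h \<le> real L" "gp \<one> g h \<le> real L'"
      using W.gp_le[of \<one> g h] W.gp_le'[of \<one> g h] gh W.discrete_geodesic_dist[OF \<gamma>] W.discrete_geodesic_dist[OF \<gamma>'] by auto
    then have TL: "T \<le> L" "T \<le> L'" using T by linarith+
    note p = gp_on_geodesic[OF \<gamma> TL(1)] and p' = gp_on_geodesic[OF \<gamma>' TL(2)]
    have "min (gp \<one> (\<gamma> T) g) (min (gp \<one> g h) (gp \<one> h (\<gamma>' T))) - 2 * \<delta> \<le> gp \<one> (\<gamma> T) (\<gamma>' T)"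
      using gh p p' by (intro W.five_point) auto
    then have "real T - 2 * \<delta> \<le> gp \<one> (\<gamma> T) (\<gamma>' T)"
      using p p' T W.gp_commute[of \<one> g] by simp
    then have "dG (\<gamma> T) (\<gamma>' T) \<le> 4 * \<delta>" using p p' by (simp add: gromov_product_def)
    then have "A * dG (\<gamma> T) (\<gamma>' T) \<le> A * (4 * \<delta>)" using A by (intro mult_left_mono) auto
    then have dp: "dX (orb (\<gamma> T)) (orb (\<gamma>' T)) \<le> 4 * \<delta> * A"
      using A(2)[of "\<gamma> T" "\<gamma>' T"] p p' by (simp add: algebra_simps)
    obtain s where s: "s \<in> {0..nrm g}" "dX (orb (\<gamma> T)) (sg g s) \<le> C1"
      using conjunct1[OF C1(2)[OF one_closed gh(1) \<gamma>]] TL(1) by auto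
    obtain s' where s': "s' \<in> {0..nrm h}" "dX (orb (\<gamma>' T)) (sg h s') \<le> C1"
      using conjunct1[OF C1(2)[OF one_closed gh(2) \<gamma>']] TL(2) by auto
    have M: "sg g r \<in> mspace X" if "r \<in> {0..nrm g}" for r using that gh x0 geod_in by simp
    have M': "sg h r \<in> mspace X" if "r \<in> {0..nrm h}" for r using that gh x0 geod_in by simp
    have ss: "dX (sg g s) (sg h s') \<le> C2"
      using triangle4[of "sg g s" X "orb (\<gamma> T)" "orb (\<gamma>' T)" "sg h s'"] M[OF s(1)] M'[OF s'(1)] p p' s s' dp
        mdist_commute[of X "sg g s"] by (simp add: C2_def)
    have r0: "dX x0 (sg g r) = r" if "r \<in> {0..nrm g}" for r using geod_dist[OF x0 orb_in[OF gh(1)], of 0 r] that x0 gh by simp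
    have r0': "dX x0 (sg h r) = r" if "r \<in> {0..nrm h}" for r using geod_dist[OF x0 orb_in[OF gh(2)], of 0 r] that x0 gh by simp
    have ss': "\<bar>s - s'\<bar> \<le> C2"
      using mdist_triangle[of x0 X "sg g s" "sg h s'"] mdist_triangle[of x0 X "sg h s'" "sg g s"]
        r0[OF s(1)] r0'[OF s'(1)] ss M[OF s(1)] M'[OF s'(1)] x0 mdist_commute[of X "sg h s'"] by simp
    \<comment> \<open>Both times are replaced by the smaller one, at the cost of another
      \<open>C2\<close>.\<close>
    define m where "m = min s s'"
    have m: "m \<in> {0..nrm g}" "m \<in> {0..nrm h}" "m \<le> s" "m \<le> s'" using s s' by (auto simp: m_def)
    have "dX (sg g m) (sg g s) + dX (sg h s') (sg h m) = \<bar>m - s\<bar> + \<bar>s' - m\<bar>"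
      using geod_dist[OF x0 orb_in[OF gh(1)], of m s] geod_dist[OF x0 orb_in[OF gh(2)], of s' m] m s s' by simp
    also have "\<dots> = \<bar>s - s'\<bar>" by (auto simp: m_def min_def)
    finally have mm: "dX (sg g m) (sg h m) \<le> 2 * C2"
      using triangle4[of "sg g m" X "sg g s" "sg h s'" "sg h m"] M[OF s(1)] M'[OF s'(1)] M[OF m(1)] M'[OF m(2)] ss ss' by simp
    \<comment> \<open>The lower quasi-isometry bound turns a large product into a large
      \<open>m\<close>; \<open>C\<close> is chosen so that \<open>m\<close> is at least
      \<open>t\<close>.\<close>
    have "real T \<le> A * nrm (\<gamma> T) + A" using A(3)[OF one_closed p(1)] p by simp
    moreover have "nrm (\<gamma> T) \<le> s + C1"
      using mdist_triangle[of x0 X "sg g s" "orb (\<gamma> T)"] r0[OF s(1)] s M[OF s(1)] x0 p(1) mdist_commute[of X "sg g s"] by simp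
    ultimately have "real T \<le> A * (s + C1) + A" using A by (smt (verit) mult_left_mono)
    moreover have "s \<le> m + C2" using ss' by (auto simp: m_def min_def)
    ultimately have "real T \<le> A * (m + C2 + C1) + A" using A by (smt (verit) mult_left_mono)
    then have "gp \<one> g h \<le> A * m + (A * (1 + C1 + C2) + 1)" using T by (simp add: algebra_simps)
    then have "C * t + C \<le> A * m + C" using t(2) CA by linarith
    moreover have "A * t \<le> C * t" using CA t by (intro mult_right_mono) auto
    ultimately have "A * t \<le> A * m" by linarith
    then have tm: "t \<le> m" by (rule mult_left_le_imp_le) (use A in simp)
    have "dX (sg g t) (sg h t) \<le> 2 * C2"
    proof (rule unit_speed_scale_le)
      show "unit_speed X m (sg g)" "unit_speed X m (sg h)" using m gh x0 by (auto intro!: geod_unit_speed)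
      show "sg g 0 = sg h 0" using gh x0 by simp
    qed (use t tm mm in auto)
    then show ?thesis using tm m CA(4) by auto
  qed
  then show ?thesis using CA(1) by blast
qed

text \<open>Close points on the geodesics of the space give close vertices on the word geodesics,
  and five points give the product. The tolerance 3 leaves room for replacing geodesics by limit
  rays.\<close>

lemma fellow_travelling_products:
  "\<exists>C>0. \<forall>g\<in>carrier G. \<forall>h\<in>carrier G. \<forall>t. 0 \<le> t \<and> t \<le> nrm g \<and> t \<le> nrm h \<and> dX (sg g t) (sg h t) \<le> 3 \<longrightarrow>
     t \<le> C * gp \<one> g h + C"
proof -
  obtain A where A: "1 \<le> A" "\<And>g h. g \<in> carrier G \<Longrightarrow> h \<in> carrier G \<Longrightarrow> dX (orb g) (orb h) \<le> A * dG g h"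
    "\<And>g h. g \<in> carrier G \<Longrightarrow> h \<in> carrier G \<Longrightarrow> dG g h \<le> A * dX (orb g) (orb h) + A"
    using orbit_map_quasi_isometry by blast
  obtain C1 where C1: "0 \<le> C1"
    "\<And>g h \<gamma> L. \<lbrakk>g \<in> carrier G; h \<in> carrier G; discrete_geodesic (word_metric G S) g h \<gamma> L\<rbrakk> \<Longrightarrow>
      (\<forall>s\<le>L. \<exists>t\<in>{0..dX (orb g) (orb h)}. dX (orb (\<gamma> s)) (geod X (orb g) (orb h) t) \<le> C1) \<and>
      (\<forall>t\<in>{0..dX (orb g) (orb h)}. \<exists>s\<le>L. dX (orb (\<gamma> s)) (geod X (orb g) (orb h) t) \<le> C1)"
    using orbit_geodesics_near by blast
  define E where "E = A * (2 * C1 + 3) + A"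
  have E: "0 \<le> E" using A C1 by (simp add: E_def)
  define C where "C = A + A * (E + 2 * \<delta>) + C1 + 1"
  have CA: "0 < C" "A \<le> C" "A * (E + 2 * \<delta>) + C1 \<le> C"
    using A C1 E W.delta_pos by (auto simp: C_def add_nonneg_nonneg add_nonneg_pos)
  have "t \<le> C * gp \<one> g h + C"
    if gh: "g \<in> carrier G" "h \<in> carrier G" and t: "0 \<le> t" "t \<le> nrm g" "t \<le> nrm h" "dX (sg g t) (sg h t) \<le> 3" for g h t
  proof -
    obtain \<gamma> L where \<gamma>: "discrete_geodesic (word_metric G S) \<one> g \<gamma> L" using W.discrete_geodesic_ex[of \<one> g] gh by auto
    obtain \<gamma>' L' where \<gamma>': "discrete_geodesic (word_metric G S) \<one> h \<gamma>' L'"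
      using W.discrete_geodesic_ex[of \<one> h] gh by auto
    obtain s where s: "s \<le> L" "dX (orb (\<gamma> s)) (sg g t) \<le> C1"
      using bspec[OF conjunct2[OF C1(2)[OF one_closed gh(1) \<gamma>]], of t] t by auto
    obtain s' where s': "s' \<le> L'" "dX (orb (\<gamma>' s')) (sg h t) \<le> C1"
      using bspec[OF conjunct2[OF C1(2)[OF one_closed gh(2) \<gamma>']], of t] t by auto
    note p = gp_on_geodesic[OF \<gamma> s(1)] and p' = gp_on_geodesic[OF \<gamma>' s'(1)]
    have M: "sg g t \<in> mspace X" "sg h t \<in> mspace X" using t gh x0 geod_in by simp_all
    have "dX (orb (\<gamma> s)) (orb (\<gamma>' s')) \<le> 2 * C1 + 3"
      using triangle4[of "orb (\<gamma> s)" X "sg g t" "sg h t" "orb (\<gamma>' s')"] M p p' s s' t(4)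
        mdist_commute[of X "sg h t"] by simp
    then have "A * dX (orb (\<gamma> s)) (orb (\<gamma>' s')) + A \<le> E" using A unfolding E_def by simp
    then have dp: "dG (\<gamma> s) (\<gamma>' s') \<le> E" using A(3)[OF p(1) p'(1)] by simp
    have "real s - E \<le> gp \<one> (\<gamma> s) (\<gamma>' s')" using W.gp_ge[of \<one> "\<gamma> s" "\<gamma>' s'"] p p' dp by simp
    moreover have "real s - E \<le> real s'" using len_ge_diff[OF p(1) p'(1)] p p' dp by (simp add: mdist_commute)
    moreover have "min (gp \<one> g (\<gamma> s)) (min (gp \<one> (\<gamma> s) (\<gamma>' s')) (gp \<one> (\<gamma>' s') h)) - 2 * \<delta> \<le> gp \<one> g h"
      using gh p p' by (intro W.five_point) auto
    moreover have "gp \<one> (\<gamma>' s') h = real s'" "gp \<one> g (\<gamma> s) = real s" using p p' W.gp_commute[of \<one> h] by auto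
    ultimately have sE: "real s \<le> gp \<one> g h + (E + 2 * \<delta>)" using E by linarith
    have "t = dX x0 (sg g t)" using geod_dist[OF x0 orb_in[OF gh(1)], of 0 t] t x0 gh by simp
    also have "\<dots> \<le> nrm (\<gamma> s) + C1" using mdist_triangle[of x0 X "orb (\<gamma> s)" "sg g t"] s p M x0 by simp
    also have "\<dots> \<le> A * real s + C1" using A(2)[OF one_closed p(1)] p by simp
    also have "\<dots> \<le> A * (gp \<one> g h + (E + 2 * \<delta>)) + C1" using sE A by simp
    also have "\<dots> = A * gp \<one> g h + (A * (E + 2 * \<delta>) + C1)" by (simp add: algebra_simps)
    also have "\<dots> \<le> C * gp \<one> g h + C"
      using CA W.gp_nonneg[of \<one> g h] gh by (intro add_mono mult_right_mono) auto
    finally show ?thesis .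
  qed
  then show ?thesis using CA(1) by blast
qed

end

section \<open>The boundary map of an orbit\<close>

context geometric_action
begin

abbreviation "bdG \<equiv> gromov_boundary (word_metric G S) \<one>"
abbreviation "to_ray u \<alpha> \<equiv> converges_to_ray X x0 (\<lambda>n. \<phi> (u n) x0) \<alpha>"

lemma orb_seq_in: "range u \<subseteq> carrier G \<Longrightarrow> orb (u n) \<in> mspace X"
  by (rule orb_in) auto

lemma to_ray_near:
  assumes u: "range u \<subseteq> carrier G" and \<alpha>: "to_ray u \<alpha>" and t: "0 \<le> t" "0 < e"
  shows "\<exists>N. \<forall>n\<ge>N. t \<le> nrm (u n) \<and> sg (u n) t \<in> mspace X \<and> dX (sg (u n) t) (\<alpha> t) < e"
proof -
  have "eventually (\<lambda>n. t \<le> nrm (u n)) sequentially"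
    using \<alpha> by (auto simp: converges_to_ray_def filterlim_at_top)
  moreover have "eventually (\<lambda>n. dX (sg (u n) t) (\<alpha> t) < e) sequentially"
    using \<alpha> t order_tendstoD(2)[of _ 0 sequentially e] by (auto simp: converges_to_ray_def)
  ultimately have "eventually (\<lambda>n. t \<le> nrm (u n) \<and> sg (u n) t \<in> mspace X \<and> dX (sg (u n) t) (\<alpha> t) < e) sequentially"
  proof eventually_elim
    case (elim n)
    have "u n \<in> carrier G" using u by auto
    then show ?case using elim t x0 by (simp add: geod_in)
  qed
  then show ?thesis by (simp add: eventually_sequentially)
qed

lemma products_diverge_to_ray:
  assumes u: "range u \<subseteq> carrier G" "W.products_diverge \<one> u u"
  shows "\<exists>\<alpha>. geodesic_ray X \<alpha> \<and> \<alpha> 0 = x0 \<and> to_ray u \<alpha>"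
proof -
  obtain C where C: "C > 0" "\<And>g h t. \<lbrakk>g \<in> carrier G; h \<in> carrier G; 0 \<le> t; C * t + C \<le> gp \<one> g h\<rbrakk> \<Longrightarrow>
     t \<le> nrm g \<and> t \<le> nrm h \<and> dX (sg g t) (sg h t) \<le> C"
    using geodesics_fellow_travel by blast
  show ?thesis
  proof (rule ex_limit_ray[OF x0, where C = C])
    show "orb (u n) \<in> mspace X" for n using u(1) by (rule orb_seq_in)
    fix T :: real assume T: "0 \<le> T"
    obtain N where N: "\<forall>i\<ge>N. \<forall>j\<ge>N. C * T + C \<le> gp \<one> (u i) (u j)"
      using u(2) unfolding W.products_diverge_def by blast
    have "T \<le> nrm (u m) \<and> T \<le> nrm (u n) \<and> dX (sg (u m) T) (sg (u n) T) \<le> C" if "m \<ge> N" "n \<ge> N" for m n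
      by (rule C(2)) (use u(1) T N that in auto)
    then show "\<exists>N. \<forall>m\<ge>N. \<forall>n\<ge>N. T \<le> nrm (u m) \<and> T \<le> nrm (u n) \<and> dX (sg (u m) T) (sg (u n) T) \<le> C"
      by blast
  qed
qed

lemma limit_rays_close:
  assumes u: "range u \<subseteq> carrier G" "range v \<subseteq> carrier G" and r: "to_ray u \<alpha>" "to_ray v \<beta>"
    "geodesic_ray X \<alpha>" "geodesic_ray X \<beta>" and t: "0 \<le> t"
    and N: "\<And>i. i \<ge> N \<Longrightarrow> dX (sg (u i) t) (sg (v i) t) \<le> C"
  shows "dX (\<alpha> t) (\<beta> t) \<le> C"
proof -
  obtain N1 where N1: "\<forall>n\<ge>N1. sg (u n) t \<in> mspace X" using to_ray_near[OF u(1) r(1) t zero_less_one] by blast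
  obtain N2 where N2: "\<forall>n\<ge>N2. sg (v n) t \<in> mspace X" using to_ray_near[OF u(2) r(2) t zero_less_one] by blast
  show ?thesis
  proof (rule dist_le_if_limit[where f = "\<lambda>n. sg (u n) t" and g = "\<lambda>n. sg (v n) t"])
    show "eventually (\<lambda>n. sg (u n) t \<in> mspace X \<and> sg (v n) t \<in> mspace X \<and> dX (sg (u n) t) (sg (v n) t) \<le> C) sequentially"
      unfolding eventually_sequentially using N1 N2 N by (intro exI[of _ "max N (max N1 N2)"]) auto
  qed (use r t geodesic_ray_in[OF r(3) t] geodesic_ray_in[OF r(4) t] in \<open>auto simp: converges_to_ray_def\<close>)
qed

text \<open>Large products keep the two limit rays within a fixed distance at every time, so they
  are asymptotic with the same origin.\<close>

lemma products_diverge_same_ray: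
  assumes u: "range u \<subseteq> carrier G" "range v \<subseteq> carrier G" "W.products_diverge \<one> u v"
    and r: "to_ray u \<alpha>" "to_ray v \<beta>" "geodesic_ray X \<alpha>" "geodesic_ray X \<beta>" "\<alpha> 0 = x0" "\<beta> 0 = x0"
  shows "\<alpha> = \<beta>"
proof -
  obtain C where C: "C > 0" "\<And>g h t. \<lbrakk>g \<in> carrier G; h \<in> carrier G; 0 \<le> t; C * t + C \<le> gp \<one> g h\<rbrakk> \<Longrightarrow>
     t \<le> nrm g \<and> t \<le> nrm h \<and> dX (sg g t) (sg h t) \<le> C"
    using geodesics_fellow_travel by blast
  have "dX (\<alpha> t) (\<beta> t) \<le> C" if t: "0 \<le> t" for t
  proof -
    obtain N where N: "\<forall>i\<ge>N. \<forall>j\<ge>N. C * t + C \<le> gp \<one> (u i) (v j)"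
      using u(3) unfolding W.products_diverge_def by blast
    have "dX (sg (u i) t) (sg (v i) t) \<le> C" if "i \<ge> N" for i
      using C(2)[of "u i" "v i" t] u t N that by auto
    then show ?thesis by (rule limit_rays_close[OF u(1,2) r(1-4) t])
  qed
  then have "(\<alpha>, \<beta>) \<in> asymptotic X" using r by (auto simp: asymptotic_def)
  then show ?thesis using asymptotic_rays_eq r by simp
qed

text \<open>The constant depends neither on the sequences nor on the rays, and this uniformity later
  makes the boundary map open. Rays that are 2-close at time \<open>t\<close> lead to geodesics that
  are 3-close there, as 1/2 + 2 + 1/2 = 3.\<close>

lemma same_ray_products:
  obtains C where "0 < C" "\<And>u v \<alpha> \<beta> t. \<lbrakk>range u \<subseteq> carrier G; range v \<subseteq> carrier G; to_ray u \<alpha>; to_ray v \<beta>;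
    geodesic_ray X \<alpha>; geodesic_ray X \<beta>; 0 \<le> t; dX (\<alpha> t) (\<beta> t) \<le> 2\<rbrakk> \<Longrightarrow>
    \<exists>N. \<forall>i\<ge>N. \<forall>j\<ge>N. t \<le> C * gp \<one> (u i) (v j) + C"
proof -
  obtain C where C: "C > 0" "\<And>g h t. \<lbrakk>g \<in> carrier G; h \<in> carrier G; 0 \<le> t \<and> t \<le> nrm g \<and> t \<le> nrm h \<and>
      dX (sg g t) (sg h t) \<le> 3\<rbrakk> \<Longrightarrow> t \<le> C * gp \<one> g h + C"
    using fellow_travelling_products by blast
  have "\<exists>N. \<forall>i\<ge>N. \<forall>j\<ge>N. t \<le> C * gp \<one> (u i) (v j) + C"
    if u: "range u \<subseteq> carrier G" "range v \<subseteq> carrier G" and r: "to_ray u \<alpha>" "to_ray v \<beta>"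
    "geodesic_ray X \<alpha>" "geodesic_ray X \<beta>" and t: "0 \<le> t" "dX (\<alpha> t) (\<beta> t) \<le> 2" for u v \<alpha> \<beta> t
  proof -
    obtain N1 where N1: "\<forall>n\<ge>N1. t \<le> nrm (u n) \<and> sg (u n) t \<in> mspace X \<and> dX (sg (u n) t) (\<alpha> t) < 1/2"
      using to_ray_near[OF u(1) r(1) t(1), of "1/2"] by auto
    obtain N2 where N2: "\<forall>n\<ge>N2. t \<le> nrm (v n) \<and> sg (v n) t \<in> mspace X \<and> dX (sg (v n) t) (\<beta> t) < 1/2"
      using to_ray_near[OF u(2) r(2) t(1), of "1/2"] by auto
    have "t \<le> C * gp \<one> (u i) (v j) + C" if ij: "i \<ge> max N1 N2" "j \<ge> max N1 N2" for i j
    proof (rule C(2))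
      have i: "t \<le> nrm (u i)" "sg (u i) t \<in> mspace X" "dX (sg (u i) t) (\<alpha> t) < 1/2" using N1 ij by auto
      have j: "t \<le> nrm (v j)" "sg (v j) t \<in> mspace X" "dX (sg (v j) t) (\<beta> t) < 1/2" using N2 ij by auto
      have "dX (sg (u i) t) (sg (v j) t) \<le> 3"
        using triangle4[of "sg (u i) t" X "\<alpha> t" "\<beta> t" "sg (v j) t"] i j t(2) geodesic_ray_in[OF r(3) t(1)]
          geodesic_ray_in[OF r(4) t(1)] mdist_commute[of X "\<beta> t"] by simp
      then show "0 \<le> t \<and> t \<le> nrm (u i) \<and> t \<le> nrm (v j) \<and> dX (sg (u i) t) (sg (v j) t) \<le> 3"
        using i j t by simp
    qed (use u in auto)
    then show ?thesis by blast
  qed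
  then show thesis using that C(1) by blast
qed

lemma same_ray_diverge:
  assumes "range u \<subseteq> carrier G" "range v \<subseteq> carrier G" "to_ray u \<alpha>" "to_ray v \<alpha>" "geodesic_ray X \<alpha>"
  shows "W.products_diverge \<one> u v"
  unfolding W.products_diverge_def
proof
  fix Z
  obtain C where C: "0 < C" "\<And>u v \<alpha> \<beta> t. \<lbrakk>range u \<subseteq> carrier G; range v \<subseteq> carrier G; to_ray u \<alpha>; to_ray v \<beta>;
    geodesic_ray X \<alpha>; geodesic_ray X \<beta>; 0 \<le> t; dX (\<alpha> t) (\<beta> t) \<le> 2\<rbrakk> \<Longrightarrow>
    \<exists>N. \<forall>i\<ge>N. \<forall>j\<ge>N. t \<le> C * gp \<one> (u i) (v j) + C" using same_ray_products by blast
  define t where "t = C * (max Z 0 + 1)"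
  have t: "0 \<le> t" using C by (simp add: t_def)
  obtain N where N: "\<forall>i\<ge>N. \<forall>j\<ge>N. t \<le> C * gp \<one> (u i) (v j) + C"
    using C(2)[OF assms assms(5) t] geodesic_ray_in[OF assms(5) t] by auto
  have "Z \<le> gp \<one> (u i) (v j)" if "i \<ge> N" "j \<ge> N" for i j
  proof -
    have "C * (max Z 0) \<le> C * gp \<one> (u i) (v j)" using N that by (simp add: t_def algebra_simps)
    then show ?thesis using C(1) by simp
  qed
  then show "\<exists>N. \<forall>i\<ge>N. \<forall>j\<ge>N. Z \<le> gp \<one> (u i) (v j)" by blast
qed

definition bray :: "(nat \<Rightarrow> 'g) set \<Rightarrow> real \<Rightarrow> 'b" where
  "bray \<xi> = ray_from X x0 (orbit_boundary_map X \<phi> x0 \<xi>)"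

lemma boundary_rep_G:
  assumes "\<xi> \<in> bdG" "u \<in> \<xi>"
  shows "range u \<subseteq> carrier G" "W.products_diverge \<one> u u"
  using W.boundary_rep[OF _ assms] by auto

text \<open>Shows that the description in \<open>orbit_boundary_map\<close> picks out a point: any
  two sequences of the class have diverging products, hence a common limit ray.\<close>

lemma ex_boundary_ray:
  assumes \<xi>: "\<xi> \<in> bdG"
  shows "\<exists>\<alpha>. geodesic_ray X \<alpha> \<and> \<alpha> 0 = x0 \<and> (\<forall>u\<in>\<xi>. to_ray u \<alpha>) \<and>
    orbit_boundary_map X \<phi> x0 \<xi> = asymptotic X `` {\<alpha>}"
proof -
  obtain u where u: "u \<in> \<xi>" using W.boundary_class[of \<one> \<xi>] \<xi> by auto
  obtain \<alpha> where \<alpha>: "geodesic_ray X \<alpha>" "\<alpha> 0 = x0" "to_ray u \<alpha>"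
    using products_diverge_to_ray boundary_rep_G[OF \<xi> u] by blast
  have all: "to_ray v \<alpha>" if v: "v \<in> \<xi>" for v
  proof -
    obtain \<beta> where \<beta>: "geodesic_ray X \<beta>" "\<beta> 0 = x0" "to_ray v \<beta>"
      using products_diverge_to_ray boundary_rep_G[OF \<xi> v] by blast
    have "W.products_diverge \<one> u v" using W.boundary_reps_diverge[OF _ \<xi> u v] by simp
    then have "\<alpha> = \<beta>"
      using products_diverge_same_ray[OF boundary_rep_G(1)[OF \<xi> u] boundary_rep_G(1)[OF \<xi> v]] \<alpha> \<beta> by blast
    then show ?thesis using \<beta> by simp
  qed
  have lim: "limitin (cone_topology X x0) (\<lambda>n. Inl (\<phi> (v n) x0)) (Inr \<eta>) sequentially \<longleftrightarrow> to_ray v (ray_from X x0 \<eta>)"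
    if "v \<in> \<xi>" "\<eta> \<in> visual_boundary X" for v \<eta>
    using boundary_rep_G(1)[OF \<xi> that(1)] that x0 orb_seq_in by (intro limitin_cone_iff) auto
  have "orbit_boundary_map X \<phi> x0 \<xi> = asymptotic X `` {\<alpha>}"
    unfolding orbit_boundary_map_def
  proof (rule the_equality)
    show "asymptotic X `` {\<alpha>} \<in> visual_boundary X \<and>
      (\<forall>u\<in>\<xi>. limitin (cone_topology X x0) (\<lambda>n. Inl (\<phi> (u n) x0)) (Inr (asymptotic X `` {\<alpha>})) sequentially)"
      using class_in_boundary[OF \<alpha>(1)] lim all ray_from_class[OF \<alpha>(1,2)] by simp
    fix \<eta> assume \<eta>: "\<eta> \<in> visual_boundary X \<and>
      (\<forall>u\<in>\<xi>. limitin (cone_topology X x0) (\<lambda>n. Inl (\<phi> (u n) x0)) (Inr \<eta>) sequentially)"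
    then have "to_ray u (ray_from X x0 \<eta>)" using lim u by blast
    then have "ray_from X x0 \<eta> = \<alpha>"
      using \<alpha> \<eta> ray_from(3)[OF x0, of \<eta>] boundary_rep_G(1)[OF \<xi> u] orb_seq_in by (intro converges_to_ray_unique[OF x0]) auto
    then show "\<eta> = asymptotic X `` {\<alpha>}" using ray_from(4)[OF x0, of \<eta>] \<eta> by simp
  qed
  then show ?thesis using \<alpha> all by blast
qed

lemma bray:
  assumes \<xi>: "\<xi> \<in> bdG"
  shows "geodesic_ray X (bray \<xi>)" "bray \<xi> 0 = x0" "orbit_boundary_map X \<phi> x0 \<xi> = asymptotic X `` {bray \<xi>}"
    "\<And>u. u \<in> \<xi> \<Longrightarrow> to_ray u (bray \<xi>)"
proof -
  obtain \<alpha> where \<alpha>: "geodesic_ray X \<alpha>" "\<alpha> 0 = x0" "\<forall>u\<in>\<xi>. to_ray u \<alpha>"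
    "orbit_boundary_map X \<phi> x0 \<xi> = asymptotic X `` {\<alpha>}" using ex_boundary_ray[OF \<xi>] by blast
  have "bray \<xi> = \<alpha>" unfolding bray_def using ray_from_class[OF \<alpha>(1,2)] \<alpha>(4) by simp
  then show "geodesic_ray X (bray \<xi>)" "bray \<xi> 0 = x0" "orbit_boundary_map X \<phi> x0 \<xi> = asymptotic X `` {bray \<xi>}"
    "\<And>u. u \<in> \<xi> \<Longrightarrow> to_ray u (bray \<xi>)" using \<alpha> by auto
qed

lemma bray_in: "\<xi> \<in> bdG \<Longrightarrow> 0 \<le> t \<Longrightarrow> bray \<xi> t \<in> mspace X"
  using bray geodesic_ray_in by blast

lemma bray_eqI:
  assumes \<xi>: "\<xi> \<in> bdG" and u: "u \<in> \<xi>" and \<alpha>: "geodesic_ray X \<alpha>" "to_ray u \<alpha>"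
  shows "bray \<xi> = \<alpha>"
  using bray[OF \<xi>] u \<alpha> boundary_rep_G(1)[OF \<xi> u] orb_seq_in by (intro converges_to_ray_unique[OF x0]) auto

lemma bray_inj:
  assumes \<xi>: "\<xi> \<in> bdG" "\<eta> \<in> bdG" and eq: "bray \<xi> = bray \<eta>"
  shows "\<xi> = \<eta>"
proof -
  obtain u where u: "u \<in> \<xi>" using W.boundary_class[of \<one> \<xi>] \<xi> by auto
  obtain v where v: "v \<in> \<eta>" using W.boundary_class[of \<one> \<eta>] \<xi> by auto
  have "to_ray v (bray \<xi>)" using bray(4)[OF \<xi>(2) v] eq by simp
  then have "W.products_diverge \<one> u v"
    using same_ray_diverge[OF boundary_rep_G(1)[OF \<xi>(1) u] boundary_rep_G(1)[OF \<xi>(2) v] bray(4)[OF \<xi>(1) u] _ bray(1)[OF \<xi>(1)]] by simp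
  then show ?thesis using W.boundary_eqI[OF _ \<xi> u v] by simp
qed

text \<open>Convergence of the orbit already forces convergence in the Gromov boundary. This carries
  a limit found in one factor over to the other.\<close>

lemma to_ray_boundary_point:
  assumes u: "range u \<subseteq> carrier G" and \<alpha>: "to_ray u \<alpha>" "geodesic_ray X \<alpha>"
  shows "\<exists>\<xi>\<in>bdG. u \<in> \<xi> \<and> bray \<xi> = \<alpha>"
proof -
  have "W.products_diverge \<one> u u" using same_ray_diverge[OF u u \<alpha>(1) \<alpha>] .
  then have "gromov_equiv (word_metric G S) \<one> `` {u} \<in> bdG" "u \<in> gromov_equiv (word_metric G S) \<one> `` {u}"
    using W.class_in_gromov_boundary[of \<one> u] u by auto
  then show ?thesis using bray_eqI \<alpha> by blast
qed

text \<open>A large product gives distance at most \<open>C\<close> at a late time \<open>T\<close>,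
  and scaling back to \<open>r\<close> brings it below \<open>e\<close>. The radius \<open>R\<close>
  is uniform in \<xi>.\<close>

lemma bray_continuous:
  assumes r: "0 \<le> r" and e: "0 < e"
  shows "\<exists>R. \<forall>\<xi>\<in>bdG. \<forall>\<eta>\<in>gromov_nbhd (word_metric G S) \<one> \<xi> R. dX (bray \<xi> r) (bray \<eta> r) < e"
proof -
  obtain C where C: "C > 0" "\<And>g h t. \<lbrakk>g \<in> carrier G; h \<in> carrier G; 0 \<le> t; C * t + C \<le> gp \<one> g h\<rbrakk> \<Longrightarrow>
     t \<le> nrm g \<and> t \<le> nrm h \<and> dX (sg g t) (sg h t) \<le> C"
    using geodesics_fellow_travel by blast
  define T where "T = r + C * r / e + 1"
  have "0 \<le> C * r / e" using r e C(1) by simp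
  then have T: "r \<le> T" "0 < T" using r by (simp_all add: T_def)
  have "T * e = r * e + r * C + e" using e by (simp add: T_def field_simps)
  then have T: "r \<le> T" "0 < T" "r * C < T * e"
    using T e r mult_nonneg_nonneg[of r e] by linarith+
  have "dX (bray \<xi> r) (bray \<eta> r) < e"
    if \<xi>: "\<xi> \<in> bdG" and nb: "\<eta> \<in> gromov_nbhd (word_metric G S) \<one> \<xi> (C * T + C)" for \<xi> \<eta>
  proof -
    obtain u v N where uv: "u \<in> \<xi>" "v \<in> \<eta>" and N: "\<forall>i\<ge>N. \<forall>j\<ge>N. C * T + C \<le> gp \<one> (u i) (v j)" and \<eta>: "\<eta> \<in> bdG"
      using nb unfolding W.in_gromov_nbhd_iff by blast
    note uG = boundary_rep_G(1)[OF \<xi> uv(1)] and vG = boundary_rep_G(1)[OF \<eta> uv(2)]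
    have "dX (sg (u i) T) (sg (v i) T) \<le> C" if "i \<ge> N" for i
      using C(2)[of "u i" "v i" T] uG vG T N that by auto
    then have dT: "dX (bray \<xi> T) (bray \<eta> T) \<le> C"
      using T by (intro limit_rays_close[OF uG vG bray(4)[OF \<xi> uv(1)] bray(4)[OF \<eta> uv(2)] bray(1)[OF \<xi>] bray(1)[OF \<eta>]]) auto
    have "T * dX (bray \<xi> r) (bray \<eta> r) \<le> r * dX (bray \<xi> T) (bray \<eta> T)"
      using bray[OF \<xi>] bray[OF \<eta>] r T by (intro unit_speed_scale geodesic_ray_unit_speed) auto
    also have "\<dots> \<le> r * C" using dT r by (intro mult_left_mono) auto
    also have "\<dots> < T * e" using T by simp
    finally show ?thesis using T by simp
  qed
  then show ?thesis by blast
qed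

text \<open>Closeness at a late time, even within the fixed tolerance 2, already means a large
  product; this gives continuity of the inverse of the boundary map.\<close>

lemma bray_close_nbhd:
  "\<exists>T>0. \<forall>t\<ge>T. \<forall>\<xi>\<in>bdG. \<forall>\<eta>\<in>bdG. dX (bray \<xi> t) (bray \<eta> t) \<le> 2 \<longrightarrow> \<eta> \<in> gromov_nbhd (word_metric G S) \<one> \<xi> R"
proof -
  obtain C where C: "0 < C" "\<And>u v \<alpha> \<beta> t. \<lbrakk>range u \<subseteq> carrier G; range v \<subseteq> carrier G; to_ray u \<alpha>; to_ray v \<beta>;
    geodesic_ray X \<alpha>; geodesic_ray X \<beta>; 0 \<le> t; dX (\<alpha> t) (\<beta> t) \<le> 2\<rbrakk> \<Longrightarrow>
    \<exists>N. \<forall>i\<ge>N. \<forall>j\<ge>N. t \<le> C * gp \<one> (u i) (v j) + C" using same_ray_products by blast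
  define T where "T = C * (max R 0 + 1)"
  have T0: "0 < T" using C by (simp add: T_def)
  have "\<eta> \<in> gromov_nbhd (word_metric G S) \<one> \<xi> R"
    if t: "T \<le> t" and \<xi>: "\<xi> \<in> bdG" and \<eta>: "\<eta> \<in> bdG" and close: "dX (bray \<xi> t) (bray \<eta> t) \<le> 2" for t \<xi> \<eta>
  proof -
    obtain u where u: "u \<in> \<xi>" using W.boundary_class[of \<one> \<xi>] \<xi> by auto
    obtain v where v: "v \<in> \<eta>" using W.boundary_class[of \<one> \<eta>] \<eta> by auto
    obtain N where N: "\<forall>i\<ge>N. \<forall>j\<ge>N. t \<le> C * gp \<one> (u i) (v j) + C"
      using C(2)[OF boundary_rep_G(1)[OF \<xi> u] boundary_rep_G(1)[OF \<eta> v] bray(4)[OF \<xi> u] bray(4)[OF \<eta> v] bray(1)[OF \<xi>] bray(1)[OF \<eta>] _ close]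
        t T0 by auto
    have "R \<le> gp \<one> (u i) (v j)" if "i \<ge> N" "j \<ge> N" for i j
    proof -
      have "T \<le> C * gp \<one> (u i) (v j) + C" using N that t by (meson order_trans)
      then have "C * (max R 0) \<le> C * gp \<one> (u i) (v j)" by (simp add: T_def algebra_simps)
      then show ?thesis using C(1) by simp
    qed
    then show ?thesis unfolding W.in_gromov_nbhd_iff using \<eta> u v by blast
  qed
  then show ?thesis using T0 by blast
qed

end

section \<open>The slopes of a pair of actions\<close>

text \<open>The ratio is a coordinate of a unit vector. A change of at most \<open>E\<close> in each
  coordinate changes the length by at most 2E, so numerator and denominator contribute E and 2E,
  relative to the old length.\<close>

lemma ratio_stable:
  fixes x y x' y' E :: real
  assumes nn: "0 \<le> x" "0 \<le> y" "0 \<le> x'" "0 \<le> y'" and P: "0 < sqrt (x\<^sup>2 + y\<^sup>2)" "0 < sqrt (x'\<^sup>2 + y'\<^sup>2)"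
    and E: "\<bar>x' - x\<bar> \<le> E" "\<bar>y' - y\<bar> \<le> E"
  shows "\<bar>x' / sqrt (x'\<^sup>2 + y'\<^sup>2) - x / sqrt (x\<^sup>2 + y\<^sup>2)\<bar> \<le> 3 * E / sqrt (x\<^sup>2 + y\<^sup>2)"
proof -
  define p p' where "p = sqrt (x\<^sup>2 + y\<^sup>2)" and "p' = sqrt (x'\<^sup>2 + y'\<^sup>2)"
  have pp: "0 < p" "0 < p'" using P by (auto simp: p_def p'_def)
  have xp: "x' \<le> p'" by (auto simp: p'_def intro: real_le_rsqrt)
  have "p' \<le> p + sqrt ((x' - x)\<^sup>2 + (y' - y)\<^sup>2)"
    using real_sqrt_sum_squares_triangle_ineq[of x "x' - x" y "y' - y"] by (simp add: p_def p'_def)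
  moreover have "p \<le> p' + sqrt ((x - x')\<^sup>2 + (y - y')\<^sup>2)"
    using real_sqrt_sum_squares_triangle_ineq[of x' "x - x'" y' "y - y'"] by (simp add: p_def p'_def)
  moreover have "sqrt ((x' - x)\<^sup>2 + (y' - y)\<^sup>2) \<le> 2 * E"
    using sqrt_sum_squares_le_sum_abs[of "x' - x" "y' - y"] E by linarith
  moreover have "sqrt ((x - x')\<^sup>2 + (y - y')\<^sup>2) \<le> 2 * E"
    using sqrt_sum_squares_le_sum_abs[of "x - x'" "y - y'"] E by linarith
  ultimately have pd: "\<bar>p' - p\<bar> \<le> 2 * E" by linarith
  \<comment> \<open>Split so that both terms carry the old length \<open>p\<close> as denominator;
    the second is then controlled by \<open>x' / p' \<le> 1\<close>.\<close>
  have "x' / p' - x / p = (x' - x) / p + (x' / p') * (p - p') / p"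
    using pp by (simp add: field_simps)
  also have "\<bar>\<dots>\<bar> \<le> \<bar>(x' - x) / p\<bar> + \<bar>(x' / p') * (p - p') / p\<bar>" by (rule abs_triangle_ineq)
  also have "\<bar>(x' - x) / p\<bar> \<le> E / p" using pp E by (simp add: divide_right_mono)
  also have "\<bar>(x' / p') * (p - p') / p\<bar> \<le> 2 * E / p"
  proof -
    have "(x' / p') * \<bar>p - p'\<bar> \<le> 1 * (2 * E)" using xp pp pd nn by (intro mult_mono) auto
    then have "(x' / p') * \<bar>p - p'\<bar> / p \<le> 2 * E / p" using pp by (intro divide_right_mono) auto
    then show ?thesis using pp nn by (simp add: abs_mult)
  qed
  finally show ?thesis by (simp add: p_def p'_def add_divide_distrib)
qed

locale geometric_pair = word_hyperbolic_group G S \<delta> +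
  A1: geometric_action G S \<delta> X1 \<phi>1 x1 + A2: geometric_action G S \<delta> X2 \<phi>2 x2
  for G :: "('g, 'm) monoid_scheme" (structure) and S \<delta>
    and X1 :: "'a metric" and \<phi>1 x1 and X2 :: "'b metric" and \<phi>2 x2
begin

abbreviation "bdG \<equiv> gromov_boundary (word_metric G S) \<one>"

definition pnrm :: "'g \<Rightarrow> real" where
  "pnrm g = sqrt ((A1.nrm g)\<^sup>2 + (A2.nrm g)\<^sup>2)"

text \<open>The cosine of the angle between the direction of \<open>g\<close> and the first
  factor.\<close>

definition slope :: "'g \<Rightarrow> real" where
  "slope g = A1.nrm g / pnrm g"

section \<open>Slopes of single elements\<close>

lemma pnrm_ge: "A1.nrm g \<le> pnrm g" "A2.nrm g \<le> pnrm g" "0 \<le> pnrm g"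
  by (auto simp: pnrm_def intro: real_le_rsqrt)

lemma slope_bounds: "0 \<le> slope g" "slope g \<le> 1"
  using pnrm_ge[of g] by (auto simp: slope_def divide_le_eq_1)

lemma slope_sq:
  assumes "0 < pnrm g"
  shows "(slope g)\<^sup>2 + (A2.nrm g / pnrm g)\<^sup>2 = 1"
proof -
  have sq: "(A1.nrm g)\<^sup>2 + (A2.nrm g)\<^sup>2 = (pnrm g)\<^sup>2" by (simp add: pnrm_def)
  have "(slope g)\<^sup>2 + (A2.nrm g / pnrm g)\<^sup>2 = ((A1.nrm g)\<^sup>2 + (A2.nrm g)\<^sup>2) / (pnrm g)\<^sup>2"
    by (simp add: slope_def power_divide add_divide_distrib)
  then show ?thesis unfolding sq using assms by simp
qed

lemma ex_quasi_isometry_constant: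
  "\<exists>A\<ge>1. \<forall>g\<in>carrier G. A1.nrm g \<le> A * len g \<and> A2.nrm g \<le> A * len g \<and>
     len g \<le> A * A1.nrm g + A \<and> len g \<le> A * A2.nrm g + A"
proof -
  obtain A where A: "1 \<le> A" "\<And>g h. \<lbrakk>g \<in> carrier G; h \<in> carrier G\<rbrakk> \<Longrightarrow> mdist X1 (\<phi>1 g x1) (\<phi>1 h x1) \<le> A * dG g h \<and>
      dG g h \<le> A * mdist X1 (\<phi>1 g x1) (\<phi>1 h x1) + A"
    using A1.orbit_map_quasi_isometry by blast
  obtain B where B: "1 \<le> B" "\<And>g h. \<lbrakk>g \<in> carrier G; h \<in> carrier G\<rbrakk> \<Longrightarrow> mdist X2 (\<phi>2 g x2) (\<phi>2 h x2) \<le> B * dG g h \<and>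
      dG g h \<le> B * mdist X2 (\<phi>2 g x2) (\<phi>2 h x2) + B"
    using A2.orbit_map_quasi_isometry by blast
  have "A1.nrm g \<le> (A + B) * len g \<and> A2.nrm g \<le> (A + B) * len g \<and>
     len g \<le> (A + B) * A1.nrm g + (A + B) \<and> len g \<le> (A + B) * A2.nrm g + (A + B)" if g: "g \<in> carrier G" for g
  proof -
    have nn: "0 \<le> A * len g" "0 \<le> B * len g" "0 \<le> B * A1.nrm g" "0 \<le> A * A2.nrm g" using A(1) B(1) by auto
    show ?thesis
      using A(2)[OF one_closed g] B(2)[OF one_closed g] nn A(1) B(1) unfolding A1.orb_one A2.orb_one distrib_right
      by linarith
  qed
  moreover have "1 \<le> A + B" using A(1) B(1) by simp
  ultimately show ?thesis by blast
qed

definition qi :: real where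
  "qi = (SOME A. 1 \<le> A \<and> (\<forall>g\<in>carrier G. A1.nrm g \<le> A * len g \<and> A2.nrm g \<le> A * len g \<and>
     len g \<le> A * A1.nrm g + A \<and> len g \<le> A * A2.nrm g + A))"

lemma qi: "1 \<le> qi" "g \<in> carrier G \<Longrightarrow> A1.nrm g \<le> qi * len g" "g \<in> carrier G \<Longrightarrow> A2.nrm g \<le> qi * len g"
  "g \<in> carrier G \<Longrightarrow> len g \<le> qi * A1.nrm g + qi" "g \<in> carrier G \<Longrightarrow> len g \<le> qi * A2.nrm g + qi"
  using someI_ex[OF ex_quasi_isometry_constant[unfolded Bex_def]] unfolding qi_def[symmetric] by auto

lemma pnrm_large:
  assumes g: "g \<in> carrier G" "qi * (Z + 1) \<le> len g"
  shows "Z \<le> A1.nrm g" "Z \<le> A2.nrm g" "Z \<le> pnrm g"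
proof -
  have "qi * Z \<le> qi * A1.nrm g" "qi * Z \<le> qi * A2.nrm g"
    using qi(4)[OF g(1)] qi(5)[OF g(1)] g(2) by (auto simp: algebra_simps)
  then show 1: "Z \<le> A1.nrm g" "Z \<le> A2.nrm g" using qi(1) by auto
  then show "Z \<le> pnrm g" using pnrm_ge[of g] by linarith
qed

lemma slope_stable:
  assumes "0 < pnrm g" "0 < pnrm h" "\<bar>A1.nrm h - A1.nrm g\<bar> \<le> E" "\<bar>A2.nrm h - A2.nrm g\<bar> \<le> E"
  shows "\<bar>slope h - slope g\<bar> \<le> 3 * E / pnrm g"
  using ratio_stable[of "A1.nrm g" "A2.nrm g" "A1.nrm h" "A2.nrm h" E] assms by (simp add: slope_def pnrm_def)

text \<open>The accumulation values of the slope at infinity, defined without reference to a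
  boundary point; that each occurs at every boundary point is
  \<open>ex_slope_sequence\<close>.\<close>

definition slopes :: "real set" where
  "slopes = {s. \<forall>N. \<forall>e>0. \<exists>g\<in>carrier G. N \<le> len g \<and> \<bar>slope g - s\<bar> < e}"

lemma slopes_closed: "closed slopes"
proof -
  have "s \<in> slopes" if "s \<in> closure slopes" for s
    unfolding slopes_def
  proof (intro CollectI allI impI)
    have s: "\<forall>e>0. \<exists>y\<in>slopes. dist y s < e" using that by (simp add: closure_approachable)
    fix N e :: real assume e: "0 < e"
    obtain y where y: "y \<in> slopes" "dist y s < e / 2" using s e by (meson half_gt_zero)
    have "\<forall>N. \<forall>e>0. \<exists>g\<in>carrier G. N \<le> len g \<and> \<bar>slope g - y\<bar> < e" using y(1) by (simp add: slopes_def)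
    then obtain g where g: "g \<in> carrier G" "N \<le> len g" "\<bar>slope g - y\<bar> < e / 2"
      using e by (meson half_gt_zero)
    then have "\<bar>slope g - s\<bar> < e" using y(2) unfolding dist_real_def by linarith
    then show "\<exists>g\<in>carrier G. N \<le> len g \<and> \<bar>slope g - s\<bar> < e" using g by blast
  qed
  then show ?thesis using closure_subset_eq by blast
qed

text \<open>Both displacements are comparable to the word length, hence to each other, so limiting
  directions stay away from both axes. The second bound concerns the other factor, since 1 - s^2 is
  the square of its share.\<close>

lemma slopes_pos: "\<exists>k>0. \<forall>s\<in>slopes. k \<le> s \<and> k\<^sup>2 \<le> 1 - s\<^sup>2"
proof -
  \<comment> \<open>One factor 2 qi compares the word length with a single displacement, the other
    compares the displacement in the product with the word length.\<close>
  define k where "k = 1 / (4 * qi\<^sup>2)"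
  have k: "0 < k" using qi(1) by (simp add: k_def)
  have sl: "k \<le> slope g \<and> k\<^sup>2 \<le> 1 - (slope g)\<^sup>2" if g: "g \<in> carrier G" "2 * qi \<le> len g" for g
  proof -
    have l: "0 < len g" using g(2) qi(1) by simp
    have "len g \<le> 2 * qi * A1.nrm g" "len g \<le> 2 * qi * A2.nrm g"
      using qi(4)[OF g(1)] qi(5)[OF g(1)] g(2) by auto
    moreover have p: "pnrm g \<le> 2 * qi * len g"
      using sqrt_sum_squares_le_sum_abs[of "A1.nrm g" "A2.nrm g"] qi(2,3)[OF g(1)] by (simp add: pnrm_def)
    moreover have p0: "0 < pnrm g"
    proof (rule ccontr)
      assume "\<not> 0 < pnrm g"
      then have "A1.nrm g \<le> 0" using pnrm_ge[of g] by linarith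
      then have "2 * qi * A1.nrm g \<le> 0" using qi(1) by (simp add: mult_le_0_iff)
      then show False using calculation(1) l by linarith
    qed
    ultimately have le: "2 * qi * len g \<le> 2 * qi * (2 * qi * A1.nrm g)" "2 * qi * len g \<le> 2 * qi * (2 * qi * A2.nrm g)"
      using qi(1) by (intro mult_left_mono; simp)+
    then have n: "pnrm g \<le> 4 * qi\<^sup>2 * A1.nrm g" "pnrm g \<le> 4 * qi\<^sup>2 * A2.nrm g"
    proof -
      have eq: "4 * qi\<^sup>2 * x = 2 * qi * (2 * qi * x)" for x by (simp add: power2_eq_square)
      show "pnrm g \<le> 4 * qi\<^sup>2 * A1.nrm g" "pnrm g \<le> 4 * qi\<^sup>2 * A2.nrm g"
        unfolding eq using p le order_trans by blast+
    qed
    have 1: "k \<le> slope g" "k \<le> A2.nrm g / pnrm g"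
      using n p0 qi(1) by (auto simp: k_def slope_def field_simps)
    have "1 - (slope g)\<^sup>2 = (A2.nrm g / pnrm g)\<^sup>2" using slope_sq[OF p0] by simp
    then show ?thesis using 1 k by (simp add: power_mono)
  qed
  have "k \<le> s \<and> k\<^sup>2 \<le> 1 - s\<^sup>2" if s: "s \<in> slopes" for s
  proof -
    have "\<forall>n. \<exists>g\<in>carrier G. 2 * qi \<le> len g \<and> \<bar>slope g - s\<bar> < inverse (real (Suc n))"
      using s unfolding slopes_def by simp
    then obtain g where g: "\<And>n. g n \<in> carrier G" "\<And>n. 2 * qi \<le> len (g n)" "\<And>n. \<bar>slope (g n) - s\<bar> < inverse (real (Suc n))"
      by metis
    have "(\<lambda>n. slope (g n) - s) \<longlonglongrightarrow> 0"
      by (rule Lim_null_comparison[OF _ LIMSEQ_inverse_real_of_nat])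
        (use g(3) in \<open>auto intro!: always_eventually less_imp_le\<close>)
    then have lim: "(\<lambda>n. slope (g n)) \<longlonglongrightarrow> s" by (simp add: LIM_zero_iff)
    have "k \<le> s" by (rule LIMSEQ_le_const[OF lim]) (use sl g in auto)
    moreover have "(\<lambda>n. 1 - (slope (g n))\<^sup>2) \<longlonglongrightarrow> 1 - s\<^sup>2" by (intro tendsto_intros lim)
    then have "k\<^sup>2 \<le> 1 - s\<^sup>2" by (rule LIMSEQ_le_const) (use sl g in auto)
    ultimately show ?thesis by blast
  qed
  then show ?thesis using k by blast
qed

lemma slopesI:
  assumes g: "range g \<subseteq> carrier G" and far: "filterlim (\<lambda>n. len (g n)) at_top sequentially" and lim: "(\<lambda>n. slope (g n)) \<longlonglongrightarrow> s"
  shows "s \<in> slopes"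
  unfolding slopes_def
proof (intro CollectI allI impI)
  fix N e :: real assume e: "0 < e"
  have "eventually (\<lambda>n. N \<le> len (g n)) sequentially" using far by (auto simp: filterlim_at_top)
  moreover have "eventually (\<lambda>n. dist (slope (g n)) s < e) sequentially" using lim e by (rule tendstoD)
  ultimately have "eventually (\<lambda>n. N \<le> len (g n) \<and> dist (slope (g n)) s < e) sequentially" by eventually_elim auto
  then obtain n where "N \<le> len (g n)" "dist (slope (g n)) s < e" by (auto simp: eventually_sequentially)
  then show "\<exists>g\<in>carrier G. N \<le> len g \<and> \<bar>slope g - s\<bar> < e"
    using g by (intro bexI[of _ "g n"]) (auto simp: dist_real_def)
qed

lemma diverging_far:
  assumes u: "range u \<subseteq> carrier G" "W.products_diverge \<one> u u"
  shows "filterlim (\<lambda>n. len (u n)) at_top sequentially"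
  unfolding filterlim_at_top eventually_sequentially
  using W.products_diverge_far[of \<one> u] u by auto

lemma slopes_nonempty:
  assumes "\<xi> \<in> bdG"
  shows "slopes \<noteq> {}"
proof -
  obtain u where u: "u \<in> \<xi>" using W.boundary_class[of \<one> \<xi>] assms by auto
  note uG = A1.boundary_rep_G[OF assms u]
  have "compact {0..1::real}" by simp
  moreover have "\<forall>n. slope (u n) \<in> {0..1}" using slope_bounds by auto
  ultimately obtain s r where sr: "strict_mono r" "((\<lambda>n. slope (u n)) \<circ> r) \<longlonglongrightarrow> s"
    unfolding compact_def by metis
  have "s \<in> slopes"
  proof (rule slopesI[of "u \<circ> r"])
    have "filterlim r at_top sequentially" using sr(1) by (rule filterlim_subseq)
    then show "filterlim (\<lambda>n. len ((u \<circ> r) n)) at_top sequentially"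
      using filterlim_compose[OF diverging_far[OF uG]] by simp
  qed (use uG sr in \<open>auto simp: o_def\<close>)
  then show ?thesis by blast
qed

text \<open>
  An element \<open>v\<close> of the right slope is moved towards \<open>\<xi>\<close> by a fixed element \<open>w\<close> close to \<open>\<xi>\<close>; the
  correction \<open>a\<close> (and possibly passing to \<open>inv v\<close>, which has the same slope) prevents \<open>w\<close> from
  carrying it back. Since \<open>w\<close> and \<open>a\<close> are bounded independently of \<open>v\<close>, the slope hardly changes.
\<close>

lemma ex_slope_near_boundary_point:
  assumes \<xi>: "\<xi> \<in> bdG" and u: "u \<in> \<xi>" and s: "s \<in> slopes" and e: "0 < e"
  shows "\<exists>g\<in>carrier G. \<bar>slope g - s\<bar> < e \<and> (\<exists>N. \<forall>m\<ge>N. Z \<le> gp \<one> g (u m))"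
proof -
  note uG = A1.boundary_rep_G[OF \<xi> u]
  obtain n where n: "\<And>x v. \<lbrakk>x \<in> carrier G; v \<in> carrier G\<rbrakk> \<Longrightarrow> \<exists>a\<in>carrier G. len a \<le> real n \<and>
    (gp \<one> x (a \<otimes> v) \<le> real n + \<delta> \<or> gp \<one> x (a \<otimes> inv v) \<le> real n + \<delta>)"
    using ex_separating_elements by blast
  \<comment> \<open>n + \<delta> will be lost to cancellation between \<open>w\<close> and the
    corrected \<open>v\<close>, and the last \<delta> to the four point condition.\<close>
  define K where "K = Z + (real n + \<delta>) + \<delta>"
  obtain m0 where m0: "\<forall>i\<ge>m0. \<forall>j\<ge>m0. K \<le> gp \<one> (u i) (u j)"
    using uG(2) unfolding W.products_diverge_def by blast
  define w where "w = u m0"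
  have w: "w \<in> carrier G" using uG(1) by (auto simp: w_def)
  \<comment> \<open>Bounds the change of either displacement caused by \<open>w\<close> and any
    correction of length at most \<open>n\<close>; it is fixed before \<open>v\<close> is
    chosen.\<close>
  define E where "E = A1.nrm w + A2.nrm w + qi * real n"
  have E: "0 \<le> E" using qi(1) by (simp add: E_def)
  define P where "P = 6 * E / e + 2 * E + 1"
  have P: "0 < P" "E < P" "3 * E / P < e / 2"
  proof -
    have 0: "0 \<le> 6 * E / e" using E e by simp
    then show "0 < P" "E < P" using E unfolding P_def by linarith+
    then have "6 * E < e * P" using E e 0 by (simp add: P_def field_simps add_pos_nonneg)
    then show "3 * E / P < e / 2" using \<open>0 < P\<close> e by (simp add: field_simps)
  qed
  have "\<forall>N. \<forall>e>0. \<exists>g\<in>carrier G. N \<le> len g \<and> \<bar>slope g - s\<bar> < e" using s by (simp add: slopes_def)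
  then obtain v where v: "v \<in> carrier G" "qi * (P + 1) \<le> len v" "\<bar>slope v - s\<bar> < e / 2"
    using e by (meson half_gt_zero)
  have Pv: "P \<le> A1.nrm v" "P \<le> pnrm v" using pnrm_large[OF v(1,2)] by auto
  obtain a where a: "a \<in> carrier G" "len a \<le> real n"
    "gp \<one> (inv w) (a \<otimes> v) \<le> real n + \<delta> \<or> gp \<one> (inv w) (a \<otimes> inv v) \<le> real n + \<delta>"
    using n[of "inv w" v] w v by auto
  \<comment> \<open>Inversion preserves both displacements, so \<open>v'\<close> has the slope of
    \<open>v\<close> in either case.\<close>
  obtain v' where v': "v' \<in> carrier G" "gp \<one> (inv w) (a \<otimes> v') \<le> real n + \<delta>" "A1.nrm v' = A1.nrm v" "A2.nrm v' = A2.nrm v"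
  proof (cases "gp \<one> (inv w) (a \<otimes> v) \<le> real n + \<delta>")
    case True
    then show thesis using that[of v] v by simp
  next
    case False
    then show thesis using that[of "inv v"] a v A1.nrm_inv A2.nrm_inv by simp
  qed
  define g where "g = w \<otimes> (a \<otimes> v')"
  have g: "g \<in> carrier G" using w a v' by (simp add: g_def)
  have na: "A1.nrm a \<le> qi * real n" "A2.nrm a \<le> qi * real n"
  proof -
    have "qi * len a \<le> qi * real n" using a qi(1) by (intro mult_left_mono) auto
    then show "A1.nrm a \<le> qi * real n" "A2.nrm a \<le> qi * real n" using qi(2,3)[OF a(1)] by linarith+
  qed
  have d: "\<bar>A1.nrm g - A1.nrm v\<bar> \<le> E" "\<bar>A2.nrm g - A2.nrm v\<bar> \<le> E"
    using A1.nrm_mult_diff[of w "a \<otimes> v'"] A1.nrm_mult_diff[of a v'] A2.nrm_mult_diff[of w "a \<otimes> v'"] A2.nrm_mult_diff[of a v']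
      w a v' na mdist_nonneg[of X1 x1 "\<phi>1 w x1"] mdist_nonneg[of X2 x2 "\<phi>2 w x2"] by (auto simp: g_def E_def abs_le_iff)
  have "0 < A1.nrm g" using d(1) Pv P by linarith
  then have "0 < pnrm g" using pnrm_ge(1)[of g] by linarith
  then have "\<bar>slope g - slope v\<bar> \<le> 3 * E / pnrm v" using d Pv P by (intro slope_stable) auto
  also have "\<dots> \<le> 3 * E / P" using Pv P E by (intro divide_left_mono) auto
  finally have sl: "\<bar>slope g - s\<bar> < e" using P(3) v(3) by linarith
  have "Z \<le> gp \<one> g (u m)" if m: "m \<ge> m0" for m
  proof -
    have um: "u m \<in> carrier G" using uG(1) by auto
    have "K \<le> gp \<one> w (u m)" "K \<le> gp \<one> w w" using m0 m by (auto simp: w_def)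
    moreover have "gp \<one> w w = len w" using w by (intro W.gp_self) auto
    moreover have "gp \<one> g w = len w - gp \<one> (inv w) (a \<otimes> v')" unfolding g_def using w a v' by (intro gp_mult) auto
    moreover have "min (gp \<one> g w) (gp \<one> w (u m)) - \<delta> \<le> gp \<one> g (u m)" using w g um by (intro W.four_point) auto
    ultimately show ?thesis using v'(2) W.delta_pos unfolding K_def by linarith
  qed
  then show ?thesis using g sl by blast
qed

text \<open>A choice with shrinking errors and growing products. Each term is compared with all late
  terms of \<open>u\<close>, and the four point condition then makes the new sequence equivalent to
  \<open>u\<close>.\<close>

lemma ex_slope_sequence:
  assumes \<xi>: "\<xi> \<in> bdG" and s: "s \<in> slopes"
  shows "\<exists>g\<in>\<xi>. (\<lambda>n. slope (g n)) \<longlonglongrightarrow> s"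
proof -
  obtain u where u: "u \<in> \<xi>" using W.boundary_class[of \<one> \<xi>] \<xi> by auto
  note uG = A1.boundary_rep_G[OF \<xi> u]
  have "\<forall>k. \<exists>g. g \<in> carrier G \<and> \<bar>slope g - s\<bar> < inverse (real (Suc k)) \<and> (\<exists>N. \<forall>m\<ge>N. real k \<le> gp \<one> g (u m))"
  proof
    fix k
    show "\<exists>g. g \<in> carrier G \<and> \<bar>slope g - s\<bar> < inverse (real (Suc k)) \<and> (\<exists>N. \<forall>m\<ge>N. real k \<le> gp \<one> g (u m))"
      using ex_slope_near_boundary_point[OF \<xi> u s, of "inverse (real (Suc k))" "real k"] by auto
  qed
  then obtain g where g: "\<And>k. g k \<in> carrier G" "\<And>k. \<bar>slope (g k) - s\<bar> < inverse (real (Suc k))"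
    "\<And>k. \<exists>N. \<forall>m\<ge>N. real k \<le> gp \<one> (g k) (u m)" by metis
  have gG: "range g \<subseteq> carrier G" using g(1) by auto
  have gu: "W.products_diverge \<one> g u"
    unfolding W.products_diverge_def
  proof
    fix Z
    obtain N where N: "\<forall>i\<ge>N. \<forall>j\<ge>N. Z + \<delta> \<le> gp \<one> (u i) (u j)"
      using uG(2) unfolding W.products_diverge_def by blast
    define N' where "N' = max N (nat \<lceil>Z + \<delta>\<rceil>)"
    have "Z \<le> gp \<one> (g i) (u j)" if ij: "i \<ge> N'" "j \<ge> N'" for i j
    proof -
      obtain M where M: "\<forall>m\<ge>M. real i \<le> gp \<one> (g i) (u m)" using g(3) by blast
      define m where "m = max M N"
      have "nat \<lceil>Z + \<delta>\<rceil> \<le> i" using ij by (simp add: N'_def)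
      then have "Z + \<delta> \<le> real i" by linarith
      then have "Z + \<delta> \<le> gp \<one> (g i) (u m)"
        using order_trans[of "Z + \<delta>" "real i" "gp \<one> (g i) (u m)"] M by (simp add: m_def)
      moreover have "Z + \<delta> \<le> gp \<one> (u m) (u j)" using N ij by (simp add: m_def N'_def)
      moreover have "min (gp \<one> (g i) (u m)) (gp \<one> (u m) (u j)) - \<delta> \<le> gp \<one> (g i) (u j)"
        using uG(1) g(1) by (intro W.four_point) auto
      ultimately show ?thesis by linarith
    qed
    then show "\<exists>N. \<forall>i\<ge>N. \<forall>j\<ge>N. Z \<le> gp \<one> (g i) (u j)" by blast
  qed
  have ug: "W.products_diverge \<one> u g" using W.products_diverge_sym[OF gu] .
  have "W.products_diverge \<one> g g" using W.products_diverge_trans[OF _ _ _ _ gu ug] gG uG by simp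
  then have "g \<in> \<xi>" using W.boundary_memI[OF _ \<xi> u] gG ug by simp
  moreover have "(\<lambda>n. slope (g n) - s) \<longlonglongrightarrow> 0"
    by (rule Lim_null_comparison[OF _ LIMSEQ_inverse_real_of_nat])
      (use g(2) in \<open>auto intro!: always_eventually less_imp_le\<close>)
  then have "(\<lambda>n. slope (g n)) \<longlonglongrightarrow> s" by (simp add: LIM_zero_iff)
  ultimately show ?thesis by blast
qed

text \<open>Add the triangle inequalities for \<open>g\<close> and \<open>h\<close> through the
  vertex: its distances to both ends sum to \<open>dG g h\<close>.\<close>

lemma gp_le_len_on_geodesic:
  assumes "discrete_geodesic (word_metric G S) g h \<gamma> L" "g \<in> carrier G" "h \<in> carrier G" "i \<le> L"
  shows "gp \<one> g h \<le> len (\<gamma> i)"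
proof -
  have \<gamma>: "\<gamma> 0 = g" "\<gamma> L = h" "\<gamma> i \<in> carrier G" "dG g (\<gamma> i) = real i" "dG (\<gamma> i) h = real L - real i" "dG g h = real L"
    using assms(1,4) W.discrete_geodesic_dist[OF assms(1)] by (auto simp: discrete_geodesic_def)
  show ?thesis
    using len_ge_diff[of g "\<gamma> i"] len_ge_diff[of h "\<gamma> i"] \<gamma> assms(2,3) mdist_commute[of "word_metric G S" g "\<gamma> i"]
    by (simp add: gromov_product_def)
qed

text \<open>
  A word geodesic between two elements close to the same boundary point stays far from the identity,
  so the slope changes by little in each of its steps and takes on all intermediate values.
\<close>

lemma slopes_interval:
  assumes \<xi>: "\<xi> \<in> bdG" and st: "s \<in> slopes" "t \<in> slopes" "s < r" "r < t"
  shows "r \<in> slopes"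
  unfolding slopes_def
proof (intro CollectI allI impI)
  fix N e :: real assume e: "0 < e"
  obtain u where u: "u \<in> \<xi>" "(\<lambda>n. slope (u n)) \<longlonglongrightarrow> s" using ex_slope_sequence[OF \<xi> st(1)] by blast
  obtain v where v: "v \<in> \<xi>" "(\<lambda>n. slope (v n)) \<longlonglongrightarrow> t" using ex_slope_sequence[OF \<xi> st(2)] by blast
  note uG = A1.boundary_rep_G[OF \<xi> u(1)] and vG = A1.boundary_rep_G[OF \<xi> v(1)]
  define P where "P = 3 * qi / e + 1"
  have P: "0 < P" "3 * qi / P < e"
  proof -
    have "0 \<le> 3 * qi / e" using qi(1) e by simp
    then show "0 < P" by (simp add: P_def)
    then show "3 * qi / P < e" using e by (simp add: P_def field_simps)
  qed
  \<comment> \<open>Gives the length demanded by \<open>slopes\<close> and, through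
    \<open>pnrm_large\<close>, displacement at least \<open>P\<close> all along the
    geodesic.\<close>
  define K where "K = max N (qi * (P + 1))"
  obtain M where M: "\<forall>i\<ge>M. \<forall>j\<ge>M. K \<le> gp \<one> (u i) (v j)"
    using W.boundary_reps_diverge[OF _ \<xi> u(1) v(1)] unfolding W.products_diverge_def W_carrier
    using one_closed by blast
  have "eventually (\<lambda>n. slope (u n) < r) sequentially" using u(2) st(3) by (rule order_tendstoD)
  moreover have "eventually (\<lambda>n. r < slope (v n)) sequentially" using v(2) st(4) by (rule order_tendstoD)
  ultimately have "eventually (\<lambda>n. slope (u n) < r \<and> r < slope (v n) \<and> M \<le> n) sequentially"
    using eventually_ge_at_top[of M] by eventually_elim simp
  then obtain n where n: "slope (u n) < r" "r < slope (v n)" "M \<le> n" by (auto simp: eventually_sequentially)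
  have G: "u n \<in> carrier G" "v n \<in> carrier G" using uG vG by auto
  obtain \<gamma> L where \<gamma>: "discrete_geodesic (word_metric G S) (u n) (v n) \<gamma> L"
    using W.discrete_geodesic_ex[of "u n" "v n"] G by auto
  have g: "\<gamma> 0 = u n" "\<gamma> L = v n" "\<And>i. i \<le> L \<Longrightarrow> \<gamma> i \<in> carrier G"
    "\<And>i. Suc i \<le> L \<Longrightarrow> dG (\<gamma> i) (\<gamma> (Suc i)) = 1"
    using \<gamma> by (auto simp: discrete_geodesic_def)
  have far: "K \<le> len (\<gamma> i)" if "i \<le> L" for i
    using gp_le_len_on_geodesic[OF \<gamma> G that] M n(3) by (meson order_trans)
  \<comment> \<open>The last vertex with slope at most \<open>r\<close>: the next one exceeds
    \<open>r\<close>, and a single step changes the slope by less than \<open>e\<close>.\<close>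
  define i where "i = (GREATEST i. i \<le> L \<and> slope (\<gamma> i) \<le> r)"
  have "0 \<le> L \<and> slope (\<gamma> 0) \<le> r" using n g by simp
  then have i: "i \<le> L" "slope (\<gamma> i) \<le> r" and imax: "\<And>j. j \<le> L \<Longrightarrow> slope (\<gamma> j) \<le> r \<Longrightarrow> j \<le> i"
    using GreatestI_nat[of "\<lambda>i. i \<le> L \<and> slope (\<gamma> i) \<le> r" 0 L]
      Greatest_le_nat[of "\<lambda>i. i \<le> L \<and> slope (\<gamma> i) \<le> r" _ L] unfolding i_def by auto
  have "i \<noteq> L" using i(2) g(2) n(2) by auto
  then have si: "Suc i \<le> L" using i by simp
  have ri: "r < slope (\<gamma> (Suc i))" using imax[OF si] by (meson Suc_n_not_le_n not_le)
  have ic: "\<gamma> i \<in> carrier G" "\<gamma> (Suc i) \<in> carrier G" using g(3) si by auto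
  have Pi: "P \<le> pnrm (\<gamma> i)" "P \<le> pnrm (\<gamma> (Suc i))"
    using pnrm_large(3)[OF ic(1)] pnrm_large(3)[OF ic(2)] far[of i] far[OF si] si by (auto simp: K_def)
  define a where "a = inv (\<gamma> i) \<otimes> \<gamma> (Suc i)"
  have a: "a \<in> carrier G" "len a = 1" using ic dG_len[OF ic] g(4)[OF si] by (auto simp: a_def)
  have da: "mdist X1 (\<phi>1 (\<gamma> i) x1) (\<phi>1 (\<gamma> (Suc i)) x1) \<le> qi" "mdist X2 (\<phi>2 (\<gamma> i) x2) (\<phi>2 (\<gamma> (Suc i)) x2) \<le> qi"
    using A1.orb_dist[OF ic] A2.orb_dist[OF ic] qi(2)[OF a(1)] qi(3)[OF a(1)] a(2) by (auto simp: a_def)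
  have "\<bar>A1.nrm (\<gamma> (Suc i)) - A1.nrm (\<gamma> i)\<bar> \<le> qi"
    using mdist_triangle[of x1 X1 "\<phi>1 (\<gamma> i) x1" "\<phi>1 (\<gamma> (Suc i)) x1"] mdist_triangle[of x1 X1 "\<phi>1 (\<gamma> (Suc i)) x1" "\<phi>1 (\<gamma> i) x1"]
      da(1) A1.x0 ic mdist_commute[of X1 "\<phi>1 (\<gamma> (Suc i)) x1" "\<phi>1 (\<gamma> i) x1"] by simp
  moreover have "\<bar>A2.nrm (\<gamma> (Suc i)) - A2.nrm (\<gamma> i)\<bar> \<le> qi"
    using mdist_triangle[of x2 X2 "\<phi>2 (\<gamma> i) x2" "\<phi>2 (\<gamma> (Suc i)) x2"] mdist_triangle[of x2 X2 "\<phi>2 (\<gamma> (Suc i)) x2" "\<phi>2 (\<gamma> i) x2"]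
      da(2) A2.x0 ic mdist_commute[of X2 "\<phi>2 (\<gamma> (Suc i)) x2" "\<phi>2 (\<gamma> i) x2"] by simp
  ultimately have "\<bar>slope (\<gamma> (Suc i)) - slope (\<gamma> i)\<bar> \<le> 3 * qi / pnrm (\<gamma> i)"
    using Pi P by (intro slope_stable) auto
  also have "\<dots> \<le> 3 * qi / P" using Pi P qi(1) by (intro divide_left_mono) auto
  finally have "\<bar>slope (\<gamma> i) - r\<bar> < e" using P(2) i(2) ri by linarith
  then show "\<exists>g\<in>carrier G. N \<le> len g \<and> \<bar>slope g - r\<bar> < e"
    using ic(1) far[OF i(1)] by (intro bexI[of _ "\<gamma> i"]) (auto simp: K_def)
qed

text \<open>A finite group has no limiting slopes and an empty boundary, while \<open>{a..b}\<close>
  has points; any interval then serves, hence the implication.\<close>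

lemma slopes_segment: "\<exists>a b. a \<le> b \<and> (bdG \<noteq> {} \<longrightarrow> slopes = {a..b})"
proof (cases "bdG = {}")
  case False
  then obtain \<xi> where \<xi>: "\<xi> \<in> bdG" by blast
  have ne: "slopes \<noteq> {}" using slopes_nonempty[OF \<xi>] .
  have bd: "slopes \<subseteq> {0..1}"
  proof
    fix s assume s: "s \<in> slopes"
    obtain k where "0 < k" "k \<le> s" "k\<^sup>2 \<le> 1 - s\<^sup>2" using slopes_pos s by blast
    then have "0 \<le> s" "s\<^sup>2 \<le> 1" by (auto intro: order_trans[of _ "1 - k\<^sup>2"])
    then show "s \<in> {0..1}" by (simp add: abs_square_le_1)
  qed
  then have bdd: "bdd_below slopes" "bdd_above slopes" by (meson bdd_below_Icc bdd_below_mono, meson bdd_above_Icc bdd_above_mono)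
  define a b where "a = Inf slopes" and "b = Sup slopes"
  have ab: "a \<in> slopes" "b \<in> slopes" unfolding a_def b_def
    using closed_contains_Inf closed_contains_Sup ne bdd slopes_closed by auto
  have bnd: "a \<le> s" "s \<le> b" if "s \<in> slopes" for s
    using that bdd by (auto simp: a_def b_def cInf_lower cSup_upper)
  have "slopes = {a..b}"
  proof
    show "slopes \<subseteq> {a..b}" using bnd by auto
    show "{a..b} \<subseteq> slopes"
    proof
      fix r assume "r \<in> {a..b}"
      then consider "r = a" | "r = b" | "a < r" "r < b" by fastforce
      then show "r \<in> slopes" using ab slopes_interval[OF \<xi> ab] by cases auto
    qed
  qed
  then show ?thesis using bnd(2)[OF ab(1)] by blast
qed auto

end

section \<open>Rays in the schmear\<close>

lemma tendsto_zero_le: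
  fixes f g :: "nat \<Rightarrow> real"
  assumes "g \<longlonglongrightarrow> 0" "eventually (\<lambda>n. 0 \<le> f n \<and> f n \<le> g n) sequentially"
  shows "f \<longlonglongrightarrow> 0"
  by (rule Lim_null_comparison[OF _ assms(1)]) (use assms(2) in \<open>auto elim: eventually_mono\<close>)

text \<open>Pointwise limits supply the boundedness condition of \<open>ex_limit_ray\<close>, as
  geodesics eventually within 1 of a limit point are within 2 of each other; uniqueness of limits
  identifies the values.\<close>

lemma (in convex_space) ray_of_limits:
  assumes x0: "x0 \<in> mspace X" and y: "\<And>n. y n \<in> mspace X"
    and far: "filterlim (\<lambda>n. mdist X x0 (y n)) at_top sequentially"
    and l: "\<And>t. 0 \<le> t \<Longrightarrow> l t \<in> mspace X \<and> (\<lambda>n. mdist X (geod X x0 (y n) t) (l t)) \<longlonglongrightarrow> 0"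
  shows "\<exists>\<alpha>. geodesic_ray X \<alpha> \<and> \<alpha> 0 = x0 \<and> converges_to_ray X x0 y \<alpha> \<and> (\<forall>t\<ge>0. \<alpha> t = l t)"
proof -
  have "\<exists>\<alpha>. geodesic_ray X \<alpha> \<and> \<alpha> 0 = x0 \<and> converges_to_ray X x0 y \<alpha>"
  proof (rule ex_limit_ray[OF x0 y, where C = 2])
    fix T :: real assume T: "0 \<le> T"
    have "eventually (\<lambda>n. T \<le> mdist X x0 (y n)) sequentially" using far unfolding filterlim_at_top by blast
    moreover have "eventually (\<lambda>n. mdist X (geod X x0 (y n) T) (l T) < 1) sequentially"
      using l[OF T] by (intro order_tendstoD(2)[of _ 0]) auto
    ultimately have "eventually (\<lambda>n. T \<le> mdist X x0 (y n) \<and> mdist X (geod X x0 (y n) T) (l T) < 1) sequentially"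
      by eventually_elim simp
    then obtain N where N: "\<And>n. n \<ge> N \<Longrightarrow> T \<le> mdist X x0 (y n) \<and> mdist X (geod X x0 (y n) T) (l T) < 1"
      by (auto simp: eventually_sequentially)
    have "T \<le> mdist X x0 (y m) \<and> T \<le> mdist X x0 (y n) \<and> mdist X (geod X x0 (y m) T) (geod X x0 (y n) T) \<le> 2"
      if "m \<ge> N" "n \<ge> N" for m n
    proof -
      have "geod X x0 (y m) T \<in> mspace X" "geod X x0 (y n) T \<in> mspace X"
        using N[OF that(1)] N[OF that(2)] x0 y T by (auto intro!: geod_in)
      then show ?thesis
        using N[OF that(1)] N[OF that(2)] l[OF T] mdist_triangle[of "geod X x0 (y m) T" X "l T" "geod X x0 (y n) T"]
          mdist_commute[of X "l T" "geod X x0 (y n) T"] by auto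
    qed
    then show "\<exists>N. \<forall>m\<ge>N. \<forall>n\<ge>N. T \<le> mdist X x0 (y m) \<and> T \<le> mdist X x0 (y n) \<and>
        mdist X (geod X x0 (y m) T) (geod X x0 (y n) T) \<le> 2" by blast
  qed
  then obtain \<alpha> where \<alpha>: "geodesic_ray X \<alpha>" "\<alpha> 0 = x0" "converges_to_ray X x0 y \<alpha>" by blast
  have "\<alpha> t = l t" if t: "0 \<le> t" for t
    by (rule limit_unique[of "\<lambda>n. geod X x0 (y n) t"])
      (use \<alpha> l[OF t] t geodesic_ray_in[OF \<alpha>(1) t] eventually_geod_in[OF x0 y far t] in \<open>auto simp: converges_to_ray_def\<close>)
  then show ?thesis using \<alpha> by blast
qed

lemma (in convex_space) openin_visual_ball:
  assumes x0: "x0 \<in> mspace X" and r: "0 < r" and p: "p \<in> mspace X"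
  shows "openin (visual_topology X x0) {\<zeta> \<in> visual_boundary X. mdist X (ray_from X x0 \<zeta> r) p < e}"
  unfolding openin_visual_iff[OF x0]
proof (intro conjI ballI)
  fix \<zeta> assume \<zeta>: "\<zeta> \<in> {\<zeta> \<in> visual_boundary X. mdist X (ray_from X x0 \<zeta> r) p < e}"
  define e' where "e' = e - mdist X (ray_from X x0 \<zeta> r) p"
  have M: "ray_from X x0 \<eta> r \<in> mspace X" if "\<eta> \<in> visual_boundary X" for \<eta>
    using geodesic_ray_in[OF ray_from(3)[OF x0 that]] r by simp
  have "mdist X (ray_from X x0 \<eta> r) p < e"
    if "\<eta> \<in> visual_boundary X" "mdist X (ray_from X x0 \<eta> r) (ray_from X x0 \<zeta> r) < e'" for \<eta>
    using mdist_triangle[of "ray_from X x0 \<eta> r" X "ray_from X x0 \<zeta> r" p] M[OF that(1)] M[of \<zeta>] \<zeta> p that(2)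
    by (auto simp: e'_def)
  moreover have "0 < e'" using \<zeta> by (simp add: e'_def)
  ultimately show "\<exists>r'>0. \<exists>e'>0. \<forall>\<eta>\<in>visual_boundary X. mdist X (ray_from X x0 \<eta> r') (ray_from X x0 \<zeta> r') < e' \<longrightarrow>
      \<eta> \<in> {\<zeta> \<in> visual_boundary X. mdist X (ray_from X x0 \<zeta> r) p < e}"
    using r by (intro exI[of _ r] exI[of _ e'] conjI) auto
qed auto

context geometric_action
begin

text \<open>In the product, a factor geodesic is evaluated at a fixed time multiplied by a slope
  that varies with the element. Geodesics are 1-Lipschitz, so a convergent time is as good as a
  constant one.\<close>

lemma moving_point_tendsto:
  assumes u: "range u \<subseteq> carrier G" "to_ray u \<alpha>" and \<alpha>: "geodesic_ray X \<alpha>" and a: "a \<longlonglongrightarrow> c" "0 \<le> c"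
    and ev: "eventually (\<lambda>n. 0 \<le> a n \<and> a n \<le> nrm (u n)) sequentially"
  shows "(\<lambda>n. dX (sg (u n) (a n)) (\<alpha> c)) \<longlonglongrightarrow> 0"
proof -
  have far: "eventually (\<lambda>n. c \<le> nrm (u n)) sequentially"
    using u(2) by (auto simp: converges_to_ray_def filterlim_at_top)
  have "(\<lambda>n. \<bar>a n - c\<bar> + dX (sg (u n) c) (\<alpha> c)) \<longlonglongrightarrow> \<bar>c - c\<bar> + 0"
    using u(2) a by (intro tendsto_intros) (auto simp: converges_to_ray_def)
  then have lim: "(\<lambda>n. \<bar>a n - c\<bar> + dX (sg (u n) c) (\<alpha> c)) \<longlonglongrightarrow> 0" by simp
  have "eventually (\<lambda>n. norm (dX (sg (u n) (a n)) (\<alpha> c)) \<le> \<bar>a n - c\<bar> + dX (sg (u n) c) (\<alpha> c)) sequentially"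
    using ev far
  proof eventually_elim
    case (elim n)
    have "u n \<in> carrier G" using u(1) by auto
    then have M: "orb (u n) \<in> mspace X" by simp
    have "dX (sg (u n) (a n)) (sg (u n) c) = \<bar>a n - c\<bar>"
      using elim a(2) x0 M by (intro geod_dist) auto
    then show ?case
      using mdist_triangle[of "sg (u n) (a n)" X "sg (u n) c" "\<alpha> c"] geodesic_ray_in[OF \<alpha> a(2)]
        geod_in[OF x0 M, of "a n"] geod_in[OF x0 M a(2)] elim by simp
  qed
  then show ?thesis using lim by (rule Lim_null_comparison)
qed

text \<open>Basic Gromov neighbourhoods need not be open, so openness is checked at each point with
  a radius from \<open>bray_continuous\<close>.\<close>

lemma openin_bray_ball:
  assumes r: "0 \<le> r" and p: "p \<in> mspace X"
  shows "openin (gromov_topology (word_metric G S) \<one>) {\<eta> \<in> bdG. dX (bray \<eta> r) p < e}"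
  unfolding openin_gromov_topology
proof (intro conjI ballI)
  fix \<xi> assume \<xi>: "\<xi> \<in> {\<eta> \<in> bdG. dX (bray \<eta> r) p < e}"
  then have "0 < e - dX (bray \<xi> r) p" by simp
  then obtain R where R: "\<forall>\<xi>\<in>bdG. \<forall>\<eta>\<in>gromov_nbhd (word_metric G S) \<one> \<xi> R. dX (bray \<xi> r) (bray \<eta> r) < e - dX (bray \<xi>' r) p"
    if "\<xi>' = \<xi>" for \<xi>'
    using bray_continuous[OF r] by metis
  have "\<eta> \<in> {\<eta> \<in> bdG. dX (bray \<eta> r) p < e}" if \<eta>: "\<eta> \<in> gromov_nbhd (word_metric G S) \<one> \<xi> R" for \<eta>
  proof -
    have "\<eta> \<in> bdG" using \<eta> by (simp add: gromov_nbhd_def)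
    moreover have "dX (bray \<xi> r) (bray \<eta> r) < e - dX (bray \<xi> r) p" using R[OF refl] \<eta> \<xi> by blast
    ultimately show ?thesis
      using mdist_triangle[of "bray \<eta> r" X "bray \<xi> r" p] bray_in[of \<eta> r] bray_in[of \<xi> r] \<xi> r p
        mdist_commute[of X "bray \<xi> r" "bray \<eta> r"] by simp
  qed
  then show "\<exists>R. gromov_nbhd (word_metric G S) \<one> \<xi> R \<subseteq> {\<eta> \<in> bdG. dX (bray \<eta> r) p < e}" by blast
qed auto

text \<open>The speed of \<beta> is \<open>s\<close>, read off between times 0 and 1, so the
  rescaling in \<open>endpoint\<close> returns the ray itself.\<close>

lemma endpoint_bray:
  assumes \<xi>: "\<xi> \<in> bdG" and s: "0 < s" and \<beta>: "\<And>t. 0 \<le> t \<Longrightarrow> \<beta> t = bray \<xi> (s * t)"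
  shows "endpoint X \<beta> = orbit_boundary_map X \<phi> x0 \<xi>"
proof -
  note b = bray[OF \<xi>]
  have "mdist X (\<beta> 0) (\<beta> 1) = s" using geodesic_ray_dist[OF b(1), of 0 s] \<beta>[of 0] \<beta>[of 1] s by simp
  then have "(\<lambda>t\<in>{0..}. \<beta> (t / mdist X (\<beta> 0) (\<beta> 1))) = (\<lambda>t\<in>{0..}. bray \<xi> t)"
    using s by (auto simp: fun_eq_iff \<beta>)
  also have "\<dots> = bray \<xi>"
    using b(1) unfolding geodesic_ray_def by (auto simp: fun_eq_iff PiE_def extensional_def)
  finally show ?thesis by (simp add: endpoint_def b(3))
qed

end

context geometric_pair
begin

sublocale P: convex_space "prod_metric X1 X2"
  by (rule convex_space_prod) unfold_locales

abbreviation "dP \<equiv> mdist (prod_metric X1 X2)"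
abbreviation "porb g \<equiv> (\<phi>1 g x1, \<phi>2 g x2)"

section \<open>Orbit geodesics and rays of the product\<close>

lemma xP: "(x1, x2) \<in> mspace (prod_metric X1 X2)"
  using A1.x0 A2.x0 by simp

lemma pnrm_dist: "dP (x1, x2) (porb g) = pnrm g"
  by (simp add: prod_dist_def pnrm_def)

lemma dP_le: "dP p q \<le> mdist X1 (fst p) (fst q) + mdist X2 (snd p) (snd q)"
  by (simp add: prod_dist_def case_prod_unfold sqrt_sum_squares_le_sum)

lemma dP_ge: "mdist X1 (fst p) (fst q) \<le> dP p q" "mdist X2 (snd p) (snd q) \<le> dP p q"
  by (auto simp: prod_dist_def case_prod_unfold intro: real_le_rsqrt)

text \<open>The speed in the second factor of a unit speed ray that has speed \<open>s\<close> in
  the first.\<close>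

definition co :: "real \<Rightarrow> real" where
  "co s = sqrt (1 - s\<^sup>2)"

lemma slopes_range:
  assumes "s \<in> slopes"
  shows "0 < s" "s \<le> 1" "0 < co s" "s\<^sup>2 + (co s)\<^sup>2 = 1"
proof -
  obtain k where k: "0 < k" "k \<le> s" "k\<^sup>2 \<le> 1 - s\<^sup>2" using slopes_pos assms by blast
  then show "0 < s" by simp
  have "0 < 1 - s\<^sup>2" using k zero_less_power[of k 2] by linarith
  then show "0 < co s" "s\<^sup>2 + (co s)\<^sup>2 = 1" by (auto simp: co_def)
  have "s\<^sup>2 \<le> 1" using \<open>0 < 1 - s\<^sup>2\<close> by simp
  then show "s \<le> 1" using \<open>0 < s\<close> by (simp add: abs_square_le_1)
qed

lemma co_slope: "0 < pnrm g \<Longrightarrow> co (slope g) = A2.nrm g / pnrm g"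
  using slope_sq[of g] pnrm_ge[of g] unfolding co_def by (intro real_sqrt_unique) auto

lemma geod_porb:
  assumes g: "g \<in> carrier G" and r: "0 \<le> r" "r \<le> pnrm g" "0 < pnrm g"
  shows "geod (prod_metric X1 X2) (x1, x2) (porb g) r = (A1.sg g (r * slope g), A2.sg g (r * co (slope g)))"
  using geod_prod[OF A1.convex_space_axioms A2.convex_space_axioms A1.x0 A1.orb_in[OF g] A2.x0 A2.orb_in[OF g]
      pnrm_dist[symmetric] r(3,1,2)] co_slope[OF r(3)] by (simp add: slope_def)

lemma scaled_le_nrm:
  assumes r: "0 \<le> r" "r \<le> pnrm g" "0 < pnrm g"
  shows "0 \<le> r * slope g" "r * slope g \<le> A1.nrm g" "0 \<le> r * co (slope g)" "r * co (slope g) \<le> A2.nrm g"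
proof -
  show "0 \<le> r * slope g" using r slope_bounds by simp
  show "0 \<le> r * co (slope g)" using r co_slope[OF r(3)] by simp
  have "r * A1.nrm g \<le> pnrm g * A1.nrm g" "r * A2.nrm g \<le> pnrm g * A2.nrm g" using r by (auto intro!: mult_right_mono)
  then show "r * slope g \<le> A1.nrm g" "r * co (slope g) \<le> A2.nrm g"
    unfolding co_slope[OF r(3)] using r(3) by (auto simp: slope_def field_simps)
qed

definition pray :: "(nat \<Rightarrow> 'g) set \<Rightarrow> real \<Rightarrow> real \<Rightarrow> 'a \<times> 'b" where
  "pray \<xi> s = (\<lambda>t\<in>{0..}. (A1.bray \<xi> (s * t), A2.bray \<xi> (co s * t)))"

lemma pray_ray:
  assumes \<xi>: "\<xi> \<in> bdG" and s: "s \<in> slopes"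
  shows "geodesic_ray (prod_metric X1 X2) (pray \<xi> s)" "pray \<xi> s 0 = (x1, x2)"
proof -
  note sr = slopes_range[OF s]
  show "pray \<xi> s 0 = (x1, x2)" using A1.bray(2)[OF \<xi>] A2.bray(2)[OF \<xi>] by (simp add: pray_def)
  show "geodesic_ray (prod_metric X1 X2) (pray \<xi> s)"
    unfolding geodesic_ray_def
  proof (intro conjI allI impI)
    show "pray \<xi> s \<in> {0..} \<rightarrow>\<^sub>E mspace (prod_metric X1 X2)"
      using sr A1.bray_in[OF \<xi>] A2.bray_in[OF \<xi>] by (auto simp: pray_def)
    fix t t' :: real assume t: "0 \<le> t" "0 \<le> t'"
    have "mdist X1 (A1.bray \<xi> (s * t)) (A1.bray \<xi> (s * t')) = \<bar>s * t - s * t'\<bar>"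
      using geodesic_ray_dist[OF A1.bray(1)[OF \<xi>]] t sr by simp
    also have "\<dots> = s * \<bar>t - t'\<bar>" using sr(1) by (simp add: abs_mult flip: right_diff_distrib)
    finally have 1: "mdist X1 (A1.bray \<xi> (s * t)) (A1.bray \<xi> (s * t')) = s * \<bar>t - t'\<bar>" .
    have "mdist X2 (A2.bray \<xi> (co s * t)) (A2.bray \<xi> (co s * t')) = \<bar>co s * t - co s * t'\<bar>"
      using geodesic_ray_dist[OF A2.bray(1)[OF \<xi>]] t sr by simp
    also have "\<dots> = co s * \<bar>t - t'\<bar>" using sr(3) by (simp add: abs_mult flip: right_diff_distrib)
    finally have 2: "mdist X2 (A2.bray \<xi> (co s * t)) (A2.bray \<xi> (co s * t')) = co s * \<bar>t - t'\<bar>" .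
    have "(s * \<bar>t - t'\<bar>)\<^sup>2 + (co s * \<bar>t - t'\<bar>)\<^sup>2 = (s\<^sup>2 + (co s)\<^sup>2) * (t - t')\<^sup>2"
      by (simp add: power_mult_distrib distrib_right)
    then show "dP (pray \<xi> s t) (pray \<xi> s t') = \<bar>t - t'\<bar>"
      using t sr(4) by (simp add: pray_def prod_dist_def 1 2)
  qed
qed

text \<open>Factor by factor, the geodesic to the orbit point is evaluated at times converging to
  those of the limit ray; the distance in the product is at most the sum of the two.\<close>

lemma pray_converges:
  assumes \<xi>: "\<xi> \<in> bdG" and s: "s \<in> slopes" and u: "u \<in> \<xi>" and lim: "(\<lambda>n. slope (u n)) \<longlonglongrightarrow> s"
  shows "converges_to_ray (prod_metric X1 X2) (x1, x2) (\<lambda>n. porb (u n)) (pray \<xi> s)"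
  unfolding converges_to_ray_def pnrm_dist
proof (intro conjI allI impI)
  note uG = A1.boundary_rep_G(1)[OF \<xi> u]
  have "filterlim (\<lambda>n. A1.nrm (u n)) at_top sequentially" using A1.bray(4)[OF \<xi> u] by (simp add: converges_to_ray_def)
  then show far: "filterlim (\<lambda>n. pnrm (u n)) at_top sequentially"
    by (rule filterlim_at_top_mono) (simp add: pnrm_ge)
  fix r :: real assume r: "0 \<le> r"
  have ev: "eventually (\<lambda>n. max r 1 \<le> pnrm (u n)) sequentially" using far unfolding filterlim_at_top by blast
  have lim2: "(\<lambda>n. co (slope (u n))) \<longlonglongrightarrow> co s" unfolding co_def by (intro tendsto_intros lim)
  have c1: "(\<lambda>n. mdist X1 (A1.sg (u n) (r * slope (u n))) (A1.bray \<xi> (r * s))) \<longlonglongrightarrow> 0"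
  proof (rule A1.moving_point_tendsto[OF uG A1.bray(4)[OF \<xi> u] A1.bray(1)[OF \<xi>]])
    show "eventually (\<lambda>n. 0 \<le> r * slope (u n) \<and> r * slope (u n) \<le> A1.nrm (u n)) sequentially"
      using ev by eventually_elim (use r scaled_le_nrm(1,2) in auto)
  qed (use r lim slopes_range(1)[OF s] in \<open>auto intro!: tendsto_intros\<close>)
  have c2: "(\<lambda>n. mdist X2 (A2.sg (u n) (r * co (slope (u n)))) (A2.bray \<xi> (r * co s))) \<longlonglongrightarrow> 0"
  proof (rule A2.moving_point_tendsto[OF uG A2.bray(4)[OF \<xi> u] A2.bray(1)[OF \<xi>]])
    show "eventually (\<lambda>n. 0 \<le> r * co (slope (u n)) \<and> r * co (slope (u n)) \<le> A2.nrm (u n)) sequentially"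
      using ev by eventually_elim (use r scaled_le_nrm(3,4) in auto)
  qed (use r lim2 slopes_range(3)[OF s] in \<open>auto intro!: tendsto_intros\<close>)
  have "eventually (\<lambda>n. norm (dP (geod (prod_metric X1 X2) (x1, x2) (porb (u n)) r) (pray \<xi> s r)) \<le>
      mdist X1 (A1.sg (u n) (r * slope (u n))) (A1.bray \<xi> (r * s)) +
      mdist X2 (A2.sg (u n) (r * co (slope (u n)))) (A2.bray \<xi> (r * co s))) sequentially"
    using ev
  proof eventually_elim
    case (elim n)
    have "u n \<in> carrier G" using uG by auto
    then have "geod (prod_metric X1 X2) (x1, x2) (porb (u n)) r = (A1.sg (u n) (r * slope (u n)), A2.sg (u n) (r * co (slope (u n))))"
      using elim r by (intro geod_porb) auto
    then show ?case
      using dP_le[of "geod (prod_metric X1 X2) (x1, x2) (porb (u n)) r" "pray \<xi> s r"] r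
      by (simp add: pray_def mult.commute del: mdist_prod_metric)
  qed
  moreover have "(\<lambda>n. mdist X1 (A1.sg (u n) (r * slope (u n))) (A1.bray \<xi> (r * s)) +
      mdist X2 (A2.sg (u n) (r * co (slope (u n)))) (A2.bray \<xi> (r * co s))) \<longlonglongrightarrow> 0"
    using tendsto_add[OF c1 c2] by simp
  ultimately show "(\<lambda>n. dP (geod (prod_metric X1 X2) (x1, x2) (porb (u n)) r) (pray \<xi> s r)) \<longlonglongrightarrow> 0"
    by (rule Lim_null_comparison)
qed

text \<open>The slopes converge without passing to a subsequence, because the slope of
  \<open>g n\<close> is the distance from \<open>x1\<close> to the first component of its geodesic
  at time 1. Both limiting speeds are positive, so rescaling time gives convergence in each factor.
  The boundary point found from \<open>X1\<close> also serves \<open>X2\<close>, being a class of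
  sequences in \<open>G\<close>.\<close>

lemma pray_if_converges:
  assumes g: "range g \<subseteq> carrier G" and \<alpha>: "geodesic_ray (prod_metric X1 X2) \<alpha>"
    and conv: "converges_to_ray (prod_metric X1 X2) (x1, x2) (\<lambda>n. porb (g n)) \<alpha>"
  shows "\<exists>\<xi>\<in>bdG. \<exists>s\<in>slopes. \<alpha> = pray \<xi> s"
proof -
  have gG: "g n \<in> carrier G" for n using g by auto
  have far: "filterlim (\<lambda>n. pnrm (g n)) at_top sequentially"
    using conv unfolding converges_to_ray_def pnrm_dist by blast
  have \<alpha>M: "fst (\<alpha> r) \<in> mspace X1" "snd (\<alpha> r) \<in> mspace X2" if "0 \<le> r" for r
    using geodesic_ray_in[OF \<alpha> that] by (auto simp: mem_Times_iff)
  have lenfar: "filterlim (\<lambda>n. len (g n)) at_top sequentially"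
    unfolding filterlim_at_top
  proof
    fix Z
    have "eventually (\<lambda>n. 2 * qi * Z \<le> pnrm (g n)) sequentially" using far unfolding filterlim_at_top by blast
    then show "eventually (\<lambda>n. Z \<le> len (g n)) sequentially"
    proof eventually_elim
      case (elim n)
      have "pnrm (g n) \<le> A1.nrm (g n) + A2.nrm (g n)"
        using sqrt_sum_squares_le_sum[of "A1.nrm (g n)" "A2.nrm (g n)"] by (simp add: pnrm_def)
      then have "2 * qi * Z \<le> 2 * qi * len (g n)" using elim qi(2,3)[OF gG[of n]] by linarith
      then show ?case using qi(1) by simp
    qed
  qed
  have ev: "eventually (\<lambda>n. max r 1 \<le> pnrm (g n)) sequentially" for r
    using far unfolding filterlim_at_top by blast
  have c: "(\<lambda>n. mdist X1 (A1.sg (g n) (r * slope (g n))) (fst (\<alpha> r))) \<longlonglongrightarrow> 0 \<and>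
      (\<lambda>n. mdist X2 (A2.sg (g n) (r * co (slope (g n)))) (snd (\<alpha> r))) \<longlonglongrightarrow> 0" if r: "0 \<le> r" for r
  proof -
    have lim: "(\<lambda>n. dP (geod (prod_metric X1 X2) (x1, x2) (porb (g n)) r) (\<alpha> r)) \<longlonglongrightarrow> 0"
      using conv r unfolding converges_to_ray_def by blast
    have "eventually (\<lambda>n. geod (prod_metric X1 X2) (x1, x2) (porb (g n)) r = (A1.sg (g n) (r * slope (g n)), A2.sg (g n) (r * co (slope (g n))))) sequentially"
      using ev[of r] by eventually_elim (use gG r in \<open>auto intro!: geod_porb\<close>)
    then have "eventually (\<lambda>n. mdist X1 (A1.sg (g n) (r * slope (g n))) (fst (\<alpha> r)) \<le> dP (geod (prod_metric X1 X2) (x1, x2) (porb (g n)) r) (\<alpha> r) \<and>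
       mdist X2 (A2.sg (g n) (r * co (slope (g n)))) (snd (\<alpha> r)) \<le> dP (geod (prod_metric X1 X2) (x1, x2) (porb (g n)) r) (\<alpha> r)) sequentially"
      by eventually_elim (metis dP_ge fst_conv snd_conv)
    then show ?thesis
      by (intro conjI tendsto_zero_le[OF lim]) (auto elim: eventually_mono)
  qed
  \<comment> \<open>The candidate for the speed of the first component, read off at time 1.\<close>
  define s where "s = mdist X1 x1 (fst (\<alpha> 1))"
  have slim: "(\<lambda>n. slope (g n)) \<longlonglongrightarrow> s"
  proof -
    have "eventually (\<lambda>n. norm (slope (g n) - s) \<le> mdist X1 (A1.sg (g n) (1 * slope (g n))) (fst (\<alpha> 1))) sequentially"
      using ev[of 1]
    proof eventually_elim
      case (elim n)
      have sl: "0 \<le> 1 * slope (g n)" "1 * slope (g n) \<le> A1.nrm (g n)" using scaled_le_nrm[of 1 "g n"] elim by auto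
      have "mdist X1 x1 (A1.sg (g n) (1 * slope (g n))) = slope (g n)"
        using A1.geod_dist[OF A1.x0 A1.orb_in[OF gG], of 0 n "1 * slope (g n)"] sl A1.x0 gG[of n] by simp
      then show ?case
        using A1.geod_in[OF A1.x0 A1.orb_in[OF gG] sl] \<alpha>M[of 1] A1.x0
          mdist_triangle[of x1 X1 "A1.sg (g n) (1 * slope (g n))" "fst (\<alpha> 1)"]
          mdist_triangle[of x1 X1 "fst (\<alpha> 1)" "A1.sg (g n) (1 * slope (g n))"]
          mdist_commute[of X1 "fst (\<alpha> 1)" "A1.sg (g n) (1 * slope (g n))"]
        by (simp add: s_def abs_le_iff)
    qed
    then have "(\<lambda>n. slope (g n) - s) \<longlonglongrightarrow> 0" 
      by (rule Lim_null_comparison) (use conjunct1[OF c[of 1]] in simp)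
    then show ?thesis by (simp add: LIM_zero_iff)
  qed
  have s: "s \<in> slopes" by (rule slopesI[OF g lenfar slim])
  note sr = slopes_range[OF s]
  have colim: "(\<lambda>n. co (slope (g n))) \<longlonglongrightarrow> co s" unfolding co_def by (intro tendsto_intros slim)
  have far1: "filterlim (\<lambda>n. A1.nrm (g n)) at_top sequentially" "filterlim (\<lambda>n. A2.nrm (g n)) at_top sequentially"
    unfolding filterlim_at_top
  proof safe
    fix Z
    have "eventually (\<lambda>n. qi * (Z + 1) \<le> len (g n)) sequentially" using lenfar unfolding filterlim_at_top by blast
    then show "eventually (\<lambda>n. Z \<le> A1.nrm (g n)) sequentially" "eventually (\<lambda>n. Z \<le> A2.nrm (g n)) sequentially"
      using pnrm_large gG by (auto elim: eventually_mono)
  qed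
  \<comment> \<open>Time \<open>t\<close> in \<open>X1\<close> corresponds to time t / s in the
    product; the mismatch between \<open>t\<close> and t / s times the slope of \<open>g n\<close>
    tends to 0.\<close>
  have l1: "fst (\<alpha> (t / s)) \<in> mspace X1 \<and> (\<lambda>n. mdist X1 (A1.sg (g n) t) (fst (\<alpha> (t / s)))) \<longlonglongrightarrow> 0" if t: "0 \<le> t" for t
  proof
    have ts: "0 \<le> t / s" using t sr by simp
    show "fst (\<alpha> (t / s)) \<in> mspace X1" using \<alpha>M[OF ts] by simp
    have "(\<lambda>n. \<bar>t - t / s * slope (g n)\<bar> + mdist X1 (A1.sg (g n) (t / s * slope (g n))) (fst (\<alpha> (t / s)))) \<longlonglongrightarrow> \<bar>t - t / s * s\<bar> + 0"
      using c[OF ts] by (intro tendsto_intros slim) auto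
    then have lim: "(\<lambda>n. \<bar>t - t / s * slope (g n)\<bar> + mdist X1 (A1.sg (g n) (t / s * slope (g n))) (fst (\<alpha> (t / s)))) \<longlonglongrightarrow> 0"
      using sr by simp
    have "eventually (\<lambda>n. t \<le> A1.nrm (g n)) sequentially" using far1(1) unfolding filterlim_at_top by blast
    then have "eventually (\<lambda>n. 0 \<le> mdist X1 (A1.sg (g n) t) (fst (\<alpha> (t / s))) \<and>
      mdist X1 (A1.sg (g n) t) (fst (\<alpha> (t / s))) \<le>
        \<bar>t - t / s * slope (g n)\<bar> + mdist X1 (A1.sg (g n) (t / s * slope (g n))) (fst (\<alpha> (t / s)))) sequentially"
      using ev[of "t / s"]
    proof eventually_elim
      case (elim n)
      have sl: "0 \<le> t / s * slope (g n)" "t / s * slope (g n) \<le> A1.nrm (g n)"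
        using scaled_le_nrm[OF ts, of "g n"] elim by auto
      show ?case
        using A1.geod_dist[OF A1.x0 A1.orb_in[OF gG] t _ sl] A1.geod_in[OF A1.x0 A1.orb_in[OF gG] sl]
          A1.geod_in[OF A1.x0 A1.orb_in[OF gG] t] elim \<alpha>M[OF ts]
          mdist_triangle[of "A1.sg (g n) t" X1 "A1.sg (g n) (t / s * slope (g n))" "fst (\<alpha> (t / s))"] by simp
    qed
    then show "(\<lambda>n. mdist X1 (A1.sg (g n) t) (fst (\<alpha> (t / s)))) \<longlonglongrightarrow> 0"
      by (rule tendsto_zero_le[OF lim])
  qed
  have l2: "snd (\<alpha> (t / co s)) \<in> mspace X2 \<and> (\<lambda>n. mdist X2 (A2.sg (g n) t) (snd (\<alpha> (t / co s)))) \<longlonglongrightarrow> 0" if t: "0 \<le> t" for t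
  proof
    have ts: "0 \<le> t / co s" using t sr by simp
    show "snd (\<alpha> (t / co s)) \<in> mspace X2" using \<alpha>M[OF ts] by simp
    have "(\<lambda>n. \<bar>t - t / co s * co (slope (g n))\<bar> + mdist X2 (A2.sg (g n) (t / co s * co (slope (g n)))) (snd (\<alpha> (t / co s)))) \<longlonglongrightarrow> \<bar>t - t / co s * co s\<bar> + 0"
      using c[OF ts] by (intro tendsto_intros colim) auto
    then have lim: "(\<lambda>n. \<bar>t - t / co s * co (slope (g n))\<bar> + mdist X2 (A2.sg (g n) (t / co s * co (slope (g n)))) (snd (\<alpha> (t / co s)))) \<longlonglongrightarrow> 0"
      using sr by simp
    have "eventually (\<lambda>n. t \<le> A2.nrm (g n)) sequentially" using far1(2) unfolding filterlim_at_top by blast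
    then have "eventually (\<lambda>n. 0 \<le> mdist X2 (A2.sg (g n) t) (snd (\<alpha> (t / co s))) \<and>
      mdist X2 (A2.sg (g n) t) (snd (\<alpha> (t / co s))) \<le>
        \<bar>t - t / co s * co (slope (g n))\<bar> + mdist X2 (A2.sg (g n) (t / co s * co (slope (g n)))) (snd (\<alpha> (t / co s)))) sequentially"
      using ev[of "t / co s"]
    proof eventually_elim
      case (elim n)
      have sl: "0 \<le> t / co s * co (slope (g n))" "t / co s * co (slope (g n)) \<le> A2.nrm (g n)"
        using scaled_le_nrm[OF ts, of "g n"] elim by auto
      show ?case
        using A2.geod_dist[OF A2.x0 A2.orb_in[OF gG] t _ sl] A2.geod_in[OF A2.x0 A2.orb_in[OF gG] sl]
          A2.geod_in[OF A2.x0 A2.orb_in[OF gG] t] elim \<alpha>M[OF ts]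
          mdist_triangle[of "A2.sg (g n) t" X2 "A2.sg (g n) (t / co s * co (slope (g n)))" "snd (\<alpha> (t / co s))"] by simp
    qed
    then show "(\<lambda>n. mdist X2 (A2.sg (g n) t) (snd (\<alpha> (t / co s)))) \<longlonglongrightarrow> 0"
      by (rule tendsto_zero_le[OF lim])
  qed
  obtain \<alpha>1 where a1: "geodesic_ray X1 \<alpha>1" "A1.to_ray g \<alpha>1" "\<And>t. 0 \<le> t \<Longrightarrow> \<alpha>1 t = fst (\<alpha> (t / s))"
    using A1.ray_of_limits[OF A1.x0 A1.orb_seq_in[OF g] far1(1) l1] by blast
  obtain \<alpha>2 where a2: "geodesic_ray X2 \<alpha>2" "A2.to_ray g \<alpha>2" "\<And>t. 0 \<le> t \<Longrightarrow> \<alpha>2 t = snd (\<alpha> (t / co s))"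
    using A2.ray_of_limits[OF A2.x0 A2.orb_seq_in[OF g] far1(2) l2] by blast
  obtain \<xi> where \<xi>: "\<xi> \<in> bdG" "g \<in> \<xi>" "A1.bray \<xi> = \<alpha>1"
    using A1.to_ray_boundary_point[OF g a1(2,1)] by blast
  have b2: "A2.bray \<xi> = \<alpha>2" using A2.bray_eqI[OF \<xi>(1,2) a2(1,2)] .
  have "\<alpha> = pray \<xi> s"
  proof (rule geodesic_ray_eqI[OF \<alpha> pray_ray(1)[OF \<xi>(1) s]])
    fix t :: real assume t: "0 \<le> t"
    then show "\<alpha> t = pray \<xi> s t"
      using a1(3)[of "s * t"] a2(3)[of "co s * t"] sr by (simp add: pray_def \<xi>(3) b2 prod_eq_iff)
  qed
  then show ?thesis using \<xi>(1) s by blast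
qed

section \<open>The parametrization of the schmear by boundary points and slopes\<close>

definition pclass :: "(nat \<Rightarrow> 'g) set \<times> real \<Rightarrow> (real \<Rightarrow> 'a \<times> 'b) set" where
  "pclass z = asymptotic (prod_metric X1 X2) `` {pray (fst z) (snd z)}"

lemma pclass:
  assumes "\<xi> \<in> bdG" "s \<in> slopes"
  shows "pclass (\<xi>, s) \<in> visual_boundary (prod_metric X1 X2)"
    "ray_from (prod_metric X1 X2) (x1, x2) (pclass (\<xi>, s)) = pray \<xi> s"
  using pray_ray[OF assms] P.class_in_boundary P.ray_from_class by (simp_all add: pclass_def)

text \<open>Closure points are limits of sequences in the orbit, to which
  \<open>pray_if_converges\<close> applies; conversely, \<open>ex_slope_sequence\<close> realizes
  any boundary point and any limiting slope by one sequence.\<close>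

lemma schmear_iff: "\<zeta> \<in> schmear G X1 \<phi>1 x1 X2 \<phi>2 x2 \<longleftrightarrow> (\<exists>\<xi>\<in>bdG. \<exists>s\<in>slopes. \<zeta> = pclass (\<xi>, s))"
proof -
  have orb: "orbit G (diagonal_action \<phi>1 \<phi>2) (x1, x2) = porb ` carrier G"
    by (auto simp: orbit_def diagonal_action_def)
  have sub: "porb ` carrier G \<subseteq> mspace (prod_metric X1 X2)" by auto
  show ?thesis
  proof
    assume "\<zeta> \<in> schmear G X1 \<phi>1 x1 X2 \<phi>2 x2"
    then have z: "\<zeta> \<in> visual_boundary (prod_metric X1 X2)" and cl: "Inr \<zeta> \<in> cone_topology (prod_metric X1 X2) (x1, x2) closure_of (Inl ` (porb ` carrier G))"
      by (auto simp: schmear_def orb)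
    obtain y where y: "range y \<subseteq> porb ` carrier G" "converges_to_ray (prod_metric X1 X2) (x1, x2) y (ray_from (prod_metric X1 X2) (x1, x2) \<zeta>)"
      using P.in_closure_iff[OF xP sub z] cl by blast
    have "\<exists>k. k \<in> carrier G \<and> y n = porb k" for n
    proof -
      have "y n \<in> porb ` carrier G" using y(1) by (rule subsetD) (rule rangeI)
      then show ?thesis by (elim imageE) blast
    qed
    then obtain g where g: "\<And>n. g n \<in> carrier G" "\<And>n. y n = porb (g n)" by metis
    have gG: "range g \<subseteq> carrier G" using g(1) by auto
    have "y = (\<lambda>n. porb (g n))" using g(2) by auto
    then obtain \<xi> s where "\<xi> \<in> bdG" "s \<in> slopes" "ray_from (prod_metric X1 X2) (x1, x2) \<zeta> = pray \<xi> s"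
      using pray_if_converges[OF gG P.ray_from(3)[OF xP z]] y(2) by auto
    then show "\<exists>\<xi>\<in>bdG. \<exists>s\<in>slopes. \<zeta> = pclass (\<xi>, s)"
      using P.ray_from(4)[OF xP z] by (auto simp: pclass_def)
  next
    assume "\<exists>\<xi>\<in>bdG. \<exists>s\<in>slopes. \<zeta> = pclass (\<xi>, s)"
    then obtain \<xi> s where \<xi>: "\<xi> \<in> bdG" "s \<in> slopes" "\<zeta> = pclass (\<xi>, s)" by blast
    obtain u where u: "u \<in> \<xi>" "(\<lambda>n. slope (u n)) \<longlonglongrightarrow> s" using ex_slope_sequence[OF \<xi>(1,2)] by blast
    have "converges_to_ray (prod_metric X1 X2) (x1, x2) (\<lambda>n. porb (u n)) (ray_from (prod_metric X1 X2) (x1, x2) \<zeta>)"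
      using pray_converges[OF \<xi>(1,2) u] pclass(2)[OF \<xi>(1,2)] \<xi>(3) by simp
    moreover have "range (\<lambda>n. porb (u n)) \<subseteq> porb ` carrier G" using A1.boundary_rep_G(1)[OF \<xi>(1) u(1)] by auto
    ultimately have "Inr \<zeta> \<in> cone_topology (prod_metric X1 X2) (x1, x2) closure_of (Inl ` (porb ` carrier G))"
      using P.in_closure_iff[OF xP sub] pclass(1)[OF \<xi>(1,2)] \<xi>(3) by blast
    then show "\<zeta> \<in> schmear G X1 \<phi>1 x1 X2 \<phi>2 x2"
      using pclass(1)[OF \<xi>(1,2)] \<xi>(3) by (simp add: schmear_def orb)
  qed
qed

lemma pclass_maps:
  assumes \<xi>: "\<xi> \<in> bdG" and s: "s \<in> slopes"
  shows "schmear_map1 X1 x1 X2 x2 (pclass (\<xi>, s)) = orbit_boundary_map X1 \<phi>1 x1 \<xi>"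
    "schmear_map2 X1 x1 X2 x2 (pclass (\<xi>, s)) = orbit_boundary_map X2 \<phi>2 x2 \<xi>"
  unfolding schmear_map1_def schmear_map2_def pclass(2)[OF assms]
  by (rule A1.endpoint_bray[OF \<xi> slopes_range(1)[OF s]], simp add: pray_def,
    rule A2.endpoint_bray[OF \<xi> slopes_range(3)[OF s]], simp add: pray_def)

text \<open>The first component alone detects both parameters: distances from \<open>x1\<close> give
  the speeds, and moving along the second ray to time \<open>s * t\<close> allows comparing the
  boundary points. Each of the two steps costs one distance in the product.\<close>

lemma pray_dist1:
  assumes \<xi>: "\<xi> \<in> bdG" "\<eta> \<in> bdG" and s: "s \<in> slopes" "s' \<in> slopes" and t: "0 \<le> t"
  shows "\<bar>s * t - s' * t\<bar> \<le> dP (pray \<xi> s t) (pray \<eta> s' t)"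
    "mdist X1 (A1.bray \<xi> (s * t)) (A1.bray \<eta> (s * t)) \<le> 2 * dP (pray \<xi> s t) (pray \<eta> s' t)"
proof -
  define D where "D = dP (pray \<xi> s t) (pray \<eta> s' t)"
  have 1: "mdist X1 (A1.bray \<xi> (s * t)) (A1.bray \<eta> (s' * t)) \<le> D"
    using dP_ge(1)[of "pray \<xi> s t" "pray \<eta> s' t"] t unfolding D_def by (simp add: pray_def del: mdist_prod_metric)
  have st: "0 \<le> s * t" "0 \<le> s' * t" using slopes_range(1)[OF s(1)] slopes_range(1)[OF s(2)] t by simp_all
  note M = A1.bray_in[OF \<xi>(1) st(1)] A1.bray_in[OF \<xi>(2) st(1)] A1.bray_in[OF \<xi>(2) st(2)]
  have "mdist X1 x1 (A1.bray \<xi> (s * t)) = s * t" "mdist X1 x1 (A1.bray \<eta> (s' * t)) = s' * t"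
    using geodesic_ray_dist[OF A1.bray(1)[OF \<xi>(1)], of 0 "s * t"] geodesic_ray_dist[OF A1.bray(1)[OF \<xi>(2)], of 0 "s' * t"]
      st A1.bray(2)[OF \<xi>(1)] A1.bray(2)[OF \<xi>(2)] by auto
  then show 2: "\<bar>s * t - s' * t\<bar> \<le> dP (pray \<xi> s t) (pray \<eta> s' t)"
    using 1 mdist_triangle[OF A1.x0 M(1,3)] mdist_triangle[OF A1.x0 M(3,1)]
      mdist_commute[of X1 "A1.bray \<eta> (s' * t)" "A1.bray \<xi> (s * t)"] unfolding D_def by linarith
  have "mdist X1 (A1.bray \<eta> (s' * t)) (A1.bray \<eta> (s * t)) = \<bar>s * t - s' * t\<bar>"
    using geodesic_ray_dist[OF A1.bray(1)[OF \<xi>(2)] st(2,1)] by simp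
  then show "mdist X1 (A1.bray \<xi> (s * t)) (A1.bray \<eta> (s * t)) \<le> 2 * dP (pray \<xi> s t) (pray \<eta> s' t)"
    using 1 2 mdist_triangle[OF M(1,3,2)] unfolding D_def by linarith
qed

lemma pclass_inj:
  assumes \<xi>: "\<xi> \<in> bdG" "\<eta> \<in> bdG" and s: "s \<in> slopes" "s' \<in> slopes" and eq: "pclass (\<xi>, s) = pclass (\<eta>, s')"
  shows "\<xi> = \<eta>" "s = s'"
proof -
  have pe: "pray \<xi> s = pray \<eta> s'" using pclass(2)[OF \<xi>(1) s(1)] pclass(2)[OF \<xi>(2) s(2)] eq by simp
  have d0: "dP (pray \<xi> s t) (pray \<eta> s' t) = 0" if "0 \<le> t" for t
    using geodesic_ray_in[OF pray_ray(1)[OF \<xi>(2) s(2)] that] unfolding pe by (rule mdist_self)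
  show "s = s'" using pray_dist1(1)[OF \<xi> s, of 1] d0[of 1] by simp
  note sr = slopes_range[OF s(1)]
  have "A1.bray \<xi> = A1.bray \<eta>"
  proof (rule geodesic_ray_eqI[OF A1.bray(1)[OF \<xi>(1)] A1.bray(1)[OF \<xi>(2)]])
    fix t :: real assume t: "0 \<le> t"
    then have ts: "0 \<le> t / s" using sr by simp
    have "mdist X1 (A1.bray \<xi> t) (A1.bray \<eta> t) \<le> 0"
      using pray_dist1(2)[OF \<xi> s ts] d0[OF ts] sr by simp
    then show "A1.bray \<xi> t = A1.bray \<eta> t"
      using A1.bray_in[OF \<xi>(1) t] A1.bray_in[OF \<xi>(2) t] by (metis antisym mdist_nonneg mdist_zero)
  qed
  then show "\<xi> = \<eta>" using A1.bray_inj \<xi> by blast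
qed

lemma slopes_memI: "bdG \<noteq> {} \<longrightarrow> slopes = {a..b} \<Longrightarrow> \<xi> \<in> bdG \<Longrightarrow> s \<in> {a..b} \<Longrightarrow> s \<in> slopes"
  by (metis empty_iff)

lemma pclass_continuous:
  assumes I: "bdG \<noteq> {} \<longrightarrow> slopes = {a..b}"
  shows "continuous_map (prod_topology (group_boundary_topology G S) (top_of_set {a..b}))
    (visual_topology (prod_metric X1 X2) (x1, x2)) pclass"
  unfolding continuous_map_def
proof (intro conjI allI impI)
  have sl: "s \<in> slopes" if "\<xi> \<in> bdG" "s \<in> {a..b}" for \<xi> s
    using slopes_memI[OF I that] .
  show "pclass \<in> topspace (prod_topology (group_boundary_topology G S) (top_of_set {a..b})) \<rightarrow>
      topspace (visual_topology (prod_metric X1 X2) (x1, x2))"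
    using pclass(1) sl unfolding P.topspace_visual[OF xP] by (auto simp: topspace_gromov_topology)
  fix V assume V: "openin (visual_topology (prod_metric X1 X2) (x1, x2)) V"
  show "openin (prod_topology (group_boundary_topology G S) (top_of_set {a..b}))
      {z \<in> topspace (prod_topology (group_boundary_topology G S) (top_of_set {a..b})). pclass z \<in> V}"
    unfolding openin_prod_topology_alt
  proof (intro allI impI)
    fix \<xi> s assume "(\<xi>, s) \<in> {z \<in> topspace (prod_topology (group_boundary_topology G S) (top_of_set {a..b})). pclass z \<in> V}"
    then have \<xi>: "\<xi> \<in> bdG" and sI: "s \<in> {a..b}" and zV: "pclass (\<xi>, s) \<in> V" by (auto simp: topspace_gromov_topology)
    have s: "s \<in> slopes" using sl \<xi> sI by blast
    note sr = slopes_range[OF s]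
    obtain r e where re: "r > 0" "e > 0" and near: "\<forall>\<eta>\<in>visual_boundary (prod_metric X1 X2).
       dP (ray_from (prod_metric X1 X2) (x1, x2) \<eta> r) (ray_from (prod_metric X1 X2) (x1, x2) (pclass (\<xi>, s)) r) < e \<longrightarrow> \<eta> \<in> V"
      using V zV unfolding P.openin_visual_iff[OF xP] by blast
    \<comment> \<open>Each factor gets e / 4 for the change of boundary point, and \<open>f\<close>
      bounds the effect of the change of speeds by e / 2 in total.\<close>
    define U where "U = {\<eta> \<in> bdG. mdist X1 (A1.bray \<eta> (s * r)) (A1.bray \<xi> (s * r)) < e / 4} \<inter>
      {\<eta> \<in> bdG. mdist X2 (A2.bray \<eta> (co s * r)) (A2.bray \<xi> (co s * r)) < e / 4}"
    have r1: "0 \<le> s * r" "0 \<le> co s * r" using sr re by auto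
    have U: "openin (group_boundary_topology G S) U"
      unfolding U_def
      by (intro openin_Int A1.openin_bray_ball A2.openin_bray_ball r1 A1.bray_in[OF \<xi> r1(1)] A2.bray_in[OF \<xi> r1(2)])
    have \<xi>U: "\<xi> \<in> U"
      unfolding U_def using \<xi> re A1.bray_in[OF \<xi> r1(1)] A2.bray_in[OF \<xi> r1(2)] by simp
    define f where "f s' = \<bar>s' - s\<bar> * r + \<bar>co s' - co s\<bar> * r" for s'
    have "continuous_on UNIV f" unfolding f_def co_def by (intro continuous_intros)
    then have "open (f -` {..<e/2})" by (intro open_vimage) auto
    then have B: "openin (top_of_set {a..b}) ({a..b} \<inter> f -` {..<e/2})" by (simp add: openin_open_Int)
    have sB: "s \<in> {a..b} \<inter> f -` {..<e/2}" using sI re by (simp add: f_def)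
    have "U \<times> ({a..b} \<inter> f -` {..<e/2}) \<subseteq>
        {z \<in> topspace (prod_topology (group_boundary_topology G S) (top_of_set {a..b})). pclass z \<in> V}"
    proof
      fix z assume "z \<in> U \<times> ({a..b} \<inter> f -` {..<e/2})"
      then obtain \<eta> s' where z: "z = (\<eta>, s')" and \<eta>: "\<eta> \<in> U" and s': "s' \<in> {a..b}" "f s' \<in> {..<e/2}" by blast
      have \<eta>b: "\<eta> \<in> bdG" using \<eta> by (simp add: U_def)
      have s's: "s' \<in> slopes" using sl \<eta>b s'(1) by blast
      note sr' = slopes_range[OF s's]
      have r2: "0 \<le> s' * r" "0 \<le> co s' * r" using sr' re by auto
      have "mdist X1 (A1.bray \<eta> (s' * r)) (A1.bray \<eta> (s * r)) = \<bar>s' * r - s * r\<bar>"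
        using geodesic_ray_dist[OF A1.bray(1)[OF \<eta>b] r2(1) r1(1)] .
      also have "\<dots> = \<bar>s' - s\<bar> * r" using re by (simp add: abs_mult flip: left_diff_distrib)
      finally have 1: "mdist X1 (A1.bray \<eta> (s' * r)) (A1.bray \<xi> (s * r)) < \<bar>s' - s\<bar> * r + e / 4"
        using mdist_triangle[OF A1.bray_in[OF \<eta>b r2(1)] A1.bray_in[OF \<eta>b r1(1)] A1.bray_in[OF \<xi> r1(1)]] \<eta>
        by (simp add: U_def)
      have "mdist X2 (A2.bray \<eta> (co s' * r)) (A2.bray \<eta> (co s * r)) = \<bar>co s' * r - co s * r\<bar>"
        using geodesic_ray_dist[OF A2.bray(1)[OF \<eta>b] r2(2) r1(2)] .
      also have "\<dots> = \<bar>co s' - co s\<bar> * r" using re by (simp add: abs_mult flip: left_diff_distrib)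
      finally have 2: "mdist X2 (A2.bray \<eta> (co s' * r)) (A2.bray \<xi> (co s * r)) < \<bar>co s' - co s\<bar> * r + e / 4"
        using mdist_triangle[OF A2.bray_in[OF \<eta>b r2(2)] A2.bray_in[OF \<eta>b r1(2)] A2.bray_in[OF \<xi> r1(2)]] \<eta>
        by (simp add: U_def)
      have "dP (pray \<eta> s' r) (pray \<xi> s r) \<le>
          mdist X1 (A1.bray \<eta> (s' * r)) (A1.bray \<xi> (s * r)) + mdist X2 (A2.bray \<eta> (co s' * r)) (A2.bray \<xi> (co s * r))"
        using dP_le[of "pray \<eta> s' r" "pray \<xi> s r"] re by (simp add: pray_def del: mdist_prod_metric)
      also have "\<dots> < e" using 1 2 s'(2) by (simp add: f_def)
      finally have "pclass (\<eta>, s') \<in> V"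
        using near pclass[OF \<eta>b s's] pclass(2)[OF \<xi> s] by auto
      then show "z \<in> {z \<in> topspace (prod_topology (group_boundary_topology G S) (top_of_set {a..b})). pclass z \<in> V}"
        using \<eta>b s' z by (simp add: topspace_gromov_topology)
    qed
    then show "\<exists>U W. openin (group_boundary_topology G S) U \<and> openin (top_of_set {a..b}) W \<and> \<xi> \<in> U \<and> s \<in> W \<and>
        U \<times> W \<subseteq> {z \<in> topspace (prod_topology (group_boundary_topology G S) (top_of_set {a..b})). pclass z \<in> V}"
      using U \<xi>U B sB by blast
  qed
qed

text \<open>Closeness of product rays at one suitable time forces closeness of the speeds and,
  through \<open>bray_close_nbhd\<close>, closeness of the boundary points.\<close>

lemma pclass_open:
  assumes I: "bdG \<noteq> {} \<longrightarrow> slopes = {a..b}"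
    and O: "openin (prod_topology (group_boundary_topology G S) (top_of_set {a..b})) Q"
  shows "openin (schmear_topology G X1 \<phi>1 x1 X2 \<phi>2 x2) (pclass ` Q)"
proof (subst openin_subopen, intro ballI)
  let ?\<Lambda> = "schmear G X1 \<phi>1 x1 X2 \<phi>2 x2"
  have sl: "s \<in> slopes" if "\<xi> \<in> bdG" "s \<in> {a..b}" for \<xi> s
    using slopes_memI[OF I that] .
  fix \<zeta> assume "\<zeta> \<in> pclass ` Q"
  then obtain \<xi> s where z: "\<zeta> = pclass (\<xi>, s)" "(\<xi>, s) \<in> Q" by auto
  obtain A B where AB: "openin (group_boundary_topology G S) A" "openin (top_of_set {a..b}) B" "\<xi> \<in> A" "s \<in> B" "A \<times> B \<subseteq> Q"
    using O[unfolded openin_prod_topology_alt, rule_format, OF z(2)] by (elim exE conjE) (rule that)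
  have "A \<subseteq> bdG" using AB(1) by (simp add: openin_gromov_topology)
  then have \<xi>: "\<xi> \<in> bdG" using AB(3) by (rule subsetD)
  have sI: "s \<in> {a..b}" using AB(2,4) openin_imp_subset by blast
  have s: "s \<in> slopes" using sl \<xi> sI by blast
  note sr = slopes_range[OF s]
  obtain R where R: "gromov_nbhd (word_metric G S) \<one> \<xi> R \<subseteq> A" using AB(1,3) unfolding openin_gromov_topology by blast
  obtain \<epsilon> where \<epsilon>: "0 < \<epsilon>" "\<And>s'. s' \<in> {a..b} \<Longrightarrow> \<bar>s' - s\<bar> < \<epsilon> \<Longrightarrow> s' \<in> B"
    using AB(2,4) unfolding openin_euclidean_subtopology_iff dist_real_def by blast
  obtain T where T: "0 < T" "\<forall>t\<ge>T. \<forall>\<xi>\<in>bdG. \<forall>\<eta>\<in>bdG. mdist X1 (A1.bray \<xi> t) (A1.bray \<eta> t) \<le> 2 \<longrightarrow>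
      \<eta> \<in> gromov_nbhd (word_metric G S) \<one> \<xi> R"
    using A1.bray_close_nbhd[of R] by blast
  \<comment> \<open>At product time \<open>r\<close> the first component has reached time
    \<open>T\<close> in \<open>X1\<close>.\<close>
  define r where "r = T / s"
  have r: "0 < r" "s * r = T" using T sr by (auto simp: r_def)
  \<comment> \<open>By \<open>pray_dist1\<close> the bound 1 gives distance at most 2 in
    \<open>X1\<close>, and the bound \<open>\<epsilon> * r\<close> gives speeds less than \<epsilon>
    apart.\<close>
  define e where "e = min 1 (\<epsilon> * r)"
  have e: "0 < e" "e \<le> 1" "e \<le> \<epsilon> * r" using \<epsilon> r by (auto simp: e_def)
  define V where "V = {\<eta> \<in> visual_boundary (prod_metric X1 X2). dP (ray_from (prod_metric X1 X2) (x1, x2) \<eta> r) (pray \<xi> s r) < e}"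
  have prM: "pray \<xi> s r \<in> mspace (prod_metric X1 X2)" using geodesic_ray_in[OF pray_ray(1)[OF \<xi> s]] r by simp
  have V: "openin (visual_topology (prod_metric X1 X2) (x1, x2)) V"
    unfolding V_def by (rule P.openin_visual_ball[OF xP r(1) prM])
  have zV: "\<zeta> \<in> V \<inter> ?\<Lambda>"
  proof
    show "\<zeta> \<in> V" unfolding V_def using pclass[OF \<xi> s] z(1) e mdist_self[OF prM] by simp
    show "\<zeta> \<in> ?\<Lambda>" using schmear_iff \<xi> s z(1) by blast
  qed
  have "V \<inter> ?\<Lambda> \<subseteq> pclass ` Q"
  proof
    fix \<eta>' assume h: "\<eta>' \<in> V \<inter> ?\<Lambda>"
    then obtain \<eta> s' where \<eta>: "\<eta> \<in> bdG" "s' \<in> slopes" "\<eta>' = pclass (\<eta>, s')" using schmear_iff by blast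
    have "dP (pray \<eta> s' r) (pray \<xi> s r) < e" using h \<eta>(3) pclass(2)[OF \<eta>(1,2)] by (simp add: V_def del: mdist_prod_metric)
    then have d: "dP (pray \<xi> s r) (pray \<eta> s' r) < e" by (simp only: mdist_commute)
    have "\<bar>s * r - s' * r\<bar> < \<epsilon> * r" using pray_dist1(1)[OF \<xi> \<eta>(1) s \<eta>(2), of r] d e r by linarith
    moreover have "\<bar>s * r - s' * r\<bar> = \<bar>s - s'\<bar> * r" using r(1) by (simp add: abs_mult flip: left_diff_distrib)
    ultimately have "\<bar>s' - s\<bar> < \<epsilon>" using r(1) by (simp add: abs_minus_commute)
    then have B: "s' \<in> B" using \<epsilon>(2) \<eta>(1,2) I by blast
    have "mdist X1 (A1.bray \<xi> (s * r)) (A1.bray \<eta> (s * r)) \<le> 2" using pray_dist1(2)[OF \<xi> \<eta>(1) s \<eta>(2), of r] d e r by linarith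
    then have "\<eta> \<in> gromov_nbhd (word_metric G S) \<one> \<xi> R" using T(2) \<xi> \<eta>(1) r by auto
    then show "\<eta>' \<in> pclass ` Q" using \<eta>(3) B R AB(5) by blast
  qed
  moreover have "openin (schmear_topology G X1 \<phi>1 x1 X2 \<phi>2 x2) (V \<inter> ?\<Lambda>)"
    unfolding schmear_topology_def using V by (auto simp: openin_subtopology)
  ultimately show "\<exists>T. openin (schmear_topology G X1 \<phi>1 x1 X2 \<phi>2 x2) T \<and> \<zeta> \<in> T \<and> T \<subseteq> pclass ` Q"
    using zV by blast
qed

theorem schmear_homeomorphism:
  "\<exists>(a::real) b h. a \<le> b \<and>
    homeomorphic_map (prod_topology (group_boundary_topology G S) (top_of_set {a..b}))
      (schmear_topology G X1 \<phi>1 x1 X2 \<phi>2 x2) h \<and>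
    (\<forall>\<xi>\<in>group_boundary G S. \<forall>s\<in>{a..b}.
      schmear_map1 X1 x1 X2 x2 (h (\<xi>, s)) = orbit_boundary_map X1 \<phi>1 x1 \<xi> \<and>
      schmear_map2 X1 x1 X2 x2 (h (\<xi>, s)) = orbit_boundary_map X2 \<phi>2 x2 \<xi>)"
proof -
  let ?\<Lambda> = "schmear G X1 \<phi>1 x1 X2 \<phi>2 x2"
  obtain a b where ab: "a \<le> b" and I: "bdG \<noteq> {} \<longrightarrow> slopes = {a..b}" using slopes_segment by blast
  have sl: "s \<in> slopes" if "\<xi> \<in> bdG" "s \<in> {a..b}" for \<xi> s
    using slopes_memI[OF I that] .
  let ?Q = "prod_topology (group_boundary_topology G S) (top_of_set {a..b})"
  have topQ: "topspace ?Q = bdG \<times> {a..b}" by (simp add: topspace_gromov_topology)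
  have im: "pclass ` (bdG \<times> {a..b}) = ?\<Lambda>"
  proof
    show "pclass ` (bdG \<times> {a..b}) \<subseteq> ?\<Lambda>" using schmear_iff sl by blast
    show "?\<Lambda> \<subseteq> pclass ` (bdG \<times> {a..b})" using schmear_iff I by blast
  qed
  have "?\<Lambda> \<subseteq> visual_boundary (prod_metric X1 X2)" by (auto simp: schmear_def)
  then have top\<Lambda>: "topspace (schmear_topology G X1 \<phi>1 x1 X2 \<phi>2 x2) = ?\<Lambda>"
    unfolding schmear_topology_def topspace_subtopology P.topspace_visual[OF xP] by blast
  have "homeomorphic_map ?Q (schmear_topology G X1 \<phi>1 x1 X2 \<phi>2 x2) pclass"
  proof (rule bijective_open_imp_homeomorphic_map)
    show "continuous_map ?Q (schmear_topology G X1 \<phi>1 x1 X2 \<phi>2 x2) pclass"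
      unfolding schmear_topology_def continuous_map_in_subtopology topQ
      using pclass_continuous[OF I] im by auto
    show "open_map ?Q (schmear_topology G X1 \<phi>1 x1 X2 \<phi>2 x2) pclass"
      unfolding open_map_def using pclass_open[OF I] by blast
    show "pclass ` topspace ?Q = topspace (schmear_topology G X1 \<phi>1 x1 X2 \<phi>2 x2)"
      unfolding topQ top\<Lambda> by (rule im)
    show "inj_on pclass (topspace ?Q)"
      unfolding topQ by (auto intro!: inj_onI dest: pclass_inj[rotated -1] simp: sl)
  qed
  then show ?thesis using ab pclass_maps[OF _ sl]
    by (intro exI[of _ a] exI[of _ b] exI[of _ pclass] conjI ballI) auto
qed

end

theorem corollary4:
  fixes G :: "('g, 'm) monoid_scheme" and S :: "'g set"
    and X1 :: "'a metric" and X2 :: "'b metric"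
    and \<phi>1 :: "'g \<Rightarrow> 'a \<Rightarrow> 'a" and \<phi>2 :: "'g \<Rightarrow> 'b \<Rightarrow> 'b"
    and x1 :: 'a and x2 :: 'b
  assumes "hyperbolic_group G S"
    and "proper_metric X1" and "CAT0 X1" and "acts_geometrically G X1 \<phi>1" and "x1 \<in> mspace X1"
    and "proper_metric X2" and "CAT0 X2" and "acts_geometrically G X2 \<phi>2" and "x2 \<in> mspace X2"
  shows "\<exists>(a::real) b h. a \<le> b \<and>
    homeomorphic_map
      (prod_topology (group_boundary_topology G S) (top_of_set {a..b}))
      (schmear_topology G X1 \<phi>1 x1 X2 \<phi>2 x2) h \<and>
    (\<forall>\<xi>\<in>group_boundary G S. \<forall>s\<in>{a..b}.
      schmear_map1 X1 x1 X2 x2 (h (\<xi>, s)) = orbit_boundary_map X1 \<phi>1 x1 \<xi> \<and>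
      schmear_map2 X1 x1 X2 x2 (h (\<xi>, s)) = orbit_boundary_map X2 \<phi>2 x2 \<xi>)"
proof -
  obtain \<delta> where "word_hyperbolic_group G S \<delta>" using hyperbolic_group_word_hyperbolic assms(1) by blast
  then interpret word_hyperbolic_group G S \<delta> .
  interpret X1: convex_space X1 using assms(2,3) by (rule convex_space_if_proper_CAT0)
  interpret X2: convex_space X2 using assms(6,7) by (rule convex_space_if_proper_CAT0)
  interpret geometric_pair G S \<delta> X1 \<phi>1 x1 X2 \<phi>2 x2
    by unfold_locales (use assms in auto)
  show ?thesis by (rule schmear_homeomorphism)
qed

end
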